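(* Let $n\ge 1$ and let $\lambda,\mu$ be partitions of $n$. Let $ABC(\lambda,\mu)$ denote the set of affine Bruhat counter-tableaux (with $k=n$) of $n$-weight $\mu$ and inner shape $\mathfrak{c}(\lambda)$, and let $SSYT(\lambda,\mu)$ denote the set of semistandard tableaux of shape $\lambda$ and weight $\mu$. Then there is a bijection $ABC(\lambda,\mu)\to SSYT(\lambda,\mu)$ which is charge preserving, i.e. $ch(A)=ch(T)$ whenever $A\mapsto T$.
   Context: Partitions are drawn as Ferrers diagrams in French convention: $\lambda=(\lambda_1\ge\lambda_2\ge\cdots)$ has $\lambda_i$ left-justified cells in its $i$-th row counted from the bottom. The hook length of a cell is $1$ plus the number of cells to its right in its row plus the number of cells above it in its column. Fix an integer $k>0$ (in the claim, $k=n$). A $(k+1)$-core is a partition having no cell of hook length $k+1$; $\deg(\kappa)$ is the number of cells of $\kappa$ of hook length $\le k$. $\mathcal P^k$ is the set of partitions with $\lambda_1\le k$. For a $(k+1)$-core $\kappa$, the sequence whose $i$-th term is the number of cells in row $i$ of $\kappa$ with hook length $\le k$ is a partition in $\mathcal P^k$; this is a bijection from $(k+1)$-cores to $\mathcal P^k$, and $\mathfrak c:\mathcal P^k\to\{(k+1)\text{-cores}\}$ denotes its inverse. Strong order on cores: $\rho\lessdot_B\gamma$ iff $\rho\subseteq\gamma$ and $\deg(\gamma)=\deg(\rho)+1$. For a core $\lambda$, $(k+\lambda_1,\lambda)$ denotes the partition with first part $k+\lambda_1$ followed by the parts of $\lambda$. Bottom strong strip: for cores $\nu\subseteq(k+\lambda_1,\lambda)$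 and an integer $0\le m\le k-1$, the skew shape $(k+\lambda_1,\lambda)/\nu$ is a bottom strong strip of length $m$ if there is a saturated chain of cores $\nu=\nu^0\lessdot_B\nu^1\lessdot_B\cdots\lessdot_B\nu^m=(k+\lambda_1,\lambda)$ such that $(k+\lambda_1,\lambda)/\nu$ is a horizontal strip (no two cells in one column) and, for each $1\le j\le m$, the rightmost cell of the bottom (first) row of $\nu^j$ lies in $\nu^j/\nu^{j-1}$. Such a chain is unique. Affine Bruhat counter-tableau (ABC): let $\alpha=(\alpha_1,\dots,\alpha_\ell)$ with $1\le\alpha_i\le k$. An ABC $A$ of $k$-weight $\alpha$ is determined by $(k+1)$-cores $\emptyset=\lambda^{(0)},\lambda^{(1)},\dots,\lambda^{(\ell)}$ such that for each $i$, $(k+\lambda^{(i-1)}_1,\lambda^{(i-1)})/\lambda^{(i)}$ is a bottom strong strip of length $k-\alpha_i$. $A$ is a diagram with $\ell$ left-justified rows numbered $1,\dots,\ell$ from top to bottom (columns numbered $1,2,\dots$ from the left), where for each $i$ rows $1,\dots,i$, viewed with row $i$ as the bottom row, form the Ferrers diagram of $(k+\lambda^{(i-1)}_1,\lambda^{(i-1)})$; the cells of $(k+\lambda^{(i-1)}_1,\lambda^{(i-1)})/\lambda^{(i)}$ are filled with the letter $i$, and the cells of $\lambda^{(\ell)}$ are empty. The inner shape of $A$ is $\lambda^{(\ell)}$. The cells filled with $i$ are partitioned into ribbons (here runs of consecutive cells in one row), namely the connected components of the $\nu^j/\nu^{j-1}$ from the chain for the $i$-th strip; these are called $i$-ribbons.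 The head of a ribbon is its rightmost cell and its tail its leftmost cell. $A$ has partition $k$-weight $\mu$ if $\alpha=\mu$ is a partition. Extension: for an ABC $A$ of partition $k$-weight $\mu$, let $s_i$ be the total size and $r_i$ the number of $i$-ribbons in row $i$ of $A$. $ext(A)$ is obtained by appending $k$ cells containing $i$ at the right end of each row $i$, where the first $\mu_i-s_i+r_i+1$ appended cells form one $i$-ribbon and each remaining appended cell is an $i$-ribbon of size one. Let $V_A$ be the set of cells $(i,c)$ (row $i$, column $c$) of $ext(A)$ lying in an $i$-ribbon of row $i$ and not equal to that ribbon's tail. Sets $E_A^r$, $r=1,\dots,\mu_1$, constructed successively: $E_A^r$ contains the cell $(1,k+\mu_1+2-r)$; for $i\ge2$, $(i,c_i)\in E_A^r$ iff $E_A^r$ contains a cell $(i-1,c_{i-1})$ and $(i,c_i)\in V_A\setminus\bigcup_{p<r}E_A^p$ with $(c_{i-1}-c_i+k)\bmod (k+1)=\min\{(c_{i-1}-x+k)\bmod(k+1): (i,x)\in V_A\setminus\bigcup_{p<r}E_A^p\}$. Reading words: given cells $(1,c_1),\dots,(m,c_m)$ (one per row $1,\dots,m$), build a permutation of $\{1,\dots,m\}$ starting from the word $1$ and, for $i=2,\dots,m$, inserting $i$ immediately to the right of the letter $j$, where $j<i$ is chosen among indices with $c_j<c_i$ so that $c_j$ is maximal (ties broken by the largest $j$); if no $j<i$ has $c_j<c_i$, insert $i$ at the beginning. $w_r(A)$ is the permutation so obtained from $E_A^r$. Charge: for a permutation $w$ of $\{1,\dots,n\}$, $ch(w)=\sum_{i=1}^n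 c_i$ with $c_1=0$ and $c_i=c_{i-1}+1$ if $i$ appears to the right of $i-1$ in $w$, $c_i=c_{i-1}$ otherwise. For a word $w$ whose content is a partition: the first charge subword is found by scanning from the right end of $w$ leftward, marking the first $1$, then continuing leftward (cyclically wrapping from the beginning to the end) marking the first $2$, and so on up to the largest letter; the marked letters in their order in $w$ form a permutation; remove them and repeat to get the subsequent charge subwords. $ch(w)$ is the sum of the charges of its charge subwords. A semistandard tableau is a filling of a Ferrers shape with positive integers weakly increasing along rows (left to right) and strictly increasing up columns; its weight has $i$-th entry the number of $i$'s; its reading word is the concatenation of its rows from the top row to the bottom row, each read left to right, and $ch(T)$ is the charge of its reading word. For an ABC $A$ of partition $k$-weight $\mu$, $ch(A)=\sum_{r=1}^{\mu_1}ch(w_r(A))$. *)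

theory Defs
  imports Main
begin

section \<open>Partitions (French convention, rows counted from the bottom, 1-indexed)\<close>

definition is_partition :: "nat list \<Rightarrow> bool" where
  "is_partition p \<longleftrightarrow> sorted_wrt (\<ge>) p \<and> 0 \<notin> set p"

definition part :: "nat list \<Rightarrow> nat \<Rightarrow> nat" where
  "part p i = (if 1 \<le> i \<and> i \<le> length p then p ! (i - 1) else 0)"

definition cells :: "nat list \<Rightarrow> (nat \<times> nat) set" where
  "cells p = {(i, c). 1 \<le> i \<and> 1 \<le> c \<and> c \<le> part p i}"

definition hook :: "nat list \<Rightarrow> nat \<Rightarrow> nat \<Rightarrow> nat" where
  "hook p i c = 1 + (part p i - c) + card {j. i < j \<and> c \<le> part p j}"

definition is_core :: "nat \<Rightarrow> nat list \<Rightarrow> bool" where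
  "is_core k p \<longleftrightarrow> is_partition p \<and> (\<forall>(i, c) \<in> cells p. hook p i c \<noteq> k + 1)"

definition deg :: "nat \<Rightarrow> nat list \<Rightarrow> nat" where
  "deg k p = card {(i, c) \<in> cells p. hook p i c \<le> k}"

definition kbounded :: "nat \<Rightarrow> nat list \<Rightarrow> nat list" where
  "kbounded k p = filter (\<lambda>x. 0 < x)
     (map (\<lambda>i. card {c. 1 \<le> c \<and> c \<le> part p i \<and> hook p i c \<le> k}) [1..<length p + 1])"

definition core_of :: "nat \<Rightarrow> nat list \<Rightarrow> nat list" where
  "core_of k la = (THE kap. is_core k kap \<and> kbounded k kap = la)"

definition strong_cover :: "nat \<Rightarrow> nat list \<Rightarrow> nat list \<Rightarrow> bool" where
  "strong_cover k rho gam \<longleftrightarrow> is_core k rho \<and> is_core k gam \<and> cells rho \<subseteq> cells gam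
     \<and> deg k gam = deg k rho + 1"

definition bigp :: "nat \<Rightarrow> nat list \<Rightarrow> nat list" where
  "bigp k la = (k + part la 1) # la"

definition horiz_strip :: "nat list \<Rightarrow> nat list \<Rightarrow> bool" where
  "horiz_strip outer inner \<longleftrightarrow> (\<forall>c. card {i. (i, c) \<in> cells outer - cells inner} \<le> 1)"

definition bss_chain :: "nat \<Rightarrow> nat list \<Rightarrow> nat list \<Rightarrow> nat \<Rightarrow> nat list list \<Rightarrow> bool" where
  "bss_chain k la nu m cs \<longleftrightarrow> length cs = m + 1 \<and> cs ! 0 = nu \<and> cs ! m = bigp k la
     \<and> (\<forall>j < m. strong_cover k (cs ! j) (cs ! (j + 1))
               \<and> (1, part (cs ! (j + 1)) 1) \<in> cells (cs ! (j + 1)) - cells (cs ! j))"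

definition is_bss :: "nat \<Rightarrow> nat list \<Rightarrow> nat list \<Rightarrow> nat \<Rightarrow> bool" where
  "is_bss k la nu m \<longleftrightarrow> is_core k nu \<and> is_core k (bigp k la) \<and> cells nu \<subseteq> cells (bigp k la)
     \<and> m \<le> k - 1 \<and> horiz_strip (bigp k la) nu \<and> (\<exists>cs. bss_chain k la nu m cs)"

text \<open>An ABC is represented by the list [\<lambda>^(1),...,\<lambda>^(\<ell>)] of cores (\<lambda>^(0) = \<emptyset>),
  which determines it.\<close>
definition lamA :: "nat list list \<Rightarrow> nat \<Rightarrow> nat list" where
  "lamA A i = (if i = 0 then [] else A ! (i - 1))"

definition is_ABC :: "nat \<Rightarrow> nat list \<Rightarrow> nat list list \<Rightarrow> bool" where
  "is_ABC k alpha A \<longleftrightarrow> length A = length alpha \<and> (\<forall>a \<in> set alpha. 1 \<le> a \<and> a \<le> k)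
     \<and> (\<forall>i \<in> {1..length A}. is_core k (lamA A i)
          \<and> is_bss k (lamA A (i - 1)) (lamA A i) (k - alpha ! (i - 1)))"

definition inner_shape :: "nat list list \<Rightarrow> nat list" where
  "inner_shape A = lamA A (length A)"

definition ABC_set :: "nat \<Rightarrow> nat list \<Rightarrow> nat list \<Rightarrow> nat list list set" where
  "ABC_set n la mu = {A. is_ABC n mu A \<and> inner_shape A = core_of n la}"

text \<open>The unique chain of the i-th strip.\<close>
definition chainA :: "nat \<Rightarrow> nat list \<Rightarrow> nat list list \<Rightarrow> nat \<Rightarrow> nat list list" where
  "chainA k mu A i = (SOME cs. bss_chain k (lamA A (i - 1)) (lamA A i) (k - mu ! (i - 1)) cs)"

definition runs :: "nat set \<Rightarrow> nat set set" where
  "runs S = {R. \<exists>a b. a \<le> b \<and> R = {a..b} \<and> R \<subseteq> S \<and> a - 1 \<notin> S \<and> b + 1 \<notin> S}"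

text \<open>The i-ribbons lying in row i of A (= bottom row of (k+\<lambda>^(i-1)_1,\<lambda>^(i-1))), as sets of
  columns: the components of \<nu>^j/\<nu>^(j-1) in that row.\<close>
definition ribbons_row :: "nat \<Rightarrow> nat list \<Rightarrow> nat list list \<Rightarrow> nat \<Rightarrow> nat set set" where
  "ribbons_row k mu A i = (let cs = chainA k mu A i in
     \<Union>j \<in> {1..k - mu ! (i - 1)}. runs {c. (1, c) \<in> cells (cs ! j) - cells (cs ! (j - 1))})"

definition rowlen :: "nat \<Rightarrow> nat list list \<Rightarrow> nat \<Rightarrow> nat" where
  "rowlen k A i = k + part (lamA A (i - 1)) 1"

definition s_size :: "nat \<Rightarrow> nat list \<Rightarrow> nat list list \<Rightarrow> nat \<Rightarrow> nat" where
  "s_size k mu A i = (\<Sum>R \<in> ribbons_row k mu A i. card R)"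

definition r_num :: "nat \<Rightarrow> nat list \<Rightarrow> nat list list \<Rightarrow> nat \<Rightarrow> nat" where
  "r_num k mu A i = card (ribbons_row k mu A i)"

text \<open>Size of the first appended ribbon in row i of ext(A): \<mu>_i - s_i + r_i + 1.\<close>
definition first_app :: "nat \<Rightarrow> nat list \<Rightarrow> nat list list \<Rightarrow> nat \<Rightarrow> nat" where
  "first_app k mu A i = mu ! (i - 1) + r_num k mu A i + 1 - s_size k mu A i"

text \<open>V_A: non-tail cells of the i-ribbons of row i of ext(A). Appended singleton ribbons consist
  only of their tail; the first appended ribbon occupies columns rowlen+1 .. rowlen+first_app.\<close>
definition V_A :: "nat \<Rightarrow> nat list \<Rightarrow> nat list list \<Rightarrow> (nat \<times> nat) set" where
  "V_A k mu A = {(i, c). 1 \<le> i \<and> i \<le> length A \<and>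
      ((\<exists>R \<in> ribbons_row k mu A i. c \<in> R \<and> c \<noteq> Min R)
       \<or> (rowlen k A i + 2 \<le> c \<and> c \<le> rowlen k A i + min (first_app k mu A i) k))}"

text \<open>Row i of E^r (as a set of columns), given the set Av = V_A minus the earlier E^p.\<close>
fun Erow :: "nat \<Rightarrow> nat list \<Rightarrow> (nat \<times> nat) set \<Rightarrow> nat \<Rightarrow> nat \<Rightarrow> nat set" where
  "Erow k mu Av r 0 = {}"
| "Erow k mu Av r (Suc 0) = {k + part mu 1 + 2 - r}"
| "Erow k mu Av r (Suc (Suc i)) =
     (let X = {x. (Suc (Suc i), x) \<in> Av} in
      {c \<in> X. \<exists>c' \<in> Erow k mu Av r (Suc i).
          (int c' - int c + int k) mod int (k + 1)
            = Min ((\<lambda>x. (int c' - int x + int k) mod int (k + 1)) ` X)})"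

definition Eset :: "nat \<Rightarrow> nat list \<Rightarrow> (nat \<times> nat) set \<Rightarrow> (nat \<times> nat) set \<Rightarrow> nat \<Rightarrow> (nat \<times> nat) set" where
  "Eset k mu V U r = {(i, c). 1 \<le> i \<and> c \<in> Erow k mu (V - U) r i}"

fun Eacc :: "nat \<Rightarrow> nat list \<Rightarrow> (nat \<times> nat) set \<Rightarrow> nat \<Rightarrow> (nat \<times> nat) set" where
  "Eacc k mu V 0 = {}"
| "Eacc k mu V (Suc r) = Eacc k mu V r \<union> Eset k mu V (Eacc k mu V r) (Suc r)"

definition E_A :: "nat \<Rightarrow> nat list \<Rightarrow> nat list list \<Rightarrow> nat \<Rightarrow> (nat \<times> nat) set" where
  "E_A k mu A r = Eset k mu (V_A k mu A) (Eacc k mu (V_A k mu A) (r - 1)) r"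

fun ins_after :: "nat \<Rightarrow> nat \<Rightarrow> nat list \<Rightarrow> nat list" where
  "ins_after j i [] = [i]"
| "ins_after j i (x # xs) = (if x = j then x # i # xs else x # ins_after j i xs)"

definition rw_step :: "(nat \<Rightarrow> nat) \<Rightarrow> nat list \<Rightarrow> nat \<Rightarrow> nat list" where
  "rw_step c w i = (let J = {j. 1 \<le> j \<and> j < i \<and> c j < c i} in
     if J = {} then i # w
     else (let cm = Max (c ` J); j = Max {j \<in> J. c j = cm} in ins_after j i w))"

text \<open>Reading word of a set of cells (1,c_1),...,(m,c_m), one per row.\<close>
definition reading_word :: "(nat \<times> nat) set \<Rightarrow> nat list" where
  "reading_word E = (let m = card E; c = (\<lambda>i. THE x. (i, x) \<in> E) in
     foldl (rw_step c) [1] [2..<m + 1])"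

definition idx :: "nat \<Rightarrow> nat list \<Rightarrow> nat" where
  "idx x xs = (LEAST p. p < length xs \<and> xs ! p = x)"

fun pc :: "nat list \<Rightarrow> nat \<Rightarrow> nat" where
  "pc w 0 = 0"
| "pc w (Suc 0) = 0"
| "pc w (Suc (Suc i)) = pc w (Suc i) + (if idx (i + 1) w < idx (i + 2) w then 1 else 0)"

definition perm_charge :: "nat list \<Rightarrow> nat" where
  "perm_charge w = (\<Sum>i = 1..length w. pc w i)"

definition ABC_charge :: "nat \<Rightarrow> nat list \<Rightarrow> nat list list \<Rightarrow> nat" where
  "ABC_charge k mu A = (\<Sum>r = 1..part mu 1. perm_charge (reading_word (E_A k mu A r)))"

definition nextpos :: "nat list \<Rightarrow> nat \<Rightarrow> nat \<Rightarrow> nat" where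
  "nextpos w p b = (if \<exists>q < p. w ! q = b then Max {q. q < p \<and> w ! q = b}
                    else Max {q. q < length w \<and> w ! q = b})"

fun marks :: "nat list \<Rightarrow> nat \<Rightarrow> nat \<Rightarrow> nat \<Rightarrow> nat set" where
  "marks w p b 0 = {}"
| "marks w p b (Suc f) = (let q = nextpos w p b in insert q (marks w q (Suc b) f))"

fun word_charge_aux :: "nat \<Rightarrow> nat list \<Rightarrow> nat" where
  "word_charge_aux 0 w = 0"
| "word_charge_aux (Suc f) w = (if w = [] then 0 else
     (let S = marks w (length w) 1 (Max (set w));
          sub = map (\<lambda>q. w ! q) (sorted_list_of_set S);
          rest = map (\<lambda>q. w ! q) (filter (\<lambda>q. q \<notin> S) [0..<length w])
      in perm_charge sub + word_charge_aux f rest))"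

definition word_charge :: "nat list \<Rightarrow> nat" where
  "word_charge w = word_charge_aux (length w) w"

text \<open>A tableau is a list of rows, bottom row first.\<close>
definition is_SSYT :: "nat list \<Rightarrow> nat list \<Rightarrow> nat list list \<Rightarrow> bool" where
  "is_SSYT la mu T \<longleftrightarrow> map length T = la
     \<and> (\<forall>row \<in> set T. sorted row \<and> (\<forall>x \<in> set row. 0 < x))
     \<and> (\<forall>i c. i + 1 < length T \<and> c < length (T ! (i + 1)) \<longrightarrow> T ! i ! c < T ! (i + 1) ! c)
     \<and> (\<forall>j \<ge> 1. count_list (concat T) j = part mu j)"

definition SSYT_set :: "nat list \<Rightarrow> nat list \<Rightarrow> nat list list set" where
  "SSYT_set la mu = {T. is_SSYT la mu T}"

definition tab_charge :: "nat list list \<Rightarrow> nat" where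
  "tab_charge T = word_charge (concat (rev T))"

end

theory Submission
  imports Defs
begin

text \<open>For \<open>k = n\<close> every core that occurs has degree at most \<open>k\<close>, hence is an ordinary partition of
  that size, and a bottom strong strip from \<open>\<lambda>\<close> to \<open>\<nu>\<close> amounts to \<open>\<nu>/\<lambda>\<close> being a horizontal strip. An
  ABC is thus the chain of shapes of a semistandard tableau \<open>T\<close>, and a count of the first parts along
  the saturated chain shows that row \<open>i\<close> of \<open>V\<^sub>A\<close> lists the contents of the letters \<open>i\<close> of \<open>T\<close>, shifted
  by \<open>k + 2\<close>. The sets \<open>E\<^sub>A\<^sup>r\<close> then select letters cyclically by decreasing content, whereas the charge
  subwords of \<open>T\<close> select them cyclically in reading order. Both selections agree: of two equal
  neighbours in a row the right one is always used first, and a used \<open>i\<close> with \<open>i + 1\<close> directly above it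
  has used up that \<open>i + 1\<close>; this rules out the cells on which the two orders differ.\<close>

section \<open>Cores with few small hooks\<close>

text \<open>Inside a chain the degree may exceed \<open>k\<close>. Each member is still a first row
  \<open>P\<close> below a partition \<open>\<rho>\<close> contained in \<open>la\<close>, and when
  \<open>P # \<rho>\<close> is a partition with \<open>sum_list \<rho> \<le> k\<close>, it is a core
  exactly if \<open>P + j = k + 1 + part \<rho> j\<close> for some \<open>j \<ge> 1\<close>. So
  \<open>P\<close> is \<open>k + 1\<close> plus the content of the end of row \<open>j\<close>; this
  is how contents enter. A ribbon in the bottom row ends at the first part of a chain member, so its
  non-tail cells are the columns whose left neighbour is not a first part. Going from that neighbour
  to the column itself adds the last unit of the shift \<open>k + 2\<close>. Contents in a partition
  of \<open>n\<close> differ by less than \<open>n\<close>, so reduction modulo \<open>n + 1\<close>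
  wraps at most once and loses nothing. The obstacle is that content order and reading order really
  differ on a full tableau: an \<open>i + 1\<close> may sit on top of a run of letters
  \<open>i\<close>, to the right of the \<open>i\<close> just chosen. No cell by cell comparison can
  succeed; an invariant of the cells left over by earlier rounds is required.\<close>

lemma part_zero [simp]: "part p 0 = 0"
  by (simp add: part_def)

lemma part_Nil [simp]: "part [] i = 0"
  by (simp add: part_def)

lemma part_Cons_1 [simp]: "part (x # p) (Suc 0) = x"
  by (simp add: part_def)

lemma part_Cons_Suc [simp]: "1 \<le> i \<Longrightarrow> part (x # p) (Suc i) = part p i"
  by (cases i) (auto simp: part_def)

lemma part_antimono:
  assumes "is_partition p" "1 \<le> i" "i \<le> j"
  shows "part p j \<le> part p i"
proof (cases "i < j \<and> j \<le> length p")
  case True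
  then have "p ! (j - 1) \<le> p ! (i - 1)"
    using assms sorted_wrt_nth_less[of "(\<ge>)" p "i - 1" "j - 1"] by (auto simp: is_partition_def)
  then show ?thesis using True assms by (simp add: part_def)
next
  case False
  then show ?thesis using assms by (auto simp: part_def)
qed

lemma part_pos_iff:
  assumes "is_partition p"
  shows "0 < part p i \<longleftrightarrow> 1 \<le> i \<and> i \<le> length p"
proof -
  have "0 < p ! (i - 1)" if "1 \<le> i" "i \<le> length p"
  proof -
    have "p ! (i - 1) \<in> set p" using that by simp
    then show ?thesis using assms unfolding is_partition_def by (metis gr0I)
  qed
  then show ?thesis by (auto simp: part_def)
qed

lemma partition_eqI:
  assumes "is_partition p" "is_partition q" "\<And>i. 1 \<le> i \<Longrightarrow> part p i = part q i"
  shows "p = q"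
proof -
  have "1 \<le> i \<and> i \<le> length p \<longleftrightarrow> 1 \<le> i \<and> i \<le> length q" for i
    using part_pos_iff[OF assms(1), of i] part_pos_iff[OF assms(2), of i] assms(3)[of i]
    by (cases "1 \<le> i") auto
  then have len: "length p = length q"
    by (metis One_nat_def Suc_leI le_antisym le_refl length_greater_0_conv list.size(3) not_gr_zero zero_le)
  show ?thesis
  proof (rule nth_equalityI[OF len])
    fix i assume "i < length p"
    then show "p ! i = q ! i" using assms(3)[of "Suc i"] len by (simp add: part_def)
  qed
qed

lemma is_partition_Nil [simp]: "is_partition []"
  by (simp add: is_partition_def)

lemma is_partition_Cons:
  "is_partition (x # p) \<longleftrightarrow> is_partition p \<and> 0 < x \<and> part p 1 \<le> x"
proof (cases p)
  case (Cons y q)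
  then show ?thesis by (auto simp: is_partition_def)
qed (auto simp: is_partition_def)

lemma sum_list_eq_sum_part:
  assumes "length p \<le> N"
  shows "sum_list p = (\<Sum>i = 1..N. part p i)"
proof -
  have "sum_list p = (\<Sum>i = 0..<length p. part p (Suc i))"
    by (simp add: sum_list_sum_nth part_def)
  also have "\<dots> = (\<Sum>i = 1..length p. part p i)"
    by (simp add: sum.atLeast1_atMost_eq atLeast0LessThan)
  also have "\<dots> = (\<Sum>i = 1..N. part p i)"
    using assms by (intro sum.mono_neutral_left) (auto simp: part_def)
  finally show ?thesis .
qed

lemma length_le_sum_list: "0 \<notin> set p \<Longrightarrow> length p \<le> sum_list (p :: nat list)"
  by (induction p) auto

lemma in_cells_iff [simp]: "(i, c) \<in> cells p \<longleftrightarrow> 1 \<le> i \<and> 1 \<le> c \<and> c \<le> part p i"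
  by (simp add: cells_def)

lemma cells_subset_iff: "cells p \<subseteq> cells q \<longleftrightarrow> (\<forall>i \<ge> 1. part p i \<le> part q i)"
proof
  assume A: "cells p \<subseteq> cells q"
  show "\<forall>i \<ge> 1. part p i \<le> part q i"
  proof (intro allI impI)
    fix i :: nat assume i: "1 \<le> i"
    show "part p i \<le> part q i"
    proof (cases "part p i = 0")
      case False
      then have "(i, part p i) \<in> cells p" using i by simp
      then have "(i, part p i) \<in> cells q" using A by blast
      then show ?thesis by simp
    qed simp
  qed
next
  assume A: "\<forall>i \<ge> 1. part p i \<le> part q i"
  show "cells p \<subseteq> cells q"
  proof (rule subrelI)
    fix i c assume "(i, c) \<in> cells p"
    then show "(i, c) \<in> cells q" using A[rule_format, of i] by simp
  qed
qed

section \<open>Columns, hook lengths and degree\<close>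

definition conj_part :: "nat list \<Rightarrow> nat \<Rightarrow> nat" where
  "conj_part p c = card {j. 1 \<le> j \<and> c \<le> part p j}"

lemma down_closed_eq_atLeastAtMost:
  fixes X :: "nat set"
  assumes "finite X" "\<And>j. j \<in> X \<Longrightarrow> 1 \<le> j" "\<And>i j. \<lbrakk>j \<in> X; 1 \<le> i; i \<le> j\<rbrakk> \<Longrightarrow> i \<in> X"
  shows "X = {1..card X}"
proof (cases "X = {}")
  case False
  have "i \<in> X \<longleftrightarrow> 1 \<le> i \<and> i \<le> Max X" for i
    using assms(2)[of i] assms(3)[OF Max_in[OF assms(1) False], of i] Max_ge[OF assms(1), of i] by blast
  then obtain m where "X = {1..m}" by (metis atLeastAtMost_iff set_eqI)
  then show ?thesis by simp
qed simp

lemma le_conj_part_iff: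
  assumes "is_partition p" "1 \<le> c" "1 \<le> j"
  shows "j \<le> conj_part p c \<longleftrightarrow> c \<le> part p j"
proof -
  let ?X = "{j. 1 \<le> j \<and> c \<le> part p j}"
  have "?X \<subseteq> {1..length p}" using assms(2) by (auto simp: part_def split: if_splits)
  then have "finite ?X" using finite_subset by blast
  moreover have "i \<in> ?X" if "l \<in> ?X" "1 \<le> i" "i \<le> l" for i l
    using part_antimono[OF assms(1) that(2,3)] that by simp
  ultimately have "?X = {1..card ?X}" by (intro down_closed_eq_atLeastAtMost) blast+
  then have "j \<in> ?X \<longleftrightarrow> j \<in> {1..card ?X}" by (rule arg_cong)
  then show ?thesis using assms(3) by (simp add: conj_part_def)
qed

lemma conj_part_le_length: "1 \<le> c \<Longrightarrow> conj_part p c \<le> length p"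
proof -
  assume "1 \<le> c"
  then have "{j. 1 \<le> j \<and> c \<le> part p j} \<subseteq> {1..length p}" by (auto simp: part_def split: if_splits)
  from card_mono[OF _ this] show ?thesis by (simp add: conj_part_def)
qed

lemma hook_Cons_1: "hook (P # \<rho>) 1 c = 1 + (P - c) + conj_part \<rho> c"
proof -
  have "{j. 1 < j \<and> c \<le> part (P # \<rho>) j} = Suc ` {j. 1 \<le> j \<and> c \<le> part \<rho> j}"
  proof (intro set_eqI iffI)
    fix j assume "j \<in> {j. 1 < j \<and> c \<le> part (P # \<rho>) j}"
    then obtain i where "j = Suc i" "1 \<le> i" "c \<le> part \<rho> i" by (cases j) auto
    then show "j \<in> Suc ` {j. 1 \<le> j \<and> c \<le> part \<rho> j}" by auto
  qed auto
  then show ?thesis by (simp add: hook_def conj_part_def card_image)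
qed

lemma hook_Cons_Suc:
  assumes "1 \<le> i" shows "hook (P # \<rho>) (Suc i) c = hook \<rho> i c"
proof -
  have "{j. Suc i < j \<and> c \<le> part (P # \<rho>) j} = Suc ` {j. i < j \<and> c \<le> part \<rho> j}"
  proof (intro set_eqI iffI)
    fix j assume "j \<in> {j. Suc i < j \<and> c \<le> part (P # \<rho>) j}"
    then obtain l where "j = Suc l" "i < l" "c \<le> part \<rho> l" using assms by (cases j) auto
    then show "j \<in> Suc ` {j. i < j \<and> c \<le> part \<rho> j}" by auto
  qed (use assms in auto)
  then show ?thesis using assms by (simp add: hook_def card_image)
qed

text \<open>A hook consists of distinct cells of the diagram; in the first row its leg is bounded by
  the number of rows above, each of which is nonempty. Hence a partition of size at most
  \<open>k\<close> has small hooks only.\<close>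

lemma hook_le_sum_list:
  assumes "0 \<notin> set p" "(i, c) \<in> cells p"
  shows "hook p i c \<le> sum_list p"
  using assms
proof (induction p arbitrary: i)
  case (Cons P \<rho>)
  show ?case
  proof (cases "i = 1")
    case True
    have "conj_part \<rho> c \<le> sum_list \<rho>"
      using conj_part_le_length[of c \<rho>] length_le_sum_list[of \<rho>] Cons.prems by fastforce
    then show ?thesis using True Cons.prems hook_Cons_1[of P \<rho> c] by auto
  next
    case False
    then obtain i' where "i = Suc i'" "1 \<le> i'" using Cons.prems by (cases i) auto
    then show ?thesis using Cons hook_Cons_Suc[of i' P \<rho> c] by (auto simp: trans_le_add2)
  qed
qed simp

definition small_row :: "nat \<Rightarrow> nat list \<Rightarrow> nat \<Rightarrow> nat" where
  "small_row k p i = card {c. 1 \<le> c \<and> c \<le> part p i \<and> hook p i c \<le> k}"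

lemma deg_eq_sum: "deg k p = (\<Sum>i = 1..length p. small_row k p i)"
proof -
  have "{(i, c) \<in> cells p. hook p i c \<le> k}
      = Sigma {1..length p} (\<lambda>i. {c. 1 \<le> c \<and> c \<le> part p i \<and> hook p i c \<le> k})"
    by (auto simp: part_def split: if_splits)
  then show ?thesis unfolding deg_def small_row_def by (simp add: card_SigmaI)
qed

lemma sum_list_filter_pos: "sum_list (filter (\<lambda>x. 0 < x) xs) = sum_list (xs :: nat list)"
  by (induction xs) auto

lemma deg_eq_sum_list_kbounded: "deg k p = sum_list (kbounded k p)"
  unfolding kbounded_def sum_list_filter_pos deg_eq_sum small_row_def
  by (simp add: interv_sum_list_conv_sum_set_nat atLeastLessThanSuc_atLeastAtMost del: upt_Suc)

lemma deg_Cons: "deg k (P # \<rho>) = small_row k (P # \<rho>) 1 + deg k \<rho>"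
proof -
  have "small_row k (P # \<rho>) (Suc i) = small_row k \<rho> i" if "1 \<le> i" for i
    using that by (simp add: small_row_def hook_Cons_Suc)
  then have "(\<Sum>i = 1..length \<rho>. small_row k (P # \<rho>) (Suc i)) = deg k \<rho>"
    by (simp add: deg_eq_sum)
  moreover have "{1..length (P # \<rho>)} = insert 1 (Suc ` {1..length \<rho>})"
    by (auto simp: image_Suc_atLeastAtMost)
  ultimately show ?thesis
    by (simp add: deg_eq_sum[of k "P # \<rho>"] sum.reindex image_iff del: image_Suc_atLeastAtMost)
qed

lemma small_row_eq_part:
  assumes "is_partition p" "sum_list p \<le> k" "1 \<le> i"
  shows "small_row k p i = part p i"
proof -
  have "hook p i c \<le> k" if "1 \<le> c" "c \<le> part p i" for c
    using hook_le_sum_list[of p i c] that assms by (simp add: is_partition_def)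
  then have "{c. 1 \<le> c \<and> c \<le> part p i \<and> hook p i c \<le> k} = {1..part p i}" by auto
  then show ?thesis by (simp add: small_row_def)
qed

lemma small_partition_deg:
  assumes "is_partition p" "sum_list p \<le> k"
  shows "deg k p = sum_list p"
  using small_row_eq_part[OF assms] by (simp add: deg_eq_sum sum_list_eq_sum_part[of p "length p"])

lemma small_partition_core:
  assumes "is_partition p" "sum_list p \<le> k"
  shows "is_core k p"
  using assms hook_le_sum_list[of p] unfolding is_core_def is_partition_def by fastforce

lemma small_partition_kbounded:
  assumes "is_partition p" "sum_list p \<le> k"
  shows "kbounded k p = p"
proof -
  have "kbounded k p = filter (\<lambda>x. 0 < x) (map (part p) [1..<length p + 1])"
    unfolding kbounded_def small_row_def[symmetric]
    using small_row_eq_part[OF assms] by (intro arg_cong[of _ _ "filter _"]) auto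
  also have "map (part p) [1..<length p + 1] = p"
    by (rule nth_equalityI) (auto simp: part_def nth_upt simp del: upt_Suc)
  also have "filter (\<lambda>x. 0 < x) p = p"
    using assms(1) by (metis (mono_tags, lifting) filter_True gr0I is_partition_def)
  finally show ?thesis .
qed

text \<open>Hook lengths strictly decrease along the first row. To skip the value
  \<open>k + 1\<close> they must jump over it, and a jump between columns \<open>c\<close> and
  \<open>c + 1\<close> happens only where a row of \<open>\<rho>\<close> ends in column
  \<open>c\<close>; that row is row \<open>j\<close>.\<close>

lemma core_Cons_imp:
  assumes "is_core k (P # \<rho>)" "sum_list \<rho> \<le> k"
  obtains j where "1 \<le> j" "P + j = k + 1 + part \<rho> j"
proof -
  have P: "is_partition \<rho>" "0 < P" "part \<rho> 1 \<le> P"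
    using assms by (auto simp: is_core_def is_partition_Cons)
  have nohook: "1 + (P - c) + conj_part \<rho> c \<noteq> k + 1" if "1 \<le> c" "c \<le> P" for c
  proof -
    have "(1, c) \<in> cells (P # \<rho>)" using that by simp
    then show ?thesis using assms(1) hook_Cons_1[of P \<rho> c] unfolding is_core_def by fastforce
  qed
  have zero: "conj_part \<rho> (Suc P) = 0"
    using le_conj_part_iff[OF P(1), of "Suc P" 1] P(3) by auto
  show thesis
  proof (cases "P + length \<rho> \<le> k")
    case True
    \<comment> \<open>All hooks of the first row are small here. The index \<open>k + 1 - P\<close>
      exceeds \<open>length \<rho>\<close>, so \<open>part \<rho> j = 0\<close>.\<close>
    then show thesis by (intro that[of "k + 1 - P"]) (auto simp: part_def)
  next
    case False
    let ?C = "{c. 1 \<le> c \<and> c \<le> P \<and> k + 1 \<le> 1 + (P - c) + conj_part \<rho> c}"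
    have "conj_part \<rho> 1 = length \<rho>"
    proof -
      have "{j. 1 \<le> j \<and> 1 \<le> part \<rho> j} = {1..length \<rho>}"
        using part_pos_iff[OF P(1)] by (simp add: set_eq_iff Suc_le_eq)
      then show ?thesis by (simp add: conj_part_def)
    qed
    then have "1 \<in> ?C" using False P by auto
    moreover have "finite ?C" by (rule finite_subset[of _ "{1..P}"]) auto
    ultimately obtain c where c: "c \<in> ?C" "\<And>d. d \<in> ?C \<Longrightarrow> d \<le> c"
      using Max_in[of ?C] Max_ge[of ?C] by blast
    have 1: "k + 2 \<le> 1 + (P - c) + conj_part \<rho> c" using c(1) nohook[of c] by auto
    have 2: "P + conj_part \<rho> (Suc c) \<le> k + c"
    proof (cases "c = P")
      case True
      then show ?thesis using zero by simp
    next
      case False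
      then show ?thesis using c(1) c(2)[of "Suc c"] by fastforce
    qed
    \<comment> \<open>Column \<open>c\<close> is the last one with a hook above
      \<open>k + 1\<close>. The two estimates say that column \<open>c\<close> of
      \<open>\<rho>\<close> reaches row \<open>j\<close> and column \<open>c + 1\<close> does
      not.\<close>
    define j where "j = k + 1 + c - P"
    have j: "1 \<le> j" "P + j = k + 1 + c" using 2 by (auto simp: j_def)
    have "j \<le> conj_part \<rho> c" "\<not> j \<le> conj_part \<rho> (Suc c)" using 1 2 j c(1) by auto
    then have "part \<rho> j = c"
      using le_conj_part_iff[OF P(1), of c j] le_conj_part_iff[OF P(1), of "Suc c" j] j(1) c(1) by auto
    then show thesis using that j by simp
  qed
qed

text \<open>Columns \<open>c \<le> part \<rho> j\<close> have at least \<open>j\<close> cells of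
  \<open>\<rho>\<close> above the first row, so their hook is at least \<open>k + 2\<close>; the
  columns further right have fewer than \<open>j\<close>, so their hook is at most \<open>k\<close>.
  The small hooks of the first row thus number \<open>P - part \<rho> j = k + 1 - j\<close>.\<close>

lemma
  assumes "is_partition (P # \<rho>)" "sum_list \<rho> \<le> k" "1 \<le> j" "P + j = k + 1 + part \<rho> j"
  shows core_ConsI: "is_core k (P # \<rho>)"
    and deg_Cons_core: "deg k (P # \<rho>) = sum_list \<rho> + (k + 1 - j)"
proof -
  have P: "is_partition \<rho>" "0 < P" "part \<rho> 1 \<le> P" using assms by (auto simp: is_partition_Cons)
  have row: "(hook (P # \<rho>) 1 c \<le> k \<longleftrightarrow> part \<rho> j < c) \<and> hook (P # \<rho>) 1 c \<noteq> k + 1"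
    if "1 \<le> c" "c \<le> P" for c
    using le_conj_part_iff[OF P(1) that(1) assms(3)] that assms(4)
    unfolding hook_Cons_1 by auto
  have "hook (P # \<rho>) i c \<noteq> k + 1" if "(i, c) \<in> cells (P # \<rho>)" for i c
  proof (cases "i = 1")
    case True
    then show ?thesis using row[of c] that by auto
  next
    case False
    moreover have "1 \<le> i" using that by simp
    ultimately obtain i' where "i = Suc i'" "1 \<le> i'" by (cases i) auto
    then show ?thesis
      using hook_Cons_Suc[of i' P \<rho> c] hook_le_sum_list[of \<rho> i' c] that assms(2) P(1)
      by (auto simp: is_partition_def)
  qed
  then show "is_core k (P # \<rho>)" using assms(1) by (auto simp: is_core_def)
  have "{c. 1 \<le> c \<and> c \<le> P \<and> hook (P # \<rho>) 1 c \<le> k} = {part \<rho> j<..P}"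
    using row by fastforce
  then have "small_row k (P # \<rho>) 1 = P - part \<rho> j" by (simp add: small_row_def)
  then show "deg k (P # \<rho>) = sum_list \<rho> + (k + 1 - j)"
    using assms(4) small_partition_deg[OF P(1) assms(2)] by (simp add: deg_Cons)
qed

text \<open>The first row of a core \<open>P # \<rho>\<close> with \<open>P + j = k + 1 + \<rho>\<^sub>j\<close> has \<open>k + 1 - j\<close> small hooks, so a small
  degree forces \<open>j\<close> beyond the length of \<open>\<rho>\<close>.\<close>
lemma core_small_deg:
  assumes "is_core k p" "deg k p \<le> k"
  shows "sum_list p = deg k p"
  using assms
proof (induction p)
  case Nil
  then show ?case by (simp add: deg_eq_sum)
next
  case (Cons P \<rho>)
  have part: "is_partition (P # \<rho>)" "is_partition \<rho>"
    using Cons.prems by (auto simp: is_core_def is_partition_Cons)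
  have "hook \<rho> i c \<noteq> k + 1" if "(i, c) \<in> cells \<rho>" for i c
  proof -
    have "(Suc i, c) \<in> cells (P # \<rho>)" using that by simp
    then show ?thesis using Cons.prems(1) hook_Cons_Suc[of i P \<rho> c] that unfolding is_core_def by fastforce
  qed
  then have "is_core k \<rho>" using part by (auto simp: is_core_def)
  moreover have "deg k \<rho> \<le> k" using Cons.prems(2) by (simp add: deg_Cons)
  ultimately have sum: "sum_list \<rho> \<le> k" using Cons.IH by simp
  obtain j where j: "1 \<le> j" "P + j = k + 1 + part \<rho> j" using core_Cons_imp[OF Cons.prems(1) sum] .
  have d: "deg k (P # \<rho>) = sum_list \<rho> + (k + 1 - j)" by (rule deg_Cons_core[OF part(1) sum j])
  \<comment> \<open>This yields \<open>j \<le> k + 1\<close>, so that the subtraction in the degree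
    formula is not truncated.\<close>
  have "part \<rho> j \<le> P" using part part_antimono[OF part(2), of 1 j] j by (auto simp: is_partition_Cons)
  then have "length \<rho> < j"
    using d Cons.prems(2) j length_le_sum_list[of \<rho>] part(2) by (auto simp: is_partition_def)
  then show ?case using d j by (auto simp: part_def)
qed

text \<open>For uniqueness, a core whose bounded partition is \<open>la\<close> has degree
  \<open>sum_list la \<le> k\<close>, so it is small itself and agrees with its own bounded
  partition. On partitions of size at most \<open>k\<close> the map to cores is therefore the
  identity.\<close>

lemma core_of_eq:
  assumes "is_partition la" "sum_list la \<le> k"
  shows "core_of k la = la"
  unfolding core_of_def
proof (rule the_equality)
  show "is_core k la \<and> kbounded k la = la"
    using small_partition_core small_partition_kbounded assms by blast
next
  fix \<kappa> assume A: "is_core k \<kappa> \<and> kbounded k \<kappa> = la"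
  then have "deg k \<kappa> \<le> k" using assms by (simp add: deg_eq_sum_list_kbounded)
  then have "sum_list \<kappa> \<le> k" using core_small_deg[of k \<kappa>] A by simp
  then show "\<kappa> = la" using small_partition_kbounded A by (auto simp: is_core_def)
qed

section \<open>Bottom strong strips\<close>

definition hstrip :: "nat list \<Rightarrow> nat list \<Rightarrow> bool" where
  "hstrip la nu \<longleftrightarrow> (\<forall>i \<ge> 1. part la i \<le> part nu i \<and> part nu (Suc i) \<le> part la i)"

text \<open>Turns a weakly decreasing function on the positive integers with finite support into the
  partition with these parts; shapes are easier to modify and to define row by row as
  functions.\<close>

definition list_of_parts :: "(nat \<Rightarrow> nat) \<Rightarrow> nat list" where
  "list_of_parts f = map f [1..<Suc (card {i. 1 \<le> i \<and> 0 < f i})]"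

lemma
  assumes "\<And>i j. \<lbrakk>1 \<le> i; i \<le> j\<rbrakk> \<Longrightarrow> f j \<le> f i" "\<And>i. L < i \<Longrightarrow> f i = 0"
  shows is_partition_list_of_parts: "is_partition (list_of_parts f)"
    and part_list_of_parts: "1 \<le> i \<Longrightarrow> part (list_of_parts f) i = f i"
proof -
  let ?X = "{i. 1 \<le> i \<and> 0 < f i}"
  have "?X \<subseteq> {1..L}" using assms(2) by (force simp: not_less[symmetric])
  then have "finite ?X" using finite_subset by blast
  moreover have "i \<in> ?X" if "l \<in> ?X" "1 \<le> i" "i \<le> l" for i l
    using assms(1)[OF that(2,3)] that by simp
  ultimately have "?X = {1..card ?X}" by (intro down_closed_eq_atLeastAtMost) blast+
  then obtain m where m: "?X = {1..m}" by blast
  have pos: "0 < f i \<longleftrightarrow> i \<le> m" if "1 \<le> i" for i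
    using m that by (auto simp: set_eq_iff)
  have l: "list_of_parts f = map f [1..<Suc m]" by (simp only: list_of_parts_def m) simp
  show "1 \<le> i \<Longrightarrow> part (list_of_parts f) i = f i"
    using pos[of i] by (auto simp: l part_def nth_append nth_upt simp del: upt_Suc)
  show "is_partition (list_of_parts f)"
    unfolding is_partition_def l sorted_wrt_iff_nth_less
    using assms(1) pos by (force simp: nth_upt simp del: upt_Suc)
qed

lemma sum_list_mono_part:
  assumes "\<And>i. 1 \<le> i \<Longrightarrow> part p i \<le> part q i"
  shows "sum_list p \<le> sum_list q"
  using assms sum_list_eq_sum_part[of p "max (length p) (length q)"]
    sum_list_eq_sum_part[of q "max (length p) (length q)"]
  by (auto intro!: sum_mono)

lemma part_bigp [simp]:
  "part (bigp k la) (Suc 0) = k + part la 1"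
  "1 \<le> i \<Longrightarrow> part (bigp k la) (Suc i) = part la i"
  by (auto simp: bigp_def)

lemma
  assumes "is_partition la" "sum_list la \<le> k" "1 \<le> k"
  shows bigp_core: "is_core k (bigp k la)" and bigp_deg: "deg k (bigp k la) = sum_list la + k"
proof -
  have "is_partition ((k + part la 1) # la)" using assms by (simp add: is_partition_Cons)
  from core_ConsI[OF this assms(2), of 1] deg_Cons_core[OF this assms(2), of 1]
  show "is_core k (bigp k la)" "deg k (bigp k la) = sum_list la + k"
    by (simp_all add: bigp_def)
qed

lemma horiz_strip_iff:
  assumes "is_partition outer" "is_partition inner"
  shows "horiz_strip outer inner \<longleftrightarrow> (\<forall>i \<ge> 1. part outer (Suc i) \<le> part inner i)"
proof -
  let ?X = "\<lambda>c. {i. (i, c) \<in> cells outer - cells inner}"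
  have "?X c \<subseteq> {1..length outer}" for c by (auto simp: part_def split: if_splits)
  then have fin: "finite (?X c)" for c using finite_subset by blast
  show ?thesis
  proof
    assume H: "horiz_strip outer inner"
    show "\<forall>i \<ge> 1. part outer (Suc i) \<le> part inner i"
    proof (intro allI impI, rule ccontr)
      fix i :: nat assume i: "1 \<le> i" "\<not> part outer (Suc i) \<le> part inner i"
      let ?c = "part outer (Suc i)"
      have "i \<in> ?X ?c" "Suc i \<in> ?X ?c"
        using i part_antimono[OF assms(1), of i "Suc i"] part_antimono[OF assms(2), of i "Suc i"] by auto
      moreover have "card (?X ?c) \<le> Suc 0" using H by (simp add: horiz_strip_def)
      ultimately have "i = Suc i" using card_le_Suc0_iff_eq[OF fin[of ?c]] by blast
      then show False by simp
    qed
  next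
    assume H: "\<forall>i \<ge> 1. part outer (Suc i) \<le> part inner i"
    have no: False if "i \<in> ?X c" "j \<in> ?X c" "i < j" for i j c
    proof -
      have "part outer j \<le> part outer (Suc i)" using part_antimono[OF assms(1), of "Suc i" j] that by simp
      then show False using H that by fastforce
    qed
    have "card (?X c) \<le> Suc 0" for c
      using no[of _ c] card_le_Suc0_iff_eq[OF fin[of c]] by (metis nat_neq_iff)
    then show "horiz_strip outer inner" by (simp add: horiz_strip_def)
  qed
qed

lemma bss_chain_deg:
  assumes "bss_chain k la nu m cs" "i \<le> m"
  shows "deg k (cs ! i) = deg k nu + i"
  using assms(2)
proof (induction i)
  case 0
  then show ?case using assms(1) by (simp add: bss_chain_def)
next
  case (Suc i)
  then have "strong_cover k (cs ! i) (cs ! (i + 1))" using assms(1) by (simp add: bss_chain_def)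
  then show ?case using Suc by (simp add: strong_cover_def)
qed

text \<open>The number of covers fixes the degree of \<open>nu\<close>, and this degree is at most
  \<open>k\<close>, so it is the size. As \<open>bigp\<close> moves every part of \<open>la\<close>
  one row up, the two conditions exchange roles: horizontality of the big strip says
  \<open>part la i \<le> part nu i\<close>, and containment in \<open>bigp k la\<close> says
  \<open>part nu (Suc i) \<le> part la i\<close>.\<close>

lemma bss_imp:
  assumes "is_bss k la nu (k - \<alpha>)" "is_partition la" "1 \<le> \<alpha>" "sum_list la + \<alpha> \<le> k"
  shows "is_partition nu" "sum_list nu = sum_list la + \<alpha>" "hstrip la nu"
proof -
  obtain cs where cs: "bss_chain k la nu (k - \<alpha>) cs" using assms(1) by (auto simp: is_bss_def)
  have core: "is_core k nu" using assms(1) by (simp add: is_bss_def)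
  then show part: "is_partition nu" by (simp add: is_core_def)
  have big: "is_core k (bigp k la)" "deg k (bigp k la) = sum_list la + k"
    using bigp_core bigp_deg assms by auto
  have "deg k (bigp k la) = deg k nu + (k - \<alpha>)"
    using bss_chain_deg[OF cs, of "k - \<alpha>"] cs by (simp add: bss_chain_def)
  then have "deg k nu = sum_list la + \<alpha>" using assms(4) big by simp
  then show "sum_list nu = sum_list la + \<alpha>" using core_small_deg[OF core] assms(4) by simp
  have "horiz_strip (bigp k la) nu" "cells nu \<subseteq> cells (bigp k la)"
    using assms(1) by (auto simp: is_bss_def)
  then have 1: "\<forall>i \<ge> 1. part (bigp k la) (Suc i) \<le> part nu i"
    and 2: "\<forall>i \<ge> 1. part nu i \<le> part (bigp k la) i"
    using horiz_strip_iff part big(1) by (auto simp: is_core_def cells_subset_iff)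
  show "hstrip la nu" unfolding hstrip_def
  proof (intro allI impI)
    fix i :: nat assume "1 \<le> i"
    then show "part la i \<le> part nu i \<and> part nu (Suc i) \<le> part la i"
      using 1[rule_format, of i] 2[rule_format, of "Suc i"] by simp
  qed
qed

text \<open>One link of \<open>bss_chain\<close> as a relation, so that chains are relational powers
  and grow by adding a link at the upper end.\<close>

definition strip_step :: "nat \<Rightarrow> nat list \<Rightarrow> nat list \<Rightarrow> bool" where
  "strip_step k rho gam \<longleftrightarrow> strong_cover k rho gam \<and> (1, part gam 1) \<in> cells gam - cells rho"

text \<open>Both lists are cores by the index criterion, of degree
  \<open>sum_list \<rho> + (k + 1 - j)\<close>. The equation between the sums and the indices says
  that the degrees differ by one, and \<open>P' < P\<close> that the end of the bottom row is
  new.\<close>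

lemma strip_step_Cons:
  assumes "is_partition (P # \<rho>)" "sum_list \<rho> \<le> k" "1 \<le> j" "P + j = k + 1 + part \<rho> j"
    and "is_partition (P' # \<rho>')" "sum_list \<rho>' \<le> k" "1 \<le> j'" "P' + j' = k + 1 + part \<rho>' j'"
    and "P' < P" "\<And>i. 1 \<le> i \<Longrightarrow> part \<rho>' i \<le> part \<rho> i"
    and "sum_list \<rho> + j' = sum_list \<rho>' + j + 1" "j \<le> k + 1" "j' \<le> k + 1"
  shows "strip_step k (P' # \<rho>') (P # \<rho>)"
proof -
  have "part (P' # \<rho>') i \<le> part (P # \<rho>) i" if "1 \<le> i" for i
  proof (cases "i = 1")
    case False
    then obtain i' where "i = Suc i'" "1 \<le> i'" using \<open>1 \<le> i\<close> by (cases i) auto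
    then show ?thesis using assms(10) by simp
  qed (use assms(9) in simp)
  moreover have "deg k (P # \<rho>) = deg k (P' # \<rho>') + 1"
    using deg_Cons_core[OF assms(1-4)] deg_Cons_core[OF assms(5-8)] assms(11-13)
      sum_list_mono_part[of \<rho>' \<rho>] assms(10) by simp
  ultimately show ?thesis
    using core_ConsI[OF assms(1-4)] core_ConsI[OF assms(5-8)] assms(1,9)
    by (auto simp: strip_step_def strong_cover_def cells_subset_iff is_partition_Cons)
qed

text \<open>Going down from the top of the strip, the current index \<open>j\<close> either stays and row \<open>j\<close> of \<open>\<rho>\<close> loses
  a cell, or, once row \<open>j\<close> has reached its final length, moves up to \<open>j + 1\<close>.\<close>
lemma strip_chain_exists:
  assumes la: "is_partition la" and nu: "is_partition nu" and hs: "hstrip la nu"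
    and size: "sum_list nu \<le> k" "0 < part nu 1"
    and "is_partition \<rho>" "\<And>i. 1 \<le> i \<Longrightarrow> part nu (Suc i) \<le> part \<rho> i \<and> part \<rho> i \<le> part la i"
    and "1 \<le> j" "part nu 1 + j \<le> k + 1" "\<And>i. \<lbrakk>1 \<le> i; i < j\<rbrakk> \<Longrightarrow> part \<rho> i = part nu (Suc i)"
    and "P + j = k + 1 + part \<rho> j" "d + sum_list nu + j = sum_list \<rho> + k + 1"
  shows "(strip_step k ^^ d) nu (P # \<rho>)"
  using assms(6-)
proof (induction d arbitrary: \<rho> j P rule: less_induct)
  case (less d)
  note rho = less.prems(1) and bd = less.prems(2) and j = less.prems(3,4) and settled = less.prems(5)
    and P = less.prems(6) and d = less.prems(7)
  have "sum_list la \<le> sum_list nu" using hs by (intro sum_list_mono_part) (auto simp: hstrip_def)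
  moreover have "sum_list \<rho> \<le> sum_list la" using bd by (intro sum_list_mono_part) blast
  ultimately have rk: "sum_list \<rho> \<le> k" using size(1) by simp
  have first: "is_partition (Q # \<sigma>)"
    if "is_partition \<sigma>" "\<And>i. 1 \<le> i \<Longrightarrow> part \<sigma> i \<le> part la i" "Q + i = k + 1 + part \<sigma> i" "part nu 1 + i \<le> k + 1"
    for Q \<sigma> i
  proof -
    have "part \<sigma> 1 \<le> part nu 1" using that(2)[of 1] hs by (force simp: hstrip_def intro: order_trans)
    then show ?thesis using that size(2) by (simp add: is_partition_Cons)
  qed
  have top: "is_partition (P # \<rho>)" using first[OF rho _ P] bd j by blast
  have long: "part nu 1 + length nu \<le> k + 1"
    using nu size length_le_sum_list[of "tl nu"] by (cases nu) (auto simp: is_partition_def)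
  have tail_le: "sum_list nu \<le> part nu 1 + sum_list \<sigma>"
    if "\<And>i. 1 \<le> i \<Longrightarrow> part nu (Suc i) \<le> part \<sigma> i" for \<sigma>
  proof -
    have "part (tl nu) i = part nu (Suc i)" if "1 \<le> i" for i using that by (cases nu) auto
    then have "sum_list (tl nu) \<le> sum_list \<sigma>" using that by (intro sum_list_mono_part) simp
    then show ?thesis by (cases nu) auto
  qed
  consider (shrink) "part nu (Suc j) < part \<rho> j" | (move) "part \<rho> j = part nu (Suc j)" "part nu 1 + j < k + 1"
    | (stop) "part \<rho> j = part nu (Suc j)" "part nu 1 + j = k + 1"
    using bd[OF j(1)] j(2) by linarith
  then show ?case
  proof cases
    case shrink
    define f where "f = (part \<rho>)(j := part \<rho> j - 1)"
    \<comment> \<open>Removing the last cell of row \<open>j\<close> leaves a partition: row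
      \<open>j + 1\<close> of \<open>\<rho>\<close> is at most
      \<open>part la (Suc j) \<le> part nu (Suc j) < part \<rho> j\<close>.\<close>
    have "part \<rho> (Suc j) < part \<rho> j" using bd[of "Suc j"] hs[unfolded hstrip_def, rule_format, of "Suc j"] shrink by simp
    then have anti: "f l \<le> f i" if "1 \<le> i" "i \<le> l" for i l
      using part_antimono[OF rho, of i l] part_antimono[OF rho, of "Suc j" l] that
      by (auto simp: f_def Suc_le_eq)
    have zero: "f i = 0" if "length \<rho> < i" for i using that by (auto simp: f_def part_def)
    define \<sigma> where "\<sigma> = list_of_parts f"
    have \<sigma>: "is_partition \<sigma>" "\<And>i. 1 \<le> i \<Longrightarrow> part \<sigma> i = f i"
      unfolding \<sigma>_def using is_partition_list_of_parts[OF anti zero] part_list_of_parts[OF anti zero] by auto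
    have le: "part \<sigma> i \<le> part \<rho> i" if "1 \<le> i" for i using that by (simp add: \<sigma> f_def)
    let ?N = "max j (max (length \<rho>) (length \<sigma>))"
    have "sum_list \<rho> = (\<Sum>i = 1..?N. part \<sigma> i + (if i = j then 1 else 0))"
      using shrink by (subst sum_list_eq_sum_part[of \<rho> ?N]) (auto intro!: sum.cong simp: \<sigma> f_def)
    also have "\<dots> = sum_list \<sigma> + 1"
      using j(1) by (simp add: sum.distrib sum_list_eq_sum_part[of \<sigma> ?N])
    finally have sum: "sum_list \<rho> = sum_list \<sigma> + 1" .
    have Q: "(P - 1) + j = k + 1 + part \<sigma> j" using P shrink j by (simp add: \<sigma> f_def)
    have bd': "part nu (Suc i) \<le> part \<sigma> i \<and> part \<sigma> i \<le> part la i" if "1 \<le> i" for i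
      using bd[OF that] that shrink by (auto simp: \<sigma> f_def)
    \<comment> \<open>Here \<open>d\<close> is the degree of \<open>P # \<rho>\<close> minus the
      size of \<open>nu\<close>. After the removal the smaller partition still contains all rows of
      \<open>nu\<close> but the first, and \<open>part nu 1 + j \<le> k + 1\<close>, so its degree
      is at least that size.\<close>
    have "d \<noteq> 0" using tail_le[OF bd'[THEN conjunct1]] d sum j by linarith
    then obtain d' where d': "d = Suc d'" by (cases d) auto
    have "(strip_step k ^^ d') nu ((P - 1) # \<sigma>)"
      using less.IH[of d' \<sigma> j "P - 1"] \<sigma>(1) bd' j settled Q d d' sum by (auto simp: \<sigma> f_def)
    moreover have "strip_step k ((P - 1) # \<sigma>) (P # \<rho>)"
      using sum rk le j first[OF \<sigma>(1) _ Q] bd' Q P shrink top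
      by (intro strip_step_Cons[where j = j and j' = j]) (auto simp: is_partition_Cons)
    ultimately show ?thesis unfolding d' by (rule relpowp_Suc_I)
  next
    case move
    have "part \<rho> (Suc j) \<le> part \<rho> j" using part_antimono[OF rho, of j "Suc j"] j by simp
    \<comment> \<open>Only the first row is shortened. Raising the index by one lowers the degree by
      one, because the first row loses one small hook.\<close>
    define Q where "Q = k + 1 + part \<rho> (Suc j) - Suc j"
    have Q: "Q + Suc j = k + 1 + part \<rho> (Suc j)" using move by (simp add: Q_def)
    have "d \<noteq> 0" using tail_le[OF bd[THEN conjunct1]] d move(2) by linarith
    then obtain d' where d': "d = Suc d'" by (cases d) auto
    have "part \<rho> i = part nu (Suc i)" if "1 \<le> i" "i < Suc j" for i
      using settled[of i] move(1) that by (cases "i = j") auto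
    then have "(strip_step k ^^ d') nu (Q # \<rho>)"
      using less.IH[of d' \<rho> "Suc j" Q] rho bd j Q d d' move by auto
    moreover have "strip_step k (Q # \<rho>) (P # \<rho>)"
      using rk j first[OF rho _ Q] bd Q P move top \<open>part \<rho> (Suc j) \<le> part \<rho> j\<close>
      by (intro strip_step_Cons[where j = j and j' = "Suc j"]) auto
    ultimately show ?thesis unfolding d' by (rule relpowp_Suc_I)
  next
    case stop
    \<comment> \<open>The first row cannot have index beyond \<open>j = k + 1 - part nu 1\<close>.
      By \<open>long\<close> this \<open>j\<close> is at least the length of \<open>nu\<close>, so
      no unsettled row is left and \<open>P # \<rho>\<close> is \<open>nu\<close>.\<close>
    have eq: "part \<rho> i = part nu (Suc i)" if "1 \<le> i" for i
    proof (cases "i < j")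
      case False
      then have "length nu \<le> i" using stop(2) long by simp
      then have "part nu (Suc i) = 0" by (simp add: part_def)
      moreover have "part \<rho> i = 0"
      proof (cases "i = j")
        case True
        then show ?thesis using stop(1) \<open>part nu (Suc i) = 0\<close> by simp
      next
        case False
        then have "part nu i = 0" using \<open>\<not> i < j\<close> stop(2) long by (simp add: part_def)
        then show ?thesis using bd[OF that] hs that by (force simp: hstrip_def)
      qed
      ultimately show ?thesis by simp
    qed (use settled that in simp)
    have "part nu (Suc j) = 0" using stop(2) long by (simp add: part_def)
    then have "P = part nu 1" using P stop by simp
    have "P # \<rho> = nu"
    proof (rule partition_eqI[OF top nu])
      fix i :: nat assume "1 \<le> i"
      then show "part (P # \<rho>) i = part nu i"
        using \<open>P = part nu 1\<close> eq by (cases "i = 1"; cases i) auto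
    qed
    moreover have "d = 0"
    proof -
      have "sum_list nu = P + sum_list \<rho>" using \<open>P # \<rho> = nu\<close> by force
      then show ?thesis using d stop \<open>P = part nu 1\<close> by simp
    qed
    ultimately show ?thesis by simp
  qed
qed

lemma bss_iff:
  assumes "is_partition la" "1 \<le> \<alpha>" "sum_list la + \<alpha> \<le> k"
  shows "is_bss k la nu (k - \<alpha>) \<longleftrightarrow>
    is_partition nu \<and> sum_list nu = sum_list la + \<alpha> \<and> hstrip la nu"
proof
  assume "is_bss k la nu (k - \<alpha>)"
  then show "is_partition nu \<and> sum_list nu = sum_list la + \<alpha> \<and> hstrip la nu"
    using bss_imp assms by blast
next
  assume A: "is_partition nu \<and> sum_list nu = sum_list la + \<alpha> \<and> hstrip la nu"
  then have nu: "is_partition nu" "sum_list nu = sum_list la + \<alpha>" "hstrip la nu" by auto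
  have "nu \<noteq> []" using nu(2) assms(2) by auto
  then have pos: "0 < part nu 1" using part_pos_iff[OF nu(1), of 1] by (simp add: Suc_le_eq)
  have "part nu 1 \<le> sum_list nu" using \<open>nu \<noteq> []\<close> by (cases nu) auto
  then have first: "part nu 1 \<le> k" using nu(2) assms(3) by simp
  have core: "is_core k nu" using nu assms by (intro small_partition_core) auto
  have big: "is_core k (bigp k la)" using assms by (intro bigp_core) auto
  have bigpart: "is_partition (bigp k la)" using big by (simp add: is_core_def)
  have sub: "part nu i \<le> part (bigp k la) i" if "1 \<le> i" for i
  proof (cases "i = 1")
    case False
    then obtain i' where "i = Suc i'" "1 \<le> i'" using \<open>1 \<le> i\<close> by (cases i) auto
    then show ?thesis using nu(3) by (simp add: hstrip_def)
  qed (use first in simp)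
  \<comment> \<open>The upper end has \<open>\<rho> = la\<close>, \<open>j = 1\<close> and
    \<open>P = k + part la 1\<close>; its degree exceeds that of \<open>nu\<close> by
    \<open>sum_list la + k - sum_list nu = k - \<alpha>\<close>.\<close>
  have "(strip_step k ^^ (k - \<alpha>)) nu (bigp k la)"
    unfolding bigp_def
    by (rule strip_chain_exists[OF assms(1) nu(1,3), where j = 1])
      (use nu assms pos first in \<open>auto simp: hstrip_def\<close>)
  then obtain f where f: "f 0 = nu" "f (k - \<alpha>) = bigp k la" "\<And>i. i < k - \<alpha> \<Longrightarrow> strip_step k (f i) (f (Suc i))"
    by (auto simp: relpowp_fun_conv)
  have "bss_chain k la nu (k - \<alpha>) (map f [0..<Suc (k - \<alpha>)])"
    using f by (auto simp: bss_chain_def strip_step_def nth_append simp del: upt_Suc)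
  then show "is_bss k la nu (k - \<alpha>)"
    using core big sub nu(3) assms horiz_strip_iff[OF bigpart nu(1)]
    by (auto simp: is_bss_def cells_subset_iff hstrip_def)
qed

section \<open>Ribbons in the bottom row\<close>

text \<open>The contents of the cells of \<open>nu/la\<close>, shifted by \<open>k + 1\<close>. The
  additive equation avoids subtraction of natural numbers.\<close>

definition content_cols :: "nat \<Rightarrow> nat list \<Rightarrow> nat list \<Rightarrow> nat set" where
  "content_cols k la nu = {p. \<exists>r c. 1 \<le> r \<and> part la r < c \<and> c \<le> part nu r \<and> p + r = k + 1 + c}"

text \<open>For nonempty \<open>nu\<close> the hook at the corner has
  \<open>part nu 1 + length nu - 1\<close> cells. This single bound keeps all shifted contents
  positive and all differences of contents below \<open>k\<close>.\<close>

lemma first_part_length_le: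
  assumes "is_partition nu" "sum_list nu \<le> k"
  shows "part nu 1 + length nu \<le> k + 1"
  using assms length_le_sum_list[of "tl nu"] by (cases nu) (auto simp: is_partition_def)

text \<open>In a horizontal strip a cell of a higher row lies strictly further left, so its content
  is strictly smaller. The contents are therefore distinct, and counting them counts the cells of
  the strip.\<close>

lemma
  assumes la: "is_partition la" and nu: "is_partition nu" and hs: "hstrip la nu"
    and size: "sum_list nu \<le> k"
  shows content_cols_subset: "content_cols k la nu \<subseteq> {part nu 1..k + part nu 1}"
    and card_content_cols: "card (content_cols k la nu) + sum_list la = sum_list nu"
proof -
  note long = first_part_length_le[OF nu size]
  have row: "r \<le> length nu" if "part la r < c" "c \<le> part nu r" for r c
    using that by (auto simp: part_def split: if_splits)
  show "content_cols k la nu \<subseteq> {part nu 1..k + part nu 1}"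
  proof
    fix p assume "p \<in> content_cols k la nu"
    then obtain r c where rc: "1 \<le> r" "part la r < c" "c \<le> part nu r" "p + r = k + 1 + c"
      by (auto simp: content_cols_def)
    then show "p \<in> {part nu 1..k + part nu 1}"
      using row[OF rc(2,3)] long part_antimono[OF nu, of 1 r] by simp
  qed
  let ?S = "Sigma {1..length nu} (\<lambda>r. {part la r<..part nu r})"
  let ?f = "\<lambda>(r, c). k + 1 + c - r"
  have img: "content_cols k la nu = ?f ` ?S"
  proof (intro set_eqI iffI)
    fix p assume "p \<in> content_cols k la nu"
    then obtain r c where rc: "1 \<le> r" "part la r < c" "c \<le> part nu r" "p + r = k + 1 + c"
      by (auto simp: content_cols_def)
    then have "(r, c) \<in> ?S" using row by auto
    moreover have "p = ?f (r, c)" using rc(4) by simp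
    ultimately show "p \<in> ?f ` ?S" by blast
  next
    fix p assume "p \<in> ?f ` ?S"
    then obtain r c where rc: "p = k + 1 + c - r" "1 \<le> r" "r \<le> length nu" "part la r < c" "c \<le> part nu r"
      by auto
    then have "p + r = k + 1 + c" using long by simp
    then show "p \<in> content_cols k la nu" using rc unfolding content_cols_def by blast
  qed
  have no: False if "(r, c) \<in> ?S" "(r', c') \<in> ?S" "k + 1 + c - r = k + 1 + c' - r'" "r < r'" for r c r' c'
  proof -
    have "c < c'" using that long by auto
    moreover have "part nu r' \<le> part nu (Suc r)" using part_antimono[OF nu, of "Suc r" r'] that by simp
    moreover have "part nu (Suc r) \<le> part la r" using hs that by (auto simp: hstrip_def)
    ultimately show False using that by simp
  qed
  have "inj_on ?f ?S"
  proof (rule inj_onI)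
    fix x y assume xy: "x \<in> ?S" "y \<in> ?S" "?f x = ?f y"
    obtain r c r' c' where [simp]: "x = (r, c)" "y = (r', c')" by (metis surj_pair)
    have "r = r'" using no[of r c r' c'] no[of r' c' r c] xy by (cases r r' rule: linorder_cases) auto
    then show "x = y" using xy long by auto
  qed
  then have "card (content_cols k la nu) = (\<Sum>r = 1..length nu. part nu r - part la r)"
    unfolding img by (simp add: card_image)
  moreover have "length la \<le> length nu"
  proof (cases "la = []")
    case False
    then have "0 < part la (length la)" using part_pos_iff[OF la, of "length la"] by (simp add: Suc_le_eq)
    then have "0 < part nu (length la)" using hs False
      by (metis One_nat_def Suc_leI hstrip_def length_greater_0_conv less_le_trans)
    then show ?thesis using part_pos_iff[OF nu] by blast
  qed simp
  moreover have "(\<Sum>r = 1..length nu. part nu r - part la r) + (\<Sum>r = 1..length nu. part la r)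
      = (\<Sum>r = 1..length nu. part nu r)"
    unfolding sum.distrib[symmetric] using hs by (intro sum.cong) (auto simp: hstrip_def)
  ultimately show "card (content_cols k la nu) + sum_list la = sum_list nu"
    by (simp add: sum_list_eq_sum_part[of _ "length nu"])
qed

lemma bss_chain_core:
  assumes "bss_chain k la nu m cs" "is_core k nu" "i \<le> m"
  shows "is_core k (cs ! i)"
proof (cases i)
  case (Suc l)
  then have "strong_cover k (cs ! l) (cs ! (l + 1))" using assms by (simp add: bss_chain_def)
  then show ?thesis using Suc by (simp add: strong_cover_def)
qed (use assms in \<open>simp add: bss_chain_def\<close>)

lemma bss_chain_mono:
  assumes "bss_chain k la nu m cs" "i \<le> j" "j \<le> m" "1 \<le> l"
  shows "part (cs ! i) l \<le> part (cs ! j) l"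
  using assms(2,3)
proof (induction j rule: dec_induct)
  case (step j)
  then have "strong_cover k (cs ! j) (cs ! (j + 1))" using assms(1) by (simp add: bss_chain_def)
  then have "part (cs ! j) l \<le> part (cs ! Suc j) l"
    using assms(4) by (simp add: strong_cover_def cells_subset_iff)
  then show ?case using step by simp
qed simp

lemma bss_chain_first_less:
  assumes "bss_chain k la nu m cs" "i < m"
  shows "part (cs ! i) 1 < part (cs ! Suc i) 1"
proof -
  have "(1, part (cs ! (i + 1)) 1) \<in> cells (cs ! (i + 1)) - cells (cs ! i)"
    using assms by (simp add: bss_chain_def)
  then show ?thesis by auto
qed

lemma strict_increasing:
  fixes p :: "nat \<Rightarrow> nat"
  assumes "\<And>i. i < m \<Longrightarrow> p i < p (Suc i)" "i < j" "j \<le> m"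
  shows "p i < p j"
proof -
  have "Suc i \<le> j" using assms(2) by simp
  then show ?thesis using assms(3)
  proof (induction j rule: dec_induct)
    case (step l)
    then show ?case using assms(1)[of l] by simp
  qed (use assms in simp)
qed

text \<open>The first parts along a chain avoid the shifted contents of the cells of \<open>nu/la\<close>, and there are
  just as many of them as there are integers left.\<close>
lemma bss_chain_first_parts:
  assumes la: "is_partition la" and nu: "is_partition nu" and hs: "hstrip la nu"
    and size: "sum_list nu = sum_list la + \<alpha>" "sum_list nu \<le> k" "1 \<le> \<alpha>"
    and cs: "bss_chain k la nu (k - \<alpha>) cs"
  shows "(\<lambda>i. part (cs ! i) 1) ` {..k - \<alpha>} = {part nu 1..k + part nu 1} - content_cols k la nu"
proof -
  let ?p = "\<lambda>i. part (cs ! i) 1"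
  have core: "is_core k nu" using small_partition_core[OF nu] size by simp
  have ends: "cs ! 0 = nu" "cs ! (k - \<alpha>) = bigp k la" using cs by (auto simp: bss_chain_def)
  have "nu \<noteq> []" using size by auto
  then have pos: "0 < part nu 1" using part_pos_iff[OF nu, of 1] by (simp add: Suc_le_eq)
  have sub: "?p i \<in> {part nu 1..k + part nu 1} - content_cols k la nu" if i: "i \<le> k - \<alpha>" for i
  proof -
    have lo: "part nu l \<le> part (cs ! i) l" and hi: "part (cs ! i) l \<le> part (bigp k la) l"
      if "1 \<le> l" for l
      using bss_chain_mono[OF cs, of 0 i l] bss_chain_mono[OF cs, of i "k - \<alpha>" l] i that ends by auto
    have "cs ! i \<noteq> []" using lo[of 1] pos by auto
    then obtain P \<rho> where P: "cs ! i = P # \<rho>" by (cases "cs ! i") auto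
    have rho: "part nu (Suc l) \<le> part \<rho> l" "part \<rho> l \<le> part la l" if "1 \<le> l" for l
      using lo[of "Suc l"] hi[of "Suc l"] that by (auto simp: P)
    have "sum_list \<rho> \<le> sum_list la" using rho by (intro sum_list_mono_part) blast
    then obtain j where j: "1 \<le> j" "P + j = k + 1 + part \<rho> j"
      using core_Cons_imp[of k P \<rho>] bss_chain_core[OF cs core i] size by (auto simp: P)
    \<comment> \<open>Otherwise a strip cell \<open>(r, c)\<close> has the content of
      \<open>(j, part \<rho> j)\<close>. If \<open>j < r\<close>, then
      \<open>c \<le> part nu (Suc j) \<le> part \<rho> j\<close>, although equal contents put
      \<open>c\<close> to the right; if \<open>r \<le> j\<close>, then
      \<open>part \<rho> j \<le> part la j \<le> part la r < c\<close>, although they put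
      \<open>c\<close> weakly to the left.\<close>
    have "P \<notin> content_cols k la nu"
    proof
      assume "P \<in> content_cols k la nu"
      then obtain r c where rc: "1 \<le> r" "part la r < c" "c \<le> part nu r" "P + r = k + 1 + c"
        by (auto simp: content_cols_def)
      show False
      proof (cases "j < r")
        case True
        then have "part nu r \<le> part nu (Suc j)" using part_antimono[OF nu, of "Suc j" r] by simp
        then show False using rho[OF j(1)] rc j True by simp
      next
        case False
        then have "part la j \<le> part la r" using part_antimono[OF la, of r j] rc by simp
        then show False using rho[OF j(1)] rc j False by simp
      qed
    qed
    moreover have "part la 1 \<le> part nu 1" using hs by (simp add: hstrip_def)
    ultimately show ?thesis using lo[of 1] hi[of 1] by (simp add: P)
  qed
  have "inj_on ?p {..k - \<alpha>}"
  proof (rule inj_onI)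
    fix x y assume "x \<in> {..k - \<alpha>}" "y \<in> {..k - \<alpha>}" "?p x = ?p y"
    then show "x = y"
      using strict_increasing[where m = "k - \<alpha>" and p = ?p, OF bss_chain_first_less[OF cs]]
      by (cases x y rule: linorder_cases) fastforce+
  qed
  then have "card (?p ` {..k - \<alpha>}) = k - \<alpha> + 1" by (simp add: card_image)
  moreover have "card ({part nu 1..k + part nu 1} - content_cols k la nu) = k + 1 - \<alpha>"
    using content_cols_subset[OF la nu hs size(2)] card_content_cols[OF la nu hs size(2)] size(1)
    by (subst card_Diff_subset) (auto intro: finite_subset)
  ultimately show ?thesis using sub size by (intro card_subset_eq) auto
qed

text \<open>The bound \<open>1 \<le> a\<close> matters: for \<open>a = 0\<close> the truncated
  \<open>a - 1\<close> would lie in the interval itself.\<close>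

lemma runs_interval:
  assumes "1 \<le> a" "a \<le> b"
  shows "runs {a..b} = {{a..b}}"
proof (intro set_eqI iffI)
  fix R assume "R \<in> runs {a..b}"
  then obtain a' b' where R: "a' \<le> b'" "R = {a'..b'}" "R \<subseteq> {a..b}" "a' - 1 \<notin> {a..b}" "b' + 1 \<notin> {a..b}"
    unfolding runs_def by blast
  then have "a' \<in> {a..b}" "b' \<in> {a..b}" by auto
  then have "a' = a" "b' = b" using R(4,5) by auto
  then show "R \<in> {{a..b}}" using R by simp
next
  fix R assume "R \<in> {{a..b}}"
  then show "R \<in> runs {a..b}" using assms by (auto simp: runs_def intro!: exI[of _ a] exI[of _ b])
qed

text \<open>Here \<open>p\<close> is the sequence of first parts and \<open>R\<close> the set of
  ribbons of the bottom row. The tail of a ribbon is the column right after a value of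
  \<open>p\<close>, so the non-tail columns are those whose left neighbour is not a value. The sizes
  telescope.\<close>

lemma
  fixes p :: "nat \<Rightarrow> nat"
  assumes "\<And>i. i < m \<Longrightarrow> p i < p (Suc i)"
  defines "R \<equiv> (\<lambda>j. {Suc (p (j - 1))..p j}) ` {1..m}"
  shows card_gap_intervals: "card R = m"
    and sum_card_gap_intervals: "(\<Sum>X \<in> R. card X) = p m - p 0"
    and non_min_gap_intervals:
      "(\<exists>X \<in> R. c \<in> X \<and> c \<noteq> Min X) \<longleftrightarrow> p 0 < c \<and> c \<le> p m \<and> c - 1 \<notin> p ` {..m}"
proof -
  note less = strict_increasing[of m p, OF assms(1)]
  have step: "p (j - 1) < p j" if "j \<in> {1..m}" for j using that assms(1)[of "j - 1"] by (cases j) auto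
  have inj: "inj_on (\<lambda>j. {Suc (p (j - 1))..p j}) {1..m}"
  proof (rule inj_onI)
    fix i j assume ij: "i \<in> {1..m}" "j \<in> {1..m}" "{Suc (p (i - 1))..p i} = {Suc (p (j - 1))..p j}"
    then have "p i = p j" using step[OF ij(1)] step[OF ij(2)] by (auto simp: Icc_eq_Icc)
    then show "i = j" using less[of i j] less[of j i] ij by (cases i j rule: linorder_cases) auto
  qed
  then show "card R = m" unfolding R_def by (simp add: card_image)
  have "(\<Sum>X \<in> R. card X) = (\<Sum>j = 1..m. p j - p (j - 1))"
    unfolding R_def using inj by (simp add: sum.reindex)
  also have "l \<le> m \<Longrightarrow> (\<Sum>j = 1..l. p j - p (j - 1)) = p l - p 0 \<and> p 0 \<le> p l" for l
  proof (induction l)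
    case (Suc l)
    then show ?case using assms(1)[of l] by simp
  qed simp
  then have "(\<Sum>j = 1..m. p j - p (j - 1)) = p m - p 0" by simp
  finally show "(\<Sum>X \<in> R. card X) = p m - p 0" .
  show "(\<exists>X \<in> R. c \<in> X \<and> c \<noteq> Min X) \<longleftrightarrow> p 0 < c \<and> c \<le> p m \<and> c - 1 \<notin> p ` {..m}"
  proof
    assume "\<exists>X \<in> R. c \<in> X \<and> c \<noteq> Min X"
    then obtain j where j: "j \<in> {1..m}" "p (j - 1) < c" "c \<le> p j" "c \<noteq> Min {Suc (p (j - 1))..p j}"
      by (auto simp: R_def)
    have "Min {Suc (p (j - 1))..p j} = Suc (p (j - 1))" using step[OF j(1)] by (intro Min_eqI) auto
    then have c: "p (j - 1) < c - 1" "c - 1 < p j" using j by auto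
    have mono: "p a \<le> p b" if "a \<le> b" "b \<le> m" for a b
      using less[of a b] that by (cases "a = b") auto
    have "c - 1 \<noteq> p i" if "i \<le> m" for i
    proof (cases "i < j")
      case True
      then have "p i \<le> p (j - 1)" using j(1) by (intro mono) auto
      then show ?thesis using c by simp
    next
      case False
      then have "p j \<le> p i" using \<open>i \<le> m\<close> by (intro mono) auto
      then show ?thesis using c by simp
    qed
    then show "p 0 < c \<and> c \<le> p m \<and> c - 1 \<notin> p ` {..m}"
      using j(1-3) mono[of 0 "j - 1"] mono[of j m] by (auto simp: le_diff_conv)
  next
    assume c: "p 0 < c \<and> c \<le> p m \<and> c - 1 \<notin> p ` {..m}"
    \<comment> \<open>The first index whose interval reaches column \<open>c\<close>; its
      predecessor still ends to the left of \<open>c\<close>.\<close>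
    define j where "j = (LEAST j. c \<le> p j)"
    have "c \<le> p j" unfolding j_def using c LeastI[of "\<lambda>j. c \<le> p j" m] by simp
    have "j \<le> m" unfolding j_def using c Least_le[of "\<lambda>j. c \<le> p j" m] by simp
    have "j \<noteq> 0" using \<open>c \<le> p j\<close> c by (intro notI) simp
    then have "p (j - 1) < c" using not_less_Least[of "j - 1" "\<lambda>j. c \<le> p j"] by (simp add: j_def[symmetric])
    have jm: "j \<in> {1..m}" using \<open>j \<le> m\<close> \<open>j \<noteq> 0\<close> by simp
    have "Min {Suc (p (j - 1))..p j} = Suc (p (j - 1))" using step[OF jm] by (intro Min_eqI) auto
    moreover have "c - 1 \<noteq> p (j - 1)" using c jm by auto
    ultimately have "c \<in> {Suc (p (j - 1))..p j} \<and> c \<noteq> Min {Suc (p (j - 1))..p j}"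
      using \<open>p (j - 1) < c\<close> \<open>c \<le> p j\<close> by auto
    moreover have "{Suc (p (j - 1))..p j} \<in> R" unfolding R_def using jm by (rule imageI)
    ultimately show "\<exists>X \<in> R. c \<in> X \<and> c \<noteq> Min X" by (rule bexI)
  qed
qed

text \<open>The ribbons reach up to column \<open>k + part la 1\<close> and account for the contents
  below that value. The size of the first appended ribbon simplifies to
  \<open>part nu 1 - part la 1 + 1\<close>; its non-tail cells account for the cells of
  \<open>nu/la\<close> in the first row. The argument applies to every chain, so the choice made by
  \<open>chainA\<close> is harmless.\<close>

lemma V_A_row:
  fixes A mu k i
  defines "la \<equiv> lamA A (i - 1)" and "nu \<equiv> lamA A i" and "\<alpha> \<equiv> mu ! (i - 1)"
  assumes la: "is_partition la" and nu: "is_partition nu" and hs: "hstrip la nu"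
    and size: "sum_list nu = sum_list la + \<alpha>" "sum_list nu \<le> k" "1 \<le> \<alpha>" "\<alpha> < k"
    and bss: "is_bss k la nu (k - \<alpha>)" and i: "1 \<le> i" "i \<le> length A"
  shows "{c. (i, c) \<in> V_A k mu A} = Suc ` content_cols k la nu"
proof -
  define cs where "cs = chainA k mu A i"
  define p where "p l = part (cs ! l) 1" for l
  have cs: "bss_chain k la nu (k - \<alpha>) cs"
    unfolding cs_def chainA_def la_def[symmetric] nu_def[symmetric] \<alpha>_def[symmetric]
    by (rule someI_ex) (use bss in \<open>simp add: is_bss_def\<close>)
  have less: "p l < p (Suc l)" if "l < k - \<alpha>" for l
    using bss_chain_first_less[OF cs that] by (simp add: p_def)
  have ends: "p 0 = part nu 1" "p (k - \<alpha>) = k + part la 1"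
    using cs by (auto simp: bss_chain_def p_def)
  have "runs {c. (1, c) \<in> cells (cs ! j) - cells (cs ! (j - 1))} = {{Suc (p (j - 1))..p j}}"
    if "j \<in> {1..k - \<alpha>}" for j
  proof -
    have "{c. (1, c) \<in> cells (cs ! j) - cells (cs ! (j - 1))} = {Suc (p (j - 1))..p j}"
      by (auto simp: p_def)
    moreover have "p (j - 1) < p j" using less[of "j - 1"] that by (cases j) auto
    ultimately show ?thesis using runs_interval[of "Suc (p (j - 1))" "p j"] by simp
  qed
  then have rib: "ribbons_row k mu A i = (\<lambda>j. {Suc (p (j - 1))..p j}) ` {1..k - \<alpha>}"
    unfolding ribbons_row_def Let_def cs_def[symmetric] \<alpha>_def[symmetric] by auto
  have le1: "part la 1 \<le> part nu 1" "part nu 1 \<le> part la 1 + \<alpha>"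
  proof -
    show le: "part la 1 \<le> part nu 1" using hs by (simp add: hstrip_def)
    have "part la l \<le> part nu l" if "1 \<le> l" for l using hs that by (simp add: hstrip_def)
    moreover have "part (tl q) l = part q (Suc l)" if "1 \<le> l" for q l using that by (cases q) auto
    ultimately have "sum_list (tl la) \<le> sum_list (tl nu)" by (intro sum_list_mono_part) simp
    moreover have "sum_list la = part la 1 + sum_list (tl la)" by (cases la) auto
    moreover have "sum_list nu = part nu 1 + sum_list (tl nu)" by (cases nu) auto
    ultimately show "part nu 1 \<le> part la 1 + \<alpha>" using size(1) by simp
  qed
  have "part nu 1 \<le> sum_list nu" by (cases nu) auto
  then have "part nu 1 \<le> k" using size by simp
  have "s_size k mu A i = k + part la 1 - part nu 1"
    unfolding s_size_def rib using sum_card_gap_intervals[where p = p and m = "k - \<alpha>", OF less] ends by simp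
  moreover have "r_num k mu A i = k - \<alpha>"
    unfolding r_num_def rib using card_gap_intervals[where p = p and m = "k - \<alpha>", OF less] by simp
  ultimately have app: "first_app k mu A i = part nu 1 + 1 - part la 1"
    unfolding first_app_def \<alpha>_def[symmetric] using size \<open>part nu 1 \<le> k\<close> le1 by simp
  have len: "rowlen k A i = k + part la 1" by (simp add: rowlen_def la_def)
  \<comment> \<open>The condition \<open>\<alpha> < k\<close> enters here: the first appended ribbon
    fits into the \<open>k\<close> appended cells, so the \<open>min\<close> in \<open>V_A\<close>
    does not cut it off.\<close>
  have "part nu 1 + 1 - part la 1 \<le> k" using le1 size(4) by simp
  then have V: "(i, c) \<in> V_A k mu A \<longleftrightarrow>
      part nu 1 < c \<and> c \<le> k + part la 1 \<and> c - 1 \<notin> p ` {..k - \<alpha>}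
      \<or> k + part la 1 + 2 \<le> c \<and> c \<le> k + part nu 1 + 1" for c
    unfolding V_A_def using i non_min_gap_intervals[where p = p and m = "k - \<alpha>" and c = c, OF less] le1
    by (simp add: rib app ends len)
  have P: "p ` {..k - \<alpha>} = {part nu 1..k + part nu 1} - content_cols k la nu"
    using bss_chain_first_parts[OF la nu hs size(1-3) cs] by (simp add: p_def)
  \<comment> \<open>This is the seam between the ribbons and the extension: column
    \<open>k + part la 1 + 1\<close> is the tail of the appended ribbon, in accordance with
    \<open>k + part la 1\<close> being the last first part.\<close>
  have top: "k + part la 1 \<notin> content_cols k la nu" 
  proof -
    have "p (k - \<alpha>) \<in> p ` {..k - \<alpha>}" by simp
    then show ?thesis unfolding P ends by simp
  qed
  have row1: "c \<in> content_cols k la nu" if "k + part la 1 < c" "c \<le> k + part nu 1" for c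
    unfolding content_cols_def mem_Collect_eq
    by (rule exI[of _ 1], rule exI[of _ "c - k"]) (use that in auto)
  note sub = content_cols_subset[OF la nu hs size(2)]
  have mem: "(i, c) \<in> V_A k mu A \<longleftrightarrow> 1 \<le> c \<and> c - 1 \<in> content_cols k la nu" for c
  proof
    assume "(i, c) \<in> V_A k mu A"
    then show "1 \<le> c \<and> c - 1 \<in> content_cols k la nu"
      unfolding V P using row1[of "c - 1"] le1 by auto
  next
    assume c: "1 \<le> c \<and> c - 1 \<in> content_cols k la nu"
    then have "c - 1 \<noteq> k + part la 1" "part nu 1 \<le> c - 1" "c - 1 \<le> k + part nu 1" using top sub by auto
    then show "(i, c) \<in> V_A k mu A" unfolding V P using c by auto
  qed
  show ?thesis
  proof (rule set_eqI)
    fix c show "c \<in> {c. (i, c) \<in> V_A k mu A} \<longleftrightarrow> c \<in> Suc ` content_cols k la nu"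
      using mem[of c] by (cases c) (simp_all add: image_iff)
  qed
qed

section \<open>Counter-tableaux as chains of shapes\<close>

lemma sum_list_take_eq_sum_part: "sum_list (take i mu) = (\<Sum>j = 1..i. part mu j)"
proof (induction i)
  case (Suc i)
  then show ?case
    by (cases "i < length mu") (auto simp: take_Suc_conv_app_nth part_def)
qed simp

lemma lamA_0 [simp]: "lamA A 0 = []"
  by (simp add: lamA_def)

lemma sum_list_take_le: "sum_list (take i mu) \<le> sum_list (mu :: nat list)"
  by (metis append_take_drop_id le_add1 sum_list_append)

text \<open>The sizes add up to partial sums of \<open>mu\<close> and never exceed \<open>n\<close>,
  so by induction every strip falls under the small case.\<close>

lemma ABC_set_iff:
  assumes "1 \<le> n" "is_partition la" "sum_list la = n" "is_partition mu" "sum_list mu = n"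
  shows "A \<in> ABC_set n la mu \<longleftrightarrow> length A = length mu \<and> lamA A (length mu) = la
    \<and> (\<forall>i \<le> length mu. is_partition (lamA A i) \<and> sum_list (lamA A i) = sum_list (take i mu))
    \<and> (\<forall>i < length mu. hstrip (lamA A i) (lamA A (Suc i)))" (is "_ \<longleftrightarrow> ?R")
proof -
  have core: "core_of n la = la" using assms by (intro core_of_eq) auto
  have pos: "1 \<le> mu ! i" if "i < length mu" for i
    using assms(4) that nth_mem[OF that] unfolding is_partition_def by (metis One_nat_def Suc_leI gr0I)
  have step: "sum_list (take (Suc i) mu) = sum_list (take i mu) + mu ! i" if "i < length mu" for i
    using that by (simp add: take_Suc_conv_app_nth)
  have le: "sum_list (take i mu) \<le> n" for i using sum_list_take_le[of i mu] assms(5) by simp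
  show ?thesis
  proof
    assume "A \<in> ABC_set n la mu"
    then have A: "is_ABC n mu A" "lamA A (length A) = la" by (auto simp: ABC_set_def inner_shape_def core)
    have len: "length A = length mu" using A by (simp add: is_ABC_def)
    have bss: "is_bss n (lamA A i) (lamA A (Suc i)) (n - mu ! i)" if "i < length mu" for i
    proof -
      have "Suc i \<in> {1..length A}" using that len by simp
      then have "is_bss n (lamA A (Suc i - 1)) (lamA A (Suc i)) (n - mu ! (Suc i - 1))"
        using A(1) unfolding is_ABC_def by blast
      then show ?thesis by simp
    qed
    have parts: "is_partition (lamA A i) \<and> sum_list (lamA A i) = sum_list (take i mu)" if "i \<le> length mu" for i
      using that
    proof (induction i)
      case (Suc i)
      then show ?case
        using bss_imp[OF bss[of i]] pos[of i] step[of i] le[of "Suc i"] by simp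
    qed simp
    moreover have "hstrip (lamA A i) (lamA A (Suc i))" if "i < length mu" for i
      using bss_imp(3)[OF bss[OF that]] parts[of i] pos[OF that] step[OF that] le[of "Suc i"] that by simp
    ultimately show ?R using len A(2) by simp
  next
    assume R: ?R
    have "is_core n (lamA A i) \<and> is_bss n (lamA A (i - 1)) (lamA A i) (n - mu ! (i - 1))"
      if i: "i \<in> {1..length A}" for i
    proof -
      obtain l where l: "i = Suc l" "l < length mu" using i R by (cases i) auto
      have "is_partition (lamA A l)" "sum_list (lamA A l) = sum_list (take l mu)"
        "is_partition (lamA A (Suc l))" "sum_list (lamA A (Suc l)) = sum_list (take (Suc l) mu)"
        using R l(2) by auto
      then show ?thesis
        using R bss_iff[of "lamA A l" "mu ! l" n] pos[OF l(2)] step[OF l(2)] le[of "Suc l"] l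
          small_partition_core[of "lamA A (Suc l)" n] by simp
    qed
    moreover have "1 \<le> a \<and> a \<le> n" if "a \<in> set mu" for a
      using that pos member_le_sum_list[of a mu] assms(5) by (auto simp: in_set_conv_nth)
    ultimately show "A \<in> ABC_set n la mu"
      using R by (simp add: ABC_set_def inner_shape_def core is_ABC_def)
  qed
qed

section \<open>Tableaux and their chains of shapes\<close>

definition row_count :: "nat list list \<Rightarrow> nat \<Rightarrow> nat \<Rightarrow> nat" where
  "row_count T i r = (if 1 \<le> r \<and> r \<le> length T then length (filter (\<lambda>x. x \<le> i) (T ! (r - 1))) else 0)"

definition shapes_of :: "nat \<Rightarrow> nat list list \<Rightarrow> nat list list" where
  "shapes_of l T = map (\<lambda>i. list_of_parts (row_count T i)) [1..<Suc l]"

definition entry :: "nat list list \<Rightarrow> nat \<times> nat \<Rightarrow> nat" where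
  "entry T = (\<lambda>(r, c). T ! (r - 1) ! (c - 1))"

lemma sorted_nth_le_iff:
  assumes "sorted xs" "c < length xs"
  shows "c < length (filter (\<lambda>x. x \<le> i) xs) \<longleftrightarrow> xs ! c \<le> (i :: nat)"
  using assms
proof (induction xs arbitrary: c)
  case (Cons x xs)
  show ?case
  proof (cases "x \<le> i")
    case True
    then show ?thesis using Cons by (cases c) auto
  next
    case False
    then have "filter (\<lambda>x. x \<le> i) (x # xs) = []" using Cons.prems(1) by (auto simp: filter_empty_conv)
    moreover have "x \<le> (x # xs) ! c" using Cons.prems by (cases c) auto
    ultimately show ?thesis using False by (simp del: filter.simps)
  qed
qed simp

lemma sum_list_list_of_parts:
  assumes "\<And>i j. \<lbrakk>1 \<le> i; i \<le> j\<rbrakk> \<Longrightarrow> f j \<le> f i" "\<And>i. L < i \<Longrightarrow> f i = 0"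
  shows "sum_list (list_of_parts f) = (\<Sum>i = 1..L. f i)"
proof -
  let ?N = "max (length (list_of_parts f)) L"
  have "sum_list (list_of_parts f) = (\<Sum>i = 1..?N. f i)"
    using part_list_of_parts[OF assms] by (subst sum_list_eq_sum_part[of _ ?N]) (auto intro!: sum.cong)
  also have "\<dots> = (\<Sum>i = 1..L. f i)" using assms(2) by (intro sum.mono_neutral_right) auto
  finally show ?thesis .
qed

lemma sum_row_count: "(\<Sum>r = 1..length T. row_count T i r) = length (filter (\<lambda>x. x \<le> i) (concat T))"
proof -
  have "(\<Sum>r = 1..length T. row_count T i r) = (\<Sum>r<length T. length (filter (\<lambda>x. x \<le> i) (T ! r)))"
    by (simp add: sum.atLeast1_atMost_eq row_count_def)
  also have "\<dots> = sum_list (map (\<lambda>row. length (filter (\<lambda>x. x \<le> i) row)) T)"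
    by (simp add: sum_list_sum_nth atLeast0LessThan)
  also have "\<dots> = length (filter (\<lambda>x. x \<le> i) (concat T))"
    by (simp add: filter_concat length_concat comp_def)
  finally show ?thesis .
qed

lemma length_filter_le_Suc:
  "length (filter (\<lambda>x. x \<le> Suc i) xs) = length (filter (\<lambda>x. x \<le> i) xs) + count_list xs (Suc i)"
  by (induction xs) auto

lemma length_filter_le_eq_sum_count:
  assumes "(0::nat) \<notin> set xs"
  shows "length (filter (\<lambda>x. x \<le> i) xs) = (\<Sum>j = 1..i. count_list xs j)"
proof (induction i)
  case 0
  then show ?case using assms by (auto simp: filter_empty_conv intro: gr0I)
next
  case (Suc i)
  then show ?case by (simp add: length_filter_le_Suc)
qed

context
  fixes la mu :: "nat list" and T :: "nat list list"
  assumes la: "is_partition la" and mu: "is_partition mu" and T: "is_SSYT la mu T"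
begin

lemma SSYT_length: "length T = length la"
  using T by (metis is_SSYT_def length_map)

lemma SSYT_row_length:
  assumes "1 \<le> r" "r \<le> length T"
  shows "length (T ! (r - 1)) = part la r"
proof -
  have "la ! (r - 1) = map length T ! (r - 1)" using T by (simp add: is_SSYT_def)
  also have "\<dots> = length (T ! (r - 1))" using assms by simp
  finally show ?thesis using assms SSYT_length by (simp add: part_def)
qed

lemma row_count_le: "row_count T i r \<le> part la r"
  using SSYT_row_length[of r] length_filter_le[of "\<lambda>x. x \<le> i" "T ! (r - 1)"]
  by (cases "1 \<le> r \<and> r \<le> length T") (auto simp: row_count_def)

lemma entry_le_iff:
  assumes "1 \<le> c" "c \<le> part la r"
  shows "entry T (r, c) \<le> i \<longleftrightarrow> c \<le> row_count T i r"
proof -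
  have r: "1 \<le> r" "r \<le> length T" using assms SSYT_length by (auto simp: part_def split: if_splits)
  then have "sorted (T ! (r - 1))" using T by (auto simp: is_SSYT_def)
  from sorted_nth_le_iff[OF this, of "c - 1" i] show ?thesis
    using r assms SSYT_row_length[OF r] by (cases c) (auto simp: entry_def row_count_def)
qed

lemma entry_pos:
  assumes "1 \<le> c" "c \<le> part la r"
  shows "1 \<le> entry T (r, c)"
proof -
  have r: "1 \<le> r" "r \<le> length T" using assms SSYT_length by (auto simp: part_def split: if_splits)
  then have "T ! (r - 1) \<in> set T" "entry T (r, c) \<in> set (T ! (r - 1))"
    using assms SSYT_row_length[OF r] by (auto simp: entry_def)
  then show ?thesis using T by (auto simp: is_SSYT_def Suc_le_eq)
qed

lemma entry_column_less:
  assumes "1 \<le> r" "1 \<le> c" "c \<le> part la (Suc r)"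
  shows "entry T (r, c) < entry T (Suc r, c)"
proof -
  have "Suc r \<le> length T" using assms SSYT_length by (auto simp: part_def split: if_splits)
  moreover have "c - 1 < length (T ! r)" using SSYT_row_length[of "Suc r"] assms calculation by simp
  moreover obtain a where a: "r = Suc a" using assms(1) by (cases r) auto
  moreover have "a + 1 < length T \<and> c - 1 < length (T ! (a + 1)) \<longrightarrow> T ! a ! (c - 1) < T ! (a + 1) ! (c - 1)"
    using T unfolding is_SSYT_def by blast
  ultimately show ?thesis by (simp add: entry_def)
qed

lemma entries_le_length:
  assumes "x \<in> set (concat T)"
  shows "1 \<le> x" "x \<le> length mu"
proof -
  show x: "1 \<le> x" using T assms by (auto simp: is_SSYT_def Suc_le_eq)
  then have "count_list (concat T) x = part mu x" using T by (auto simp: is_SSYT_def)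
  moreover have "count_list (concat T) x \<noteq> 0" using assms by (simp add: count_list_0_iff)
  ultimately show "x \<le> length mu" by (auto simp: part_def split: if_splits)
qed

text \<open>Column strictness becomes interlacing: a letter at most \<open>i + 1\<close> in row
  \<open>r + 1\<close> lies on top of a letter at most \<open>i\<close>.\<close>

lemma row_count_Suc_Suc_le:
  assumes "1 \<le> r"
  shows "row_count T (Suc i) (Suc r) \<le> row_count T i r"
proof (cases "row_count T (Suc i) (Suc r) = 0")
  case False
  let ?c = "row_count T (Suc i) (Suc r)"
  have c: "1 \<le> ?c" "?c \<le> part la (Suc r)" using False row_count_le[of "Suc i" "Suc r"] by auto
  then have "entry T (Suc r, ?c) \<le> Suc i" by (simp add: entry_le_iff)
  then have "entry T (r, ?c) \<le> i" using entry_column_less[OF assms c] by simp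
  then show ?thesis
    using entry_le_iff[of ?c r i] c part_antimono[OF la, of r "Suc r"] assms by simp
qed simp

lemma row_count_le_Suc: "row_count T i r \<le> row_count T (Suc i) r"
  by (simp add: row_count_def length_filter_le_Suc)

lemma row_count_antimono:
  assumes "1 \<le> r" "r \<le> s"
  shows "row_count T i s \<le> row_count T i r"
  using assms(2)
proof (induction s rule: dec_induct)
  case (step s)
  then show ?case using row_count_Suc_Suc_le[of s i] row_count_le_Suc[of i "Suc s"] assms(1) by simp
qed simp

lemma row_count_beyond: "length T < r \<Longrightarrow> row_count T i r = 0"
  by (simp add: row_count_def)

lemmas row_count_list = row_count_antimono row_count_beyond

lemma lamA_shapes_of:
  assumes "i \<le> l"
  shows "lamA (shapes_of l T) i = list_of_parts (row_count T i)"
proof (cases "i = 0")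
  case True
  have "row_count T 0 r = 0" for r
  proof (cases "1 \<le> r \<and> r \<le> length T")
    case True
    then have "\<forall>x \<in> set (T ! (r - 1)). 0 < x" using T by (auto simp: is_SSYT_def)
    then show ?thesis by (auto simp: row_count_def filter_empty_conv)
  qed (auto simp: row_count_def)
  then show ?thesis using True by (simp add: list_of_parts_def)
next
  case False
  then have "[1..<Suc l] ! (i - 1) = i" using assms by (subst nth_upt) auto
  moreover have "i - 1 < length [1..<Suc l]" using assms False by simp
  ultimately show ?thesis using False
    by (simp add: lamA_def shapes_of_def del: upt_Suc)
qed

lemma part_lamA_shapes_of:
  assumes "i \<le> l" "1 \<le> r"
  shows "part (lamA (shapes_of l T) i) r = row_count T i r"
  using assms part_list_of_parts[OF row_count_list] by (simp add: lamA_shapes_of)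

lemma shapes_of_in_ABC_set:
  assumes "1 \<le> n" "sum_list la = n" "sum_list mu = n"
  shows "shapes_of (length mu) T \<in> ABC_set n la mu"
  unfolding ABC_set_iff[OF assms(1) la assms(2) mu assms(3)]
proof (intro conjI allI impI)
  show "length (shapes_of (length mu) T) = length mu" by (simp add: shapes_of_def del: upt_Suc)
  show part: "is_partition (lamA (shapes_of (length mu) T) i)" if "i \<le> length mu" for i
    using that is_partition_list_of_parts[OF row_count_list] by (simp add: lamA_shapes_of)
  show "lamA (shapes_of (length mu) T) (length mu) = la"
  proof (rule partition_eqI[OF part la])
    fix r :: nat assume r: "1 \<le> r"
    have "part la r \<le> row_count T (length mu) r"
    proof (cases "r \<le> length T")
      case True
      then have "T ! (r - 1) \<in> set T" using r by simp
      then have "filter (\<lambda>x. x \<le> length mu) (T ! (r - 1)) = T ! (r - 1)"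
        using entries_le_length by (intro filter_True) auto
      then show ?thesis using True r SSYT_row_length[OF r True] by (simp add: row_count_def)
    qed (simp add: SSYT_length part_def)
    then show "part (lamA (shapes_of (length mu) T) (length mu)) r = part la r"
      using row_count_le[of "length mu" r] r by (simp add: part_lamA_shapes_of)
  qed simp
  show "sum_list (lamA (shapes_of (length mu) T) i) = sum_list (take i mu)" if "i \<le> length mu" for i
  proof -
    have "sum_list (lamA (shapes_of (length mu) T) i) = length (filter (\<lambda>x. x \<le> i) (concat T))"
      using that sum_list_list_of_parts[OF row_count_list] sum_row_count by (simp add: lamA_shapes_of)
    also have "\<dots> = (\<Sum>j = 1..i. count_list (concat T) j)"
      using entries_le_length(1) by (intro length_filter_le_eq_sum_count) force
    also have "\<dots> = sum_list (take i mu)"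
      using T by (simp add: sum_list_take_eq_sum_part is_SSYT_def)
    finally show ?thesis .
  qed
  show "hstrip (lamA (shapes_of (length mu) T) i) (lamA (shapes_of (length mu) T) (Suc i))"
    if "i < length mu" for i
    using that row_count_le_Suc row_count_Suc_Suc_le by (simp add: hstrip_def part_lamA_shapes_of)
qed

end

lemma inj_on_shapes_of:
  assumes la: "is_partition la" and mu: "is_partition mu"
  shows "inj_on (shapes_of (length mu)) (SSYT_set la mu)"
proof (rule inj_onI)
  fix T T' assume "T \<in> SSYT_set la mu" "T' \<in> SSYT_set la mu"
    and eq: "shapes_of (length mu) T = shapes_of (length mu) T'"
  then have T: "is_SSYT la mu T" and T': "is_SSYT la mu T'" by (auto simp: SSYT_set_def)
  note len = SSYT_length[OF la mu T] SSYT_length[OF la mu T']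
  have count: "row_count T i r = row_count T' i r" if "i \<le> length mu" "1 \<le> r" for i r
    using part_lamA_shapes_of[OF la mu T that] part_lamA_shapes_of[OF la mu T' that] eq by simp
  show "T = T'"
  proof (rule nth_equalityI)
    fix a assume a: "a < length T"
    have rl: "length (T ! a) = part la (Suc a)" "length (T' ! a) = part la (Suc a)"
      using SSYT_row_length[OF la mu T, of "Suc a"] SSYT_row_length[OF la mu T', of "Suc a"] a len by auto
    show "T ! a = T' ! a"
    proof (rule nth_equalityI)
      fix b assume b: "b < length (T ! a)"
      have "T ! a \<in> set T" "T ! a ! b \<in> set (T ! a)" "T' ! a \<in> set T'" "T' ! a ! b \<in> set (T' ! a)"
        using a b rl len by auto
      then have "T ! a ! b \<in> set (concat T)" "T' ! a ! b \<in> set (concat T')" by auto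
      then have "T ! a ! b \<le> length mu" "T' ! a ! b \<le> length mu"
        using entries_le_length(2)[OF la mu T] entries_le_length(2)[OF la mu T'] by blast+
      moreover have "T ! a ! b \<le> i \<longleftrightarrow> T' ! a ! b \<le> i" if "i \<le> length mu" for i
        using entry_le_iff[OF la mu T, of "Suc b" "Suc a" i] entry_le_iff[OF la mu T', of "Suc b" "Suc a" i]
          count[OF that, of "Suc a"] b rl by (simp add: entry_def)
      ultimately show "T ! a ! b = T' ! a ! b" by (meson le_antisym le_refl)
    qed (simp add: rl)
  qed (simp add: len)
qed

text \<open>A cell is labelled by the first shape that contains it. Rows increase weakly since
  shapes are left-justified, columns increase strictly by interlacing, and the weight is given by
  the differences of the sizes.\<close>

lemma shapes_of_surj:
  assumes la: "is_partition la" and mu: "is_partition mu"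
    and n: "1 \<le> n" "sum_list la = n" "sum_list mu = n" and A: "A \<in> ABC_set n la mu"
  shows "\<exists>T \<in> SSYT_set la mu. shapes_of (length mu) T = A"
proof -
  let ?l = "length mu"
  have len: "length A = ?l" and top: "lamA A ?l = la"
    and parts: "\<And>i. i \<le> ?l \<Longrightarrow> is_partition (lamA A i)"
    and sums: "\<And>i. i \<le> ?l \<Longrightarrow> sum_list (lamA A i) = sum_list (take i mu)"
    and strips: "\<And>i. i < ?l \<Longrightarrow> hstrip (lamA A i) (lamA A (Suc i))"
    using A unfolding ABC_set_iff[OF n(1) la n(2) mu n(3)] by auto
  have mono: "part (lamA A i) r \<le> part (lamA A j) r" if "i \<le> j" "j \<le> ?l" "1 \<le> r" for i j r
    using that(1,2)
  proof (induction j rule: dec_induct)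
    case (step j)
    then show ?case using strips[of j] that(3) by (force simp: hstrip_def intro: order_trans)
  qed simp
  define e where "e r c = (LEAST i. c \<le> part (lamA A i) r)" for r c
  have e_iff: "e r c \<le> i \<longleftrightarrow> c \<le> part (lamA A i) r" if "1 \<le> r" "c \<le> part la r" "i \<le> ?l" for r c i
  proof
    have "c \<le> part (lamA A (e r c)) r"
      unfolding e_def using LeastI[of "\<lambda>i. c \<le> part (lamA A i) r" ?l] that top by simp
    then show "c \<le> part (lamA A i) r" if "e r c \<le> i"
      using mono[OF that \<open>i \<le> ?l\<close> \<open>1 \<le> r\<close>] by simp
    show "e r c \<le> i" if "c \<le> part (lamA A i) r"
      unfolding e_def using that by (rule Least_le)
  qed
  have e_le: "e r c \<le> ?l" if "1 \<le> r" "c \<le> part la r" for r c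
    using e_iff[OF that, of ?l] that top by simp
  have e_pos: "1 \<le> e r c" if "1 \<le> r" "1 \<le> c" "c \<le> part la r" for r c
    using e_iff[OF that(1,3), of 0] that(2) by simp
  define T where "T = map (\<lambda>r. map (e r) [1..<Suc (part la r)]) [1..<Suc (length la)]"
  have lenT: "length T = length la" by (simp add: T_def del: upt_Suc)
  have row: "T ! a = map (e (Suc a)) [1..<Suc (part la (Suc a))]" if "a < length la" for a
    using that unfolding T_def by (subst nth_map) (simp_all del: upt_Suc)
  have ent: "T ! a ! b = e (Suc a) (Suc b)" if "a < length la" "b < part la (Suc a)" for a b
    using that unfolding row[OF that(1)] by (subst nth_map) (simp_all del: upt_Suc)
  have rlen: "length (T ! a) = part la (Suc a)" if "a < length la" for a
    using row[OF that] by (simp del: upt_Suc)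
  have count: "row_count T i r = part (lamA A i) r" if "i \<le> ?l" "1 \<le> r" for i r
  proof (cases "r \<le> length la")
    case True
    then have r: "r - 1 < length la" "Suc (r - 1) = r" using that by auto
    have "part (lamA A i) r \<le> part la r" using mono[of i ?l r] that top by simp
    then have "{b. b < length (T ! (r - 1)) \<and> T ! (r - 1) ! b \<le> i} = {..<part (lamA A i) r}"
      using rlen[OF r(1)] ent[OF r(1)] e_iff[OF that(2) _ that(1)] r(2) by (auto simp: Suc_le_eq)
    then show ?thesis using True that lenT by (simp add: row_count_def length_filter_conv_card)
  next
    case False
    then show ?thesis using mono[of i ?l r] that top lenT by (simp add: row_count_def part_def)
  qed
  have "is_SSYT la mu T" unfolding is_SSYT_def
  proof (intro conjI allI impI ballI)
    show "map length T = la"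
      by (rule nth_equalityI) (use lenT rlen in \<open>auto simp: part_def\<close>)
    fix rw assume "rw \<in> set T"
    then obtain a where a: "a < length la" "rw = T ! a" using lenT by (metis in_set_conv_nth)
    show "sorted rw" unfolding sorted_iff_nth_mono_less
    proof (intro allI impI)
      fix b b' assume b: "b < b'" "b' < length rw"
      then have b': "b' < part la (Suc a)" using rlen a by simp
      have "Suc b' \<le> part (lamA A (e (Suc a) (Suc b'))) (Suc a)"
        using e_iff[of "Suc a" "Suc b'" "e (Suc a) (Suc b')"] e_le[of "Suc a" "Suc b'"] b' by simp
      then have "e (Suc a) (Suc b) \<le> e (Suc a) (Suc b')"
        using e_iff[of "Suc a" "Suc b" "e (Suc a) (Suc b')"] e_le[of "Suc a" "Suc b'"] b b' by simp
      then show "rw ! b \<le> rw ! b'" using ent[OF a(1)] a(2) b b' by simp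
    qed
    fix x assume "x \<in> set rw"
    then obtain b where "b < part la (Suc a)" "x = T ! a ! b"
      using a rlen by (metis in_set_conv_nth)
    then show "0 < x" using ent[OF a(1)] e_pos[of "Suc a" "Suc b"] by simp
  next
    fix a b assume ab: "a + 1 < length T \<and> b < length (T ! (a + 1))"
    then have a: "Suc a < length la" "a < length la" and b: "b < part la (Suc (Suc a))"
      using lenT rlen[of "Suc a"] by auto
    have b': "b < part la (Suc a)" using b part_antimono[OF la, of "Suc a" "Suc (Suc a)"] by simp
    \<comment> \<open>The upper cell first appears in shape \<open>i + 1\<close>; interlacing places
      the cell below it already in shape \<open>i\<close>.\<close>
    obtain i where i: "e (Suc (Suc a)) (Suc b) = Suc i"
      using e_pos[of "Suc (Suc a)" "Suc b"] b by (cases "e (Suc (Suc a)) (Suc b)") auto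
    have il: "Suc i \<le> ?l" using e_le[of "Suc (Suc a)" "Suc b"] b i by simp
    then have "Suc b \<le> part (lamA A (Suc i)) (Suc (Suc a))"
      using e_iff[of "Suc (Suc a)" "Suc b" "Suc i"] b i by simp
    also have "\<dots> \<le> part (lamA A i) (Suc a)" using strips[of i] il by (simp add: hstrip_def)
    finally have "e (Suc a) (Suc b) \<le> i" using e_iff[of "Suc a" "Suc b" i] il b' by simp
    then show "T ! a ! b < T ! (a + 1) ! b" using ent[of a b] ent[of "Suc a" b] a b b' i by simp
  next
    have entries: "x \<le> ?l" if "x \<in> set (concat T)" for x
    proof -
      obtain a b where "a < length la" "b < part la (Suc a)" "x = T ! a ! b"
        using \<open>x \<in> set (concat T)\<close> lenT rlen by (auto simp: in_set_conv_nth)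
      then show ?thesis using ent e_le[of "Suc a" "Suc b"] by simp
    qed
    have total: "length (filter (\<lambda>x. x \<le> i) (concat T)) = sum_list (take i mu)" if "i \<le> ?l" for i
    proof -
      have "length (lamA A i) \<le> length T"
      proof (rule ccontr)
        let ?L = "length (lamA A i)"
        assume "\<not> ?thesis"
        then have L: "1 \<le> ?L" "length la < ?L" using lenT by auto
        have "0 < part (lamA A i) ?L" using part_pos_iff[OF parts[OF that], of ?L] L(1) by simp
        moreover have "part la ?L = 0" using L(2) by (simp add: part_def)
        ultimately show False using mono[OF that le_refl L(1)] top by simp
      qed
      then have "sum_list (lamA A i) = (\<Sum>r = 1..length T. part (lamA A i) r)"
        by (rule sum_list_eq_sum_part)
      also have "\<dots> = length (filter (\<lambda>x. x \<le> i) (concat T))"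
        unfolding sum_row_count[symmetric] using count[OF that] by simp
      finally show ?thesis using sums[OF that] by simp
    qed
    fix j :: nat assume "1 \<le> j"
    then obtain i where j: "j = Suc i" by (cases j) auto
    show "count_list (concat T) j = part mu j"
    proof (cases "j \<le> ?l")
      case True
      then show ?thesis
        using total[of i] total[of j] length_filter_le_Suc[of i "concat T"] j
        by (simp add: take_Suc_conv_app_nth part_def)
    next
      case False
      then have "j \<notin> set (concat T)" using entries by blast
      then show ?thesis using False by (simp add: count_list_0_iff part_def)
    qed
  qed
  moreover have "shapes_of ?l T = A"
  proof (rule nth_equalityI)
    show l: "length (shapes_of ?l T) = length A" by (simp add: shapes_of_def len del: upt_Suc)
    fix i assume "i < length (shapes_of ?l T)"
    then have i: "Suc i \<le> ?l" using l len by simp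
    have SS: "is_SSYT la mu T" by fact
    have "is_partition (lamA (shapes_of ?l T) (Suc i))"
      using is_partition_list_of_parts[OF row_count_list[OF la mu SS]] lamA_shapes_of[OF la mu SS i] by simp
    then have "lamA (shapes_of ?l T) (Suc i) = lamA A (Suc i)"
      using parts[OF i] part_lamA_shapes_of[OF la mu SS i] count[OF i] by (intro partition_eqI) auto
    then show "shapes_of ?l T ! i = A ! i" by (simp add: lamA_def)
  qed
  ultimately show ?thesis by (auto simp: SSYT_set_def)
qed

section \<open>Selecting letters by content\<close>

definition ct :: "nat \<times> nat \<Rightarrow> int" where
  "ct = (\<lambda>(r, c). int c - int r)"

text \<open>Rows are numbered from the bottom and read from the top, so the larger row index comes
  first.\<close>

definition read_before :: "nat \<times> nat \<Rightarrow> nat \<times> nat \<Rightarrow> bool" where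
  "read_before = (\<lambda>(a, b) (a', b'). a' < a \<or> a = a' \<and> b < b')"

lemma ct_Pair [simp]: "ct (r, c) = int c - int r"
  by (simp add: ct_def)

lemma read_before_Pair [simp]: "read_before (a, b) (a', b') \<longleftrightarrow> a' < a \<or> a = a' \<and> b < b'"
  by (simp add: read_before_def)

lemma read_before_linear: "x \<noteq> y \<Longrightarrow> read_before x y \<longleftrightarrow> \<not> read_before y x"
  by (cases x; cases y) auto

lemma read_before_trans: "read_before x y \<Longrightarrow> read_before y z \<Longrightarrow> read_before x z"
  by (cases x; cases y; cases z) auto

lemma read_before_irrefl [simp]: "\<not> read_before x x"
  by (cases x) simp

definition ct_max :: "(nat \<times> nat) set \<Rightarrow> nat \<times> nat" where
  "ct_max Y = (SOME y. y \<in> Y \<and> (\<forall>z \<in> Y. ct z \<le> ct y))"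

lemma ct_max:
  assumes "finite Y" "Y \<noteq> {}"
  shows "ct_max Y \<in> Y" "z \<in> Y \<Longrightarrow> ct z \<le> ct (ct_max Y)"
proof -
  have "Max (ct ` Y) \<in> ct ` Y" using assms by (intro Max_in) auto
  then obtain y where "y \<in> Y" "ct y = Max (ct ` Y)" by auto
  then have "y \<in> Y \<and> (\<forall>z \<in> Y. ct z \<le> ct y)" using assms(1) by simp
  then have *: "ct_max Y \<in> Y \<and> (\<forall>z \<in> Y. ct z \<le> ct (ct_max Y))" unfolding ct_max_def by (rule someI)
  then show "ct_max Y \<in> Y" "z \<in> Y \<Longrightarrow> ct z \<le> ct (ct_max Y)" by auto
qed

text \<open>\<open>D\<close> is the set of cells of a semistandard tableau, \<open>e\<close> its entries, \<open>m j\<close> the number of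
  letters \<open>j\<close>; \<open>(0, N)\<close> is a virtual cell that follows all of \<open>D\<close> in either order.\<close>
locale tableau_cells =
  fixes D :: "(nat \<times> nat) set" and e :: "nat \<times> nat \<Rightarrow> nat" and m :: "nat \<Rightarrow> nat" and N :: nat
  assumes fin: "finite D"
    and pos: "(a, b) \<in> D \<Longrightarrow> 1 \<le> a \<and> 1 \<le> b \<and> b \<le> N"
    and down: "\<lbrakk>(a', b') \<in> D; 1 \<le> a; a \<le> a'; 1 \<le> b; b \<le> b'\<rbrakk> \<Longrightarrow> (a, b) \<in> D"
    and e_pos: "x \<in> D \<Longrightarrow> 1 \<le> e x"
    and row_mono: "\<lbrakk>(a, b') \<in> D; 1 \<le> b; b \<le> b'\<rbrakk> \<Longrightarrow> e (a, b) \<le> e (a, b')"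
    and col_less: "\<lbrakk>(Suc a, b) \<in> D; 1 \<le> a\<rbrakk> \<Longrightarrow> e (a, b) < e (Suc a, b)"
    and letters: "1 \<le> j \<Longrightarrow> card {x \<in> D. e x = j} = m j"
    and m_antimono: "\<lbrakk>1 \<le> i; i \<le> j\<rbrakk> \<Longrightarrow> m j \<le> m i"
begin

text \<open>Go up column \<open>b'\<close>, gaining at least one per row, and compare along row
  \<open>a\<close>. All later restrictions on the relative position of two letters are instances of
  this bound.\<close>

lemma col_gap:
  assumes "(a', b') \<in> D" "1 \<le> a" "a \<le> a'" "1 \<le> b" "b \<le> b'"
  shows "e (a, b) + (a' - a) \<le> e (a', b')"
proof -
  have "e (a, b') + (a' - a) \<le> e (a', b')"
    using assms(3,1)
  proof (induction a' rule: dec_induct)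
    case (step l)
    have "(l, b') \<in> D" using down[OF step.prems, of l b'] step assms by simp
    then show ?case using step.IH col_less[OF step.prems] step.hyps assms(2) by simp
  qed simp
  moreover have "(a, b') \<in> D" using down[OF assms(1), of a b'] assms by simp
  ultimately show ?thesis using row_mono[of a b' b] assms by simp
qed

text \<open>Equal letters form a horizontal strip: the one in the higher row lies strictly to the
  left. Hence the two orders agree on them, and the arbitrary choice in \<open>ct_max\<close> is
  unique within a letter.\<close>

lemma same_letter:
  assumes "x \<in> D" "y \<in> D" "e x = e y" "x \<noteq> y"
  shows "ct x < ct y \<longleftrightarrow> read_before x y" "ct x \<noteq> ct y"
proof -
  obtain a b a' b' where xy: "x = (a, b)" "y = (a', b')" by (metis surj_pair)
  have "b < b'" if "a' < a"
    using col_gap[of a b a' b'] assms that pos xy by (cases "b < b'") auto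
  moreover have "b' < b" if "a < a'"
    using col_gap[of a' b' a b] assms that pos xy by (cases "b' < b") auto
  ultimately show "ct x < ct y \<longleftrightarrow> read_before x y" "ct x \<noteq> ct y"
    using assms(4) xy by (cases a a' rule: linorder_cases; auto)+
qed

text \<open>The analogue of \<open>nextpos\<close> with contents in place of positions: the nearest
  \<open>j\<close> below in content, and if there is none, wrapping around, the largest one.\<close>

definition pick :: "(nat \<times> nat) set \<Rightarrow> nat \<times> nat \<Rightarrow> nat \<Rightarrow> nat \<times> nat" where
  "pick S x j = (if \<exists>y \<in> S. e y = j \<and> ct y < ct x then ct_max {y \<in> S. e y = j \<and> ct y < ct x}
     else ct_max {y \<in> S. e y = j})"

primrec sel :: "(nat \<times> nat) set \<Rightarrow> nat \<Rightarrow> nat \<times> nat" where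
  "sel S 0 = (0, N)"
| "sel S (Suc j) = pick S (sel S j) (Suc j)"

definition height :: "(nat \<times> nat) set \<Rightarrow> nat" where
  "height S = Max (e ` S)"

definition left_closed :: "(nat \<times> nat) set \<Rightarrow> bool" where
  "left_closed S \<longleftrightarrow>
    (\<forall>a b. (a, Suc b) \<in> S \<and> (a, b) \<in> D \<and> e (a, b) = e (a, Suc b) \<longrightarrow> (a, b) \<in> S)"

definition below_closed :: "(nat \<times> nat) set \<Rightarrow> bool" where
  "below_closed S \<longleftrightarrow>
    (\<forall>a b. (Suc a, b) \<in> S \<and> (a, b) \<in> D \<and> e (Suc a, b) = Suc (e (a, b)) \<longrightarrow> (a, b) \<in> S)"

text \<open>The state after \<open>r\<close> rounds. The truncated \<open>m j - r\<close> is zero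
  once letter \<open>j\<close> is exhausted; as \<open>m\<close> decreases, the letters still
  present form an initial segment.\<close>

definition round_inv :: "(nat \<times> nat) set \<Rightarrow> nat \<Rightarrow> bool" where
  "round_inv S r \<longleftrightarrow> S \<subseteq> D \<and> (\<forall>j \<ge> 1. card {x \<in> S. e x = j} = m j - r) \<and> left_closed S \<and> below_closed S"

definition rest :: "(nat \<times> nat) set \<Rightarrow> (nat \<times> nat) set" where
  "rest S = S - sel S ` {1..height S}"

lemma round_inv_start: "round_inv D 0"
  by (auto simp: round_inv_def letters left_closed_def below_closed_def)

context
  fixes S r assumes inv: "round_inv S r" and ne: "S \<noteq> {}"
begin

lemma S_sub: "S \<subseteq> D"
  using inv by (simp add: round_inv_def)

lemma S_fin: "finite S"
  using S_sub fin by (rule finite_subset)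

lemma letters_eq: "e ` S = {1..height S}"
proof -
  have mem: "j \<in> e ` S \<longleftrightarrow> r < m j" if "1 \<le> j" for j
  proof -
    have "j \<in> e ` S \<longleftrightarrow> {x \<in> S. e x = j} \<noteq> {}" by auto
    also have "\<dots> \<longleftrightarrow> 0 < card {x \<in> S. e x = j}" using S_fin by (auto simp: card_gt_0_iff)
    finally show ?thesis using inv that by (simp add: round_inv_def)
  qed
  have "1 \<le> j" if "j \<in> e ` S" for j using that e_pos S_sub by auto
  moreover have "i \<in> e ` S" if "j \<in> e ` S" "1 \<le> i" "i \<le> j" for i j
    using mem[of i] mem[of j] m_antimono[OF that(2,3)] that by simp
  moreover have "finite (e ` S)" using S_fin by simp
  ultimately have "e ` S = {1..card (e ` S)}"
    by (intro down_closed_eq_atLeastAtMost) blast+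
  then obtain l where l: "e ` S = {1..l}" by blast
  moreover from this have "l \<noteq> 0" using ne by (intro notI) simp
  then have "Max {1..l} = l" by (intro Max_eqI) auto
  ultimately show ?thesis by (simp add: height_def)
qed

lemma sel_Suc:
  assumes "Suc j \<le> height S"
  shows "sel S (Suc j) \<in> S" "e (sel S (Suc j)) = Suc j"
    and "\<lbrakk>z \<in> S; e z = Suc j; ct z < ct (sel S j)\<rbrakk>
      \<Longrightarrow> ct (sel S (Suc j)) < ct (sel S j) \<and> ct z \<le> ct (sel S (Suc j))"
    and "\<lbrakk>\<not> (\<exists>y \<in> S. e y = Suc j \<and> ct y < ct (sel S j)); z \<in> S; e z = Suc j\<rbrakk>
      \<Longrightarrow> ct z \<le> ct (sel S (Suc j))"
proof -
  let ?Z = "{y \<in> S. e y = Suc j \<and> ct y < ct (sel S j)}" and ?Y = "{y \<in> S. e y = Suc j}"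
  have "Suc j \<in> e ` S" using assms letters_eq by simp
  then obtain y where "Suc j = e y" "y \<in> S" by (rule imageE)
  then have "y \<in> ?Y" by simp
  then have "?Y \<noteq> {}" by (metis empty_iff)
  then have Y: "finite ?Y" "?Y \<noteq> {}" and Z: "finite ?Z" using S_fin by simp_all
  have "sel S (Suc j) \<in> ?Y"
  proof (cases "\<exists>y \<in> S. e y = Suc j \<and> ct y < ct (sel S j)")
    case True
    then have "ct_max ?Z \<in> ?Z" by (intro ct_max(1)[OF Z]) blast
    moreover have "sel S (Suc j) = ct_max ?Z" by (simp only: sel.simps pick_def if_P[OF True])
    ultimately show ?thesis by simp
  next
    case False
    then have "sel S (Suc j) = ct_max ?Y" by (simp only: sel.simps pick_def if_False)
    then show ?thesis using ct_max(1)[OF Y] by simp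
  qed
  then show "sel S (Suc j) \<in> S" "e (sel S (Suc j)) = Suc j" by (simp_all del: sel.simps)
  show "ct (sel S (Suc j)) < ct (sel S j) \<and> ct z \<le> ct (sel S (Suc j))"
    if "z \<in> S" "e z = Suc j" "ct z < ct (sel S j)"
  proof -
    have z: "z \<in> ?Z" using that by simp
    then have "\<exists>y \<in> S. e y = Suc j \<and> ct y < ct (sel S j)" by blast
    then have "sel S (Suc j) = ct_max ?Z" by (simp only: sel.simps pick_def if_True)
    moreover have "ct_max ?Z \<in> ?Z" using ct_max(1)[OF Z] z by blast
    moreover have "ct z \<le> ct (ct_max ?Z)" using ct_max(2)[OF Z _ z] z by blast
    ultimately show ?thesis by simp
  qed
  show "ct z \<le> ct (sel S (Suc j))"
    if "\<not> (\<exists>y \<in> S. e y = Suc j \<and> ct y < ct (sel S j))" "z \<in> S" "e z = Suc j"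
  proof -
    have "sel S (Suc j) = ct_max ?Y" by (simp only: sel.simps pick_def if_not_P[OF that(1)])
    then show ?thesis using ct_max(2)[OF Y, of z] that by simp
  qed
qed

lemma sel_in:
  assumes "1 \<le> j" "j \<le> height S"
  shows "sel S j \<in> S" "sel S j \<in> D" "e (sel S j) = j"
  using sel_Suc(1,2)[of "j - 1"] assms S_sub by (auto simp del: sel.simps)

lemma ct_less_virtual: "z \<in> S \<Longrightarrow> ct z < ct (0, N)"
  using pos S_sub by (cases z) force

text \<open>Choosing the left one of two equal neighbours requires to come from the cell below it; by
  \<open>below_closed\<close> the cell below the right neighbour is then available too, and one descends.\<close>
lemma right_first:
  assumes "1 \<le> j" "j \<le> height S" "sel S j = (a, b)" "(a, Suc b) \<in> D" "e (a, Suc b) = j"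
  shows "(a, Suc b) \<notin> S"
  using assms
proof (induction j arbitrary: a b)
  case (Suc j)
  note s = sel_Suc[OF Suc.prems(2)]
  show ?case
  proof
    assume z: "(a, Suc b) \<in> S"
    have "ct (sel S (Suc j)) = int b - int a" using Suc.prems(3) by (simp del: sel.simps)
    have "\<not> ct (a, Suc b) < ct (sel S j)" using s(3)[OF z Suc.prems(5)] Suc.prems(3) by auto
    moreover have "\<exists>y \<in> S. e y = Suc j \<and> ct y < ct (sel S j)"
      using s(4)[OF _ z Suc.prems(5)] \<open>ct (sel S (Suc j)) = int b - int a\<close> by auto
    then have "ct (sel S (Suc j)) < ct (sel S j)" using s(3) by blast
    \<comment> \<open>The left neighbour was taken although the right one was there, so the right
      one was not below \<open>sel S j\<close> in content; nor did the choice wrap around. The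
      predecessor thus lies on the diagonal of the right neighbour.\<close>
    ultimately have eq: "ct (sel S j) = int (Suc b) - int a"
      using \<open>ct (sel S (Suc j)) = int b - int a\<close> by simp
    have j: "1 \<le> j"
    proof (rule ccontr)
      assume "\<not> 1 \<le> j"
      then have "j = 0" by simp
      then show False using \<open>\<not> ct (a, Suc b) < ct (sel S j)\<close> ct_less_virtual[OF z] by simp
    qed
    obtain a1 b1 where x: "sel S j = (a1, b1)" by (metis surj_pair)
    have x': "(a1, b1) \<in> D" "e (a1, b1) = j" using sel_in[OF j] Suc.prems(2) x by auto
    have ab: "1 \<le> a" "1 \<le> a1" "1 \<le> b1" "1 \<le> b"
      using pos Suc.prems(4) x' sel_in[OF Suc.prems(1,2)] Suc.prems(3) by auto
    have "a1 < a"
    proof (rule ccontr)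
      assume "\<not> a1 < a"
      then have "e (a, Suc b) \<le> e (a1, b1)" using col_gap[OF x'(1), of a "Suc b"] eq x ab by simp
      then show False using x' Suc.prems(5) by simp
    qed
    \<comment> \<open>Entries grow by at least one per step along the diagonal, and only
      \<open>j\<close> and \<open>j + 1\<close> are available. So the predecessor is one step down
      the diagonal, which is the cell directly below \<open>(a, b)\<close>.\<close>
    then have "e (a1, b1) + (a - a1) \<le> e (a, Suc b)"
      using col_gap[OF Suc.prems(4), of a1 b1] eq x ab by simp
    then have a: "a = Suc a1" using x' Suc.prems(5) \<open>a1 < a\<close> by simp
    then have b: "b1 = b" using eq x by simp
    have r: "(a1, Suc b) \<in> D" using down[OF Suc.prems(4), of a1 "Suc b"] ab a by simp
    have "e (a1, Suc b) = j"
      using row_mono[OF r, of b] col_less[of a1 "Suc b"] Suc.prems(4,5) x' a b ab by simp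
    then have "(a1, Suc b) \<notin> S" using Suc.IH[OF j _ _ r] Suc.prems(2) x b by simp
    moreover have "(a1, Suc b) \<in> S"
      using inv z r a \<open>e (a1, Suc b) = j\<close> Suc.prems(5) by (auto simp: round_inv_def below_closed_def)
    ultimately show False by simp
  qed
qed simp

text \<open>A \<open>z\<close> in no higher row than the selected cell lies strictly to its right,
  so it comes later in both orders. The critical case is a higher \<open>z\<close> whose content is
  not smaller: it must sit in the next row, on top of a run of letters \<open>j\<close> that starts
  at the selected cell. By \<open>right_first\<close> and \<open>left_closed\<close> the rest of
  this run is used up, whereas \<open>below_closed\<close> demands the cell under
  \<open>z\<close>.\<close>

lemma content_order_iff_read_before:
  assumes "Suc j \<le> height S" "z \<in> S" "e z = Suc j"
  shows "ct z < ct (sel S j) \<longleftrightarrow> read_before z (sel S j)" "ct z \<noteq> ct (sel S j)"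
proof -
  have "(ct z < ct (sel S j) \<longleftrightarrow> read_before z (sel S j)) \<and> ct z \<noteq> ct (sel S j)"
  proof (cases "j = 0")
    case True
    then show ?thesis using ct_less_virtual[OF assms(2)] assms(2) S_sub pos by (cases z) force
  next
    case False
    then have j: "1 \<le> j" "j \<le> height S" using assms by auto
    obtain a b a' b' where x: "sel S j = (a, b)" and z: "z = (a', b')" by (metis surj_pair)
    have xD: "(a, b) \<in> D" "e (a, b) = j" using sel_in[OF j] x by auto
    have zD: "(a', b') \<in> D" "e (a', b') = Suc j" using assms z S_sub by auto
    have p: "1 \<le> a" "1 \<le> b" "1 \<le> a'" "1 \<le> b'" using pos xD zD by auto
    have above: "b < b'" if "a' \<le> a"
      using col_gap[OF xD(1), of a' b'] that p xD zD by (cases "b < b'") auto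
    have "int b' - int a' < int b - int a" if "a < a'"
    proof (rule ccontr)
      assume "\<not> ?thesis"
      then have b: "b + (a' - a) \<le> b'" using that by simp
      have ab': "(a, b') \<in> D" using down[OF zD(1), of a b'] that p by simp
      \<comment> \<open>Squeeze: \<open>(a, b')\<close> lies to the right of a \<open>j\<close> and
        at least one row below a \<open>j + 1\<close>.\<close>
      have "e (a, b') + (a' - a) \<le> Suc j" using col_gap[OF zD(1), of a b'] that p zD by simp
      moreover have "j \<le> e (a, b')" using row_mono[OF ab', of b] b p xD by simp
      ultimately have a': "a' = Suc a" and eb': "e (a, b') = j" using that by auto
      have mid: "(a, c) \<in> D \<and> e (a, c) = j" if "b \<le> c" "c \<le> b'" for c
      proof -
        have "(a, c) \<in> D" using down[OF ab', of a c] that p by simp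
        then show ?thesis using row_mono[OF ab', of c] row_mono[of a c b] that p eb' xD by simp
      qed
      have "Suc b \<le> b'" using b a' by simp
      then have "(a, b') \<notin> S"
      proof (induction b' rule: dec_induct)
        case base
        then show ?case using right_first[OF j x] mid[of "Suc b"] b a' by simp
      next
        case (step c)
        then show ?case using inv mid[of c] mid[of "Suc c"] by (auto simp: round_inv_def left_closed_def)
      qed
      then show False
        using inv assms(2) z a' ab' eb' zD by (auto simp: round_inv_def below_closed_def)
    qed
    then show ?thesis using above x z by (cases "a < a'") auto
  qed
  then show "ct z < ct (sel S j) \<longleftrightarrow> read_before z (sel S j)" "ct z \<noteq> ct (sel S j)" by auto
qed

lemma ascent_iff_read_before:
  assumes "Suc j \<le> height S" "1 \<le> j"
  shows "ct (sel S j) < ct (sel S (Suc j)) \<longleftrightarrow> read_before (sel S j) (sel S (Suc j))"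
proof -
  note s = sel_Suc(1,2)[OF assms(1)]
  have "sel S j \<noteq> sel S (Suc j)" using s(2) sel_in(3)[OF assms(2)] assms(1) by (metis Suc_leD n_not_Suc_n)
  then show ?thesis
    using content_order_iff_read_before[OF assms(1) s] read_before_linear[of "sel S j" "sel S (Suc j)"]
    by (auto simp del: sel.simps)
qed

text \<open>Each round uses one copy of every letter still present. Left closure survives because a
  left neighbour is selected only after the right one is gone; closure below survives because a
  selected \<open>i\<close> immediately draws the \<open>i + 1\<close> on top of it.\<close>

lemma round_inv_rest: "round_inv (rest S) (Suc r)"
proof -
  have sub: "rest S \<subseteq> S" by (auto simp: rest_def)
  have chosen: "1 \<le> e x \<and> e x \<le> height S \<and> sel S (e x) = x" if "x \<in> S" "x \<notin> rest S" for x
    using that sel_in(3) by (auto simp: rest_def)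
  have sel_out: "sel S j \<notin> rest S" if "1 \<le> j" "j \<le> height S" for j
    using that by (auto simp: rest_def simp del: sel.simps)
  have card: "card {x \<in> rest S. e x = j} = m j - Suc r" if j: "1 \<le> j" for j
  proof (cases "j \<le> height S")
    case True
    have "{x \<in> rest S. e x = j} = {x \<in> S. e x = j} - {sel S j}"
    proof (intro set_eqI)
      fix x
      show "x \<in> {x \<in> rest S. e x = j} \<longleftrightarrow> x \<in> {x \<in> S. e x = j} - {sel S j}"
        using chosen[of x] sel_out[OF j True] sub by (cases "x \<in> rest S") (auto simp del: sel.simps)
    qed
    then show ?thesis
      using inv j sel_in[OF j True] by (simp add: round_inv_def del: sel.simps)
  next
    case False
    then have "j \<notin> e ` S" using letters_eq by simp
    then have "{x \<in> S. e x = j} = {}" "{x \<in> rest S. e x = j} = {}" using sub by auto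
    moreover have "card {x \<in> S. e x = j} = m j - r" using inv j by (simp add: round_inv_def)
    ultimately show ?thesis by (simp only: card.empty)
  qed
  have left: "left_closed (rest S)" unfolding left_closed_def
  proof (intro allI impI, elim conjE)
    fix a b assume A: "(a, Suc b) \<in> rest S" "(a, b) \<in> D" "e (a, b) = e (a, Suc b)"
    have S: "(a, Suc b) \<in> S" "(a, b) \<in> S"
      using A sub inv by (auto simp: round_inv_def left_closed_def)
    show "(a, b) \<in> rest S"
    proof (rule ccontr)
      assume "(a, b) \<notin> rest S"
      from chosen[OF S(2) this] have c: "1 \<le> e (a, b)" "e (a, b) \<le> height S" "sel S (e (a, b)) = (a, b)"
        by blast+
      have "(a, Suc b) \<notin> S" using right_first[OF c] A(3) S(1) S_sub by auto
      then show False using S by simp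
    qed
  qed
  have below: "below_closed (rest S)" unfolding below_closed_def
  proof (intro allI impI, elim conjE)
    fix a b assume A: "(Suc a, b) \<in> rest S" "(a, b) \<in> D" "e (Suc a, b) = Suc (e (a, b))"
    have S: "(Suc a, b) \<in> S" "(a, b) \<in> S"
      using A sub inv by (auto simp: round_inv_def below_closed_def)
    show "(a, b) \<in> rest S"
    proof (rule ccontr)
      assume "(a, b) \<notin> rest S"
      from chosen[OF S(2) this] have x: "sel S (e (a, b)) = (a, b)" by blast
      have h: "Suc (e (a, b)) \<le> height S" using S(1) A(3) letters_eq by (metis atLeastAtMost_iff imageI)
      let ?y = "sel S (Suc (e (a, b)))"
      note y = sel_Suc[OF h]
      \<comment> \<open>The content of the cell above is exactly one less, so no content fits
        strictly between and the selection must fall on that cell.\<close>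
      have "ct ?y < ct (a, b) \<and> ct (Suc a, b) \<le> ct ?y" using y(3)[OF S(1) A(3)] unfolding x by simp
      then have "ct ?y = ct (Suc a, b)" by simp
      moreover have "?y \<in> D" "(Suc a, b) \<in> D" using y(1) S(1) S_sub by blast+
      ultimately have "?y = (Suc a, b)" using same_letter(2)[of ?y "(Suc a, b)"] y(2) A(3) by argo
      then show False using sel_out[OF _ h] A(1) by (simp del: sel.simps)
    qed
  qed
  show ?thesis using card left below sub S_sub by (auto simp: round_inv_def)
qed

end

section \<open>Iterating the rounds\<close>

primrec remaining :: "nat \<Rightarrow> (nat \<times> nat) set" where
  "remaining 0 = D"
| "remaining (Suc r) = rest (remaining r)"

lemma remaining_ne:
  assumes "round_inv (remaining r) r" "r < m 1"
  shows "remaining r \<noteq> {}"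
proof
  assume "remaining r = {}"
  then have "card {x \<in> remaining r. e x = 1} = 0" by simp
  then show False using assms by (simp add: round_inv_def)
qed

lemma round_inv_remaining: "r \<le> m 1 \<Longrightarrow> round_inv (remaining r) r"
proof (induction r)
  case (Suc r)
  then show ?case using round_inv_rest[of "remaining r" r] remaining_ne[of r] by simp
qed (simp add: round_inv_start)

lemma remaining_end: "remaining (m 1) = {}"
proof (rule ccontr)
  assume "remaining (m 1) \<noteq> {}"
  then obtain x where x: "x \<in> remaining (m 1)" by auto
  have inv: "round_inv (remaining (m 1)) (m 1)" by (rule round_inv_remaining) simp
  then have "remaining (m 1) \<subseteq> D" by (simp add: round_inv_def)
  then have xD: "x \<in> D" "finite (remaining (m 1))" using x finite_subset[OF _ fin] by auto
  have "card {y \<in> remaining (m 1). e y = e x} = m (e x) - m 1"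
    using inv e_pos[OF xD(1)] by (simp add: round_inv_def)
  then have "card {y \<in> remaining (m 1). e y = e x} = 0" using m_antimono[of 1 "e x"] e_pos[OF xD(1)] by simp
  then have "{y \<in> remaining (m 1). e y = e x} = {}" using xD(2) by simp
  then show False using x by blast
qed

text \<open>The common value to which both sides are reduced: the charge of the permutation of one
  round, written through its ascents in content.\<close>

definition round_charge :: "(nat \<times> nat) set \<Rightarrow> nat" where
  "round_charge S = (\<Sum>i = 1..height S. card {j. 1 \<le> j \<and> j < i \<and> ct (sel S j) < ct (sel S (Suc j))})"

end

section \<open>Charge of words\<close>

lemma pc_eq_card: "pc w i = card {j. 1 \<le> j \<and> j < i \<and> idx j w < idx (Suc j) w}"
proof (induction w i rule: pc.induct)
  case (3 w i)
  let ?X = "\<lambda>i. {j. 1 \<le> j \<and> j < i \<and> idx j w < idx (Suc j) w}"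
  have "?X (Suc (Suc i)) = ?X (Suc i) \<union> (if idx (i + 1) w < idx (i + 2) w then {Suc i} else {})"
    by (auto simp: less_Suc_eq)
  moreover have "finite (?X (Suc i))" by (rule finite_subset[of _ "{..Suc i}"]) auto
  moreover have "Suc i \<notin> ?X (Suc i)" by simp
  ultimately have "card (?X (Suc (Suc i))) = card (?X (Suc i)) + (if idx (i + 1) w < idx (i + 2) w then 1 else 0)"
    by simp
  then show ?case using "3.IH" by simp
qed auto

text \<open>Charge depends only on which \<open>j\<close> stand to the left of \<open>j + 1\<close>,
  so it suffices to compare this ascent set on both sides.\<close>

lemma perm_charge_eq:
  assumes "length w = h" "\<And>j. \<lbrakk>1 \<le> j; Suc j \<le> h\<rbrakk> \<Longrightarrow> idx j w < idx (Suc j) w \<longleftrightarrow> P j"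
  shows "perm_charge w = (\<Sum>i = 1..h. card {j. 1 \<le> j \<and> j < i \<and> P j})"
  unfolding perm_charge_def assms(1)
proof (rule sum.cong[OF refl])
  fix i assume "i \<in> {1..h}"
  then have "{j. 1 \<le> j \<and> j < i \<and> idx j w < idx (Suc j) w} = {j. 1 \<le> j \<and> j < i \<and> P j}"
    using assms(2) by auto
  then show "pc w i = card {j. 1 \<le> j \<and> j < i \<and> P j}" by (simp add: pc_eq_card)
qed

lemma idx_Cons_same [simp]: "idx x (x # xs) = 0"
  unfolding idx_def by (rule Least_equality) auto

lemma idx_Cons_other:
  assumes "x \<noteq> y" "x \<in> set xs"
  shows "idx x (y # xs) = Suc (idx x xs)"
proof -
  obtain p where p: "p < length xs" "xs ! p = x" using assms(2) by (metis in_set_conv_nth)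
  have "(LEAST p. p < length (y # xs) \<and> (y # xs) ! p = x)
      = Suc (LEAST p. Suc p < length (y # xs) \<and> (y # xs) ! Suc p = x)"
    by (rule Least_Suc[of _ "Suc p"]) (use p assms(1) in auto)
  then show ?thesis by (simp add: idx_def)
qed

section \<open>Reading words built by insertion\<close>

lemma
  assumes "j \<in> set w" "i \<notin> set w"
  shows idx_ins_after_new: "idx i (ins_after j i w) = Suc (idx j w)"
    and set_ins_after: "set (ins_after j i w) = insert i (set w)"
    and distinct_ins_after: "distinct w \<Longrightarrow> distinct (ins_after j i w)"
    and idx_ins_after_old: "a \<in> set w \<Longrightarrow>
      idx a (ins_after j i w) = (if idx a w \<le> idx j w then idx a w else Suc (idx a w))"
proof -
  have s: "set (ins_after j i w) = insert i (set w)" for w by (induction w) auto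
  then show "set (ins_after j i w) = insert i (set w)" .
  show "distinct w \<Longrightarrow> distinct (ins_after j i w)"
    using assms
  proof (induction w)
    case (Cons x w)
    then show ?case using s[of w] by auto
  qed simp
  show "idx i (ins_after j i w) = Suc (idx j w)"
    using assms
  proof (induction w)
    case (Cons x w)
    then show ?case
      using s[of w] idx_Cons_other[of i x "i # w"] idx_Cons_other[of i x "ins_after j i w"]
        idx_Cons_other[of j x w] by (cases "x = j") auto
  qed simp
  show "a \<in> set w \<Longrightarrow> idx a (ins_after j i w) = (if idx a w \<le> idx j w then idx a w else Suc (idx a w))"
    using assms
  proof (induction w)
    case (Cons x w)
    show ?case
    proof (cases "x = j")
      case True
      then show ?thesis
        using Cons.prems idx_Cons_other[of a x "i # w"] idx_Cons_other[of a i w] idx_Cons_other[of a x w]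
        by (cases "a = x") auto
    next
      case False
      then show ?thesis
        using Cons s[of w] idx_Cons_other[of a x "ins_after j i w"] idx_Cons_other[of a x w]
          idx_Cons_other[of j x w]
        by (cases "a = x") auto
    qed
  qed simp
qed

text \<open>The last conjunct is the goal, the one before it carries the induction. Its restriction
  to last carriers is needed: the values 1, 2, 1, 2 produce the word 3 4 1 2, in which 4 precedes
  1.\<close>

definition reading_inv :: "(nat \<Rightarrow> nat) \<Rightarrow> nat \<Rightarrow> nat list \<Rightarrow> bool" where
  "reading_inv c i w \<longleftrightarrow> distinct w \<and> set w = {1..i}
    \<and> (\<forall>a \<in> {1..i}. \<forall>b \<in> {1..i}. c a < c b \<longrightarrow> c a \<notin> c ` {a<..i} \<longrightarrow> c b \<notin> c ` {b<..i}
        \<longrightarrow> idx a w < idx b w)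
    \<and> (\<forall>j. 1 \<le> j \<and> Suc j \<le> i \<longrightarrow> (idx j w < idx (Suc j) w \<longleftrightarrow> c j < c (Suc j)))"

text \<open>The word need not be sorted by \<open>c\<close>, but the last letters carrying each value of \<open>c\<close> are.\<close>
lemma reading_inv_step:
  assumes inv: "reading_inv c i w" and i: "1 \<le> i"
  shows "reading_inv c (Suc i) (rw_step c w (Suc i))"
proof -
  define J where "J = {j. 1 \<le> j \<and> j < Suc i \<and> c j < c (Suc i)}"
  have w: "distinct w" "set w = {1..i}" and
    sorted: "\<And>a b. \<lbrakk>a \<in> {1..i}; b \<in> {1..i}; c a < c b; c a \<notin> c ` {a<..i}; c b \<notin> c ` {b<..i}\<rbrakk>
      \<Longrightarrow> idx a w < idx b w"
    and asc: "\<And>j. \<lbrakk>1 \<le> j; Suc j \<le> i\<rbrakk> \<Longrightarrow> idx j w < idx (Suc j) w \<longleftrightarrow> c j < c (Suc j)"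
    using inv unfolding reading_inv_def by blast+
  have new: "Suc i \<notin> set w" using w by simp
  have last_old: "c a \<notin> c ` {a<..i}" if "c a \<notin> c ` {a<..Suc i}" for a
    using that by auto
  define w' where "w' = rw_step c w (Suc i)"
  have main: "distinct w' \<and> set w' = {1..Suc i}
    \<and> (\<forall>a \<in> {1..i}. \<forall>b \<in> {1..i}. idx a w' < idx b w' \<longleftrightarrow> idx a w < idx b w)
    \<and> (\<forall>a \<in> {1..i}. c a \<notin> c ` {a<..i} \<longrightarrow> c a < c (Suc i) \<longrightarrow> idx a w' < idx (Suc i) w')
    \<and> (\<forall>a \<in> {1..i}. c a \<notin> c ` {a<..i} \<longrightarrow> c (Suc i) \<le> c a \<longrightarrow> idx (Suc i) w' < idx a w')"
  proof (cases "J = {}")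
    case True
    then have w': "w' = Suc i # w" by (simp add: w'_def rw_step_def J_def)
    have "idx a w' = Suc (idx a w)" if "a \<in> {1..i}" for a
      using idx_Cons_other[of a "Suc i" w] that w(2) w' by auto
    moreover have "\<not> c a < c (Suc i)" if "a \<in> {1..i}" for a using that True by (auto simp: J_def)
    moreover have "{1..Suc i} = insert (Suc i) {1..i}" by auto
    ultimately show ?thesis using w new by (simp add: w')
  next
    case False
    define cm where "cm = Max (c ` J)"
    define j where "j = Max {j \<in> J. c j = cm}"
    have finJ: "finite J" by (rule finite_subset[of _ "{..i}"]) (auto simp: J_def)
    have "cm \<in> c ` J" unfolding cm_def using finJ False by (intro Max_in) auto
    then have "{j \<in> J. c j = cm} \<noteq> {}" by auto
    then have "j \<in> {j \<in> J. c j = cm}" unfolding j_def using finJ by (intro Max_in) auto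
    then have jJ: "j \<in> J" "c j = cm" by auto
    have le_cm: "c a \<le> cm" if "a \<in> J" for a unfolding cm_def using finJ that by (intro Max_ge) auto
    have le_j: "a \<le> j" if "a \<in> J" "c a = cm" for a
      unfolding j_def using finJ that by (intro Max_ge) auto
    have ji: "j \<in> {1..i}" "c j < c (Suc i)" using jJ by (auto simp: J_def)
    \<comment> \<open>Breaking ties by the largest index makes \<open>j\<close> the last carrier of
      its value, so the invariant applies to it.\<close>
    have last_j: "c j \<notin> c ` {j<..i}"
    proof
      assume "c j \<in> c ` {j<..i}"
      then obtain a where a: "j < a" "a \<le> i" "c a = c j" by auto
      then have "a \<in> J" using ji by (auto simp: J_def)
      then show False using le_j[of a] a jJ by simp
    qed
    have w': "w' = ins_after j (Suc i) w"
      using False unfolding w'_def rw_step_def J_def[symmetric] Let_def cm_def[symmetric] j_def[symmetric] by simp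
    have jw: "j \<in> set w" using ji w by simp
    note ins = idx_ins_after_new[OF jw new] idx_ins_after_old[OF jw new] set_ins_after[OF jw new]
      distinct_ins_after[OF jw new]
    have "idx a w' < idx b w' \<longleftrightarrow> idx a w < idx b w" if "a \<in> {1..i}" "b \<in> {1..i}" for a b
      using ins(2)[of a] ins(2)[of b] that w(2) unfolding w' by auto
    moreover have "idx a w' < idx (Suc i) w'"
      if a: "a \<in> {1..i}" "c a \<notin> c ` {a<..i}" "c a < c (Suc i)" for a
    proof -
      have aJ: "a \<in> J" using a by (auto simp: J_def)
      have "idx a w \<le> idx j w"
      proof (cases "c a = cm")
        case True
        have "a \<le> j" by (rule le_j[OF aJ True])
        moreover have "\<not> a < j" using a(2) True jJ(2) ji by (metis atLeastAtMost_iff greaterThanAtMost_iff imageI)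
        ultimately show ?thesis by simp
      next
        case False
        then have "c a < c j" using le_cm[OF aJ] jJ by simp
        then show ?thesis using sorted[OF a(1) ji(1) _ a(2) last_j] by simp
      qed
      then show ?thesis using ins(1) ins(2)[of a] a w(2) unfolding w' by simp
    qed
    moreover have "idx (Suc i) w' < idx a w'"
      if a: "a \<in> {1..i}" "c a \<notin> c ` {a<..i}" "c (Suc i) \<le> c a" for a
    proof -
      have "idx j w < idx a w" using sorted[OF ji(1) a(1) _ last_j a(2)] ji a by simp
      then show ?thesis using ins(1) ins(2)[of a] a w(2) unfolding w' by simp
    qed
    moreover have "{1..Suc i} = insert (Suc i) {1..i}" by auto
    ultimately show ?thesis using ins(3,4) w unfolding w' by simp
  qed
  have "idx a w' < idx b w'"
    if ab: "a \<in> {1..Suc i}" "b \<in> {1..Suc i}" "c a < c b" "c a \<notin> c ` {a<..Suc i}" "c b \<notin> c ` {b<..Suc i}" for a b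
  proof -
    consider "a \<in> {1..i}" "b \<in> {1..i}" | "a = Suc i" "b \<in> {1..i}" | "a \<in> {1..i}" "b = Suc i" | "a = b"
      using ab(1,2) by (auto simp: le_Suc_eq)
    then show ?thesis
    proof cases
      case 1
      then show ?thesis using main sorted[OF 1 ab(3)] last_old[OF ab(4)] last_old[OF ab(5)] by simp
    next
      case 2
      then show ?thesis using main last_old[OF ab(5)] ab(3) by simp
    next
      case 3
      then show ?thesis using main last_old[OF ab(4)] ab(3) by simp
    qed (use ab(3) in simp)
  qed
  moreover have "idx j w' < idx (Suc j) w' \<longleftrightarrow> c j < c (Suc j)" if j: "1 \<le> j" "Suc j \<le> Suc i" for j
  proof (cases "j = i")
    case True
    \<comment> \<open>The letter \<open>i\<close> is trivially the last carrier of its value among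
      \<open>1, ..., i\<close>, which decides the new ascent at \<open>i\<close>.\<close>
    have "i \<in> {1..i}" "c i \<notin> c ` {i<..i}" using i by auto
    then have "c i < c (Suc i) \<Longrightarrow> idx i w' < idx (Suc i) w'" "c (Suc i) \<le> c i \<Longrightarrow> idx (Suc i) w' < idx i w'"
      using main by blast+
    then show ?thesis unfolding True by (cases "c i < c (Suc i)") auto
  next
    case False
    then have "j \<in> {1..i}" "Suc j \<in> {1..i}" using j by auto
    then show ?thesis using main asc[of j] by simp
  qed
  ultimately show ?thesis using main unfolding reading_inv_def w'_def[symmetric] by blast
qed

lemma reading_inv_foldl: "1 \<le> i \<Longrightarrow> reading_inv c i (foldl (rw_step c) [1] [2..<i + 1])"
proof (induction i rule: dec_induct)
  case base
  then show ?case by (simp add: reading_inv_def)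
next
  case (step i)
  then have "[2..<Suc i + 1] = [2..<i + 1] @ [Suc i]" by simp
  then show ?case using reading_inv_step[OF step.IH step.hyps(1)] by (simp del: upt_Suc)
qed

lemma perm_charge_reading_word:
  assumes "E = (\<lambda>i. (i, c i)) ` {1..h}" "1 \<le> h"
  shows "perm_charge (reading_word E) = (\<Sum>i = 1..h. card {j. 1 \<le> j \<and> j < i \<and> c j < c (Suc j)})"
proof -
  define d where "d = (\<lambda>i. THE x. (i, x) \<in> E)"
  have d: "d i = c i" if "i \<in> {1..h}" for i
    unfolding d_def assms(1) by (rule the_equality) (use that in auto)
  have "card E = h" unfolding assms(1) by (subst card_image) (auto simp: inj_on_def)
  then have "reading_word E = foldl (rw_step d) [1] [2..<h + 1]"
    by (simp add: reading_word_def d_def)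
  then have inv: "reading_inv d h (reading_word E)" using reading_inv_foldl[OF assms(2)] by simp
  then have "length (reading_word E) = h"
    unfolding reading_inv_def by (metis card_atLeastAtMost diff_Suc_1 distinct_card One_nat_def)
  then show ?thesis
  proof (rule perm_charge_eq)
    fix j assume j: "1 \<le> j" "Suc j \<le> h"
    then show "idx j (reading_word E) < idx (Suc j) (reading_word E) \<longleftrightarrow> c j < c (Suc j)"
      using inv d[of j] d[of "Suc j"] by (simp add: reading_inv_def)
  qed
qed

section \<open>Charge subwords as rounds of selection\<close>

lemma idx_map_nth:
  assumes "distinct L" "inj_on e (set L)" "p < length L"
  shows "idx (e (L ! p)) (map e L) = p"
  unfolding idx_def
proof (rule Least_equality)
  show "p < length (map e L) \<and> map e L ! p = e (L ! p)" using assms by simp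
  fix q assume "q < length (map e L) \<and> map e L ! q = e (L ! p)"
  then have "q < length L" "L ! q = L ! p" using assms inj_onD[OF assms(2), of "L ! q" "L ! p"] by auto
  then show "p \<le> q" using assms nth_eq_iff_index_eq by force
qed

lemma sorted_list_of_set_filter: "sorted_list_of_set {q. q < n \<and> P q} = filter P [0..<n]"
proof -
  have "sorted_list_of_set (set (filter P [0..<n])) = filter P [0..<n]"
    by (intro sorted_list_of_set.idem_if_sorted_distinct) (auto simp: sorted_wrt_filter)
  moreover have "set (filter P [0..<n]) = {q. q < n \<and> P q}" by auto
  ultimately show ?thesis by simp
qed

lemma map_nth_filter: "map (\<lambda>q. map e L ! q) (filter (\<lambda>q. P (L ! q)) [0..<length L]) = map e (filter P L)"
proof -
  have "map e (filter P L) = map e (filter P (map ((!) L) [0..<length L]))" by (simp add: map_nth)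
  also have "\<dots> = map (\<lambda>q. e (L ! q)) (filter (\<lambda>q. P (L ! q)) [0..<length L])"
    by (simp add: filter_map comp_def)
  also have "\<dots> = map (\<lambda>q. map e L ! q) (filter (\<lambda>q. P (L ! q)) [0..<length L])"
    by (rule map_cong) auto
  finally show ?thesis by simp
qed

lemma sorted_read_before_nth:
  assumes "sorted_wrt read_before L" "p < length L" "q < length L"
  shows "read_before (L ! p) (L ! q) \<longleftrightarrow> p < q"
proof (cases p q rule: linorder_cases)
  case less
  then show ?thesis using sorted_wrt_nth_less[OF assms(1) less assms(3)] by simp
next
  case greater
  then show ?thesis using sorted_wrt_nth_less[OF assms(1) greater assms(2)] read_before_trans
    by (metis not_less_iff_gr_or_eq read_before_irrefl)
qed simp

lemma sorted_read_before_distinct: "sorted_wrt read_before L \<Longrightarrow> distinct L"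
  unfolding distinct_conv_nth by (metis nat_neq_iff read_before_irrefl sorted_wrt_nth_less)

context tableau_cells
begin

context
  fixes S r L assumes inv: "round_inv S r" and ne: "S \<noteq> {}"
    and L: "sorted_wrt read_before L" "set L = S"
begin

text \<open>Position \<open>p\<close> of the word carries the cell \<open>sel S j\<close>. The
  virtual cell corresponds to the position past the end, where the scan from the right
  begins.\<close>

definition at_pos :: "nat \<Rightarrow> nat \<Rightarrow> bool" where
  "at_pos j p \<longleftrightarrow> (if j = 0 then p = length L else p < length L \<and> L ! p = sel S j)"

text \<open>A letter \<open>j + 1\<close> stands to the left of position \<open>p\<close> iff its
  content is below that of \<open>sel S j\<close>, and among the letters \<open>j + 1\<close>
  position order is content order. The scan and \<open>pick\<close> therefore branch alike and end
  on the same cell.\<close>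

lemma nextpos_at_pos:
  assumes "at_pos j p" "Suc j \<le> height S"
  shows "at_pos (Suc j) (nextpos (map e L) p (Suc j))"
proof -
  note s = sel_Suc[OF inv ne assms(2)]
  have L_in: "L ! q \<in> S" "L ! q \<in> D" if "q < length L" for q
  proof -
    show "L ! q \<in> S" using nth_mem[OF that] L(2) by simp
    then show "L ! q \<in> D" using S_sub[OF inv ne] by (rule rev_subsetD)
  qed
  have before: "q < p \<longleftrightarrow> read_before (L ! q) (sel S j)" if q: "q < length L" for q
  proof (cases "j = 0")
    case True
    obtain a b where "L ! q = (a, b)" by (metis surj_pair)
    then show ?thesis using pos[of a b] L_in(2)[OF q] True assms(1) q by (auto simp: at_pos_def)
  next
    case False
    then have "p < length L" "L ! p = sel S j" using assms(1) by (auto simp: at_pos_def)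
    then show ?thesis using sorted_read_before_nth[OF L(1) q, of p] by simp
  qed
  have p: "p \<le> length L" using assms(1) by (auto simp: at_pos_def split: if_splits)
  have "sel S (Suc j) \<in> set L" using s(1) L(2) by (simp del: sel.simps)
  then obtain q0 where q0: "q0 < length L" "L ! q0 = sel S (Suc j)" by (metis in_set_conv_nth)
  have lt: "q < p \<longleftrightarrow> ct (L ! q) < ct (sel S j)" if "q < length L" "e (L ! q) = Suc j" for q
    using before[OF that(1)] content_order_iff_read_before(1)[OF inv ne assms(2) L_in(1)[OF that(1)] that(2)] by simp
  have upper: "q \<le> q0" if q: "q < length L" "e (L ! q) = Suc j" "ct (L ! q) \<le> ct (sel S (Suc j))" for q
  proof (cases "L ! q = L ! q0")
    case True
    then show ?thesis
      using sorted_read_before_distinct[OF L(1)] q(1) q0(1) nth_eq_iff_index_eq by force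
  next
    case False
    then have "ct (L ! q) < ct (L ! q0)"
      using same_letter(2)[OF L_in(2)[OF q(1)] L_in(2)[OF q0(1)]] q s(2) q0(2) by (simp del: sel.simps)
    then have "read_before (L ! q) (L ! q0)"
      using same_letter(1)[OF L_in(2)[OF q(1)] L_in(2)[OF q0(1)] _ False] q s(2) q0(2) by (simp del: sel.simps)
    then show ?thesis using sorted_read_before_nth[OF L(1) q(1) q0(1)] by simp
  qed
  have "nextpos (map e L) p (Suc j) = q0"
  proof (cases "\<exists>q < p. map e L ! q = Suc j")
    case True
    then obtain q where q: "q < p" "map e L ! q = Suc j" by blast
    then have ql: "q < length L" "e (L ! q) = Suc j" using p by auto
    have "ct (sel S (Suc j)) < ct (sel S j)" using s(3)[OF L_in(1)[OF ql(1)] ql(2)] lt[OF ql] q(1) by blast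
    then have q0p: "q0 < p" using lt[OF q0(1)] q0(2) s(2) by (simp del: sel.simps)
    have "Max {q. q < p \<and> map e L ! q = Suc j} = q0"
    proof (rule Max_eqI)
      show "finite {q. q < p \<and> map e L ! q = Suc j}" by simp
      show "q0 \<in> {q. q < p \<and> map e L ! q = Suc j}" using q0p q0 s(2) by (simp del: sel.simps)
      fix x assume "x \<in> {q. q < p \<and> map e L ! q = Suc j}"
      then have x: "x < p" "x < length L" "e (L ! x) = Suc j" using p by auto
      then have "ct (L ! x) \<le> ct (sel S (Suc j))" using s(3)[OF L_in(1)[OF x(2)] x(3)] lt[OF x(2,3)] by blast
      then show "x \<le> q0" using upper x by blast
    qed
    then show ?thesis unfolding nextpos_def if_P[OF True] .
  next
    case False
    have none: "\<not> (\<exists>y \<in> S. e y = Suc j \<and> ct y < ct (sel S j))"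
    proof
      assume "\<exists>y \<in> S. e y = Suc j \<and> ct y < ct (sel S j)"
      then obtain y where y: "y \<in> set L" "e y = Suc j" "ct y < ct (sel S j)" using L(2) by auto
      then obtain q where q: "q < length L" "L ! q = y" by (metis in_set_conv_nth)
      then have "q < p" using lt[of q] y by simp
      then show False using False q y by auto
    qed
    have "Max {q. q < length (map e L) \<and> map e L ! q = Suc j} = q0"
    proof (rule Max_eqI)
      show "finite {q. q < length (map e L) \<and> map e L ! q = Suc j}" by simp
      show "q0 \<in> {q. q < length (map e L) \<and> map e L ! q = Suc j}" using q0 s(2) by (simp del: sel.simps)
      fix x assume "x \<in> {q. q < length (map e L) \<and> map e L ! q = Suc j}"
      then have x: "x < length L" "e (L ! x) = Suc j" by auto
      then show "x \<le> q0" using upper[OF x] s(4)[OF none L_in(1)[OF x(1)] x(2)] by blast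
    qed
    then show ?thesis unfolding nextpos_def if_not_P[OF False] .
  qed
  then show ?thesis using q0 by (simp add: at_pos_def del: sel.simps)
qed

lemma marks_eq:
  assumes "at_pos j p" "j + f \<le> height S"
  shows "marks (map e L) p (Suc j) f = {q. q < length L \<and> L ! q \<in> sel S ` {Suc j..j + f}}"
  using assms
proof (induction f arbitrary: j p)
  case (Suc f)
  let ?q = "nextpos (map e L) p (Suc j)"
  have q: "at_pos (Suc j) ?q" using nextpos_at_pos[OF Suc.prems(1)] Suc.prems(2) by simp
  have IH: "marks (map e L) ?q (Suc (Suc j)) f = {q. q < length L \<and> L ! q \<in> sel S ` {Suc (Suc j)..Suc j + f}}"
    using Suc.IH[OF q] Suc.prems(2) by simp
  have "{Suc j..j + Suc f} = insert (Suc j) {Suc (Suc j)..Suc j + f}" by auto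
  then have img: "sel S ` {Suc j..j + Suc f} = insert (sel S (Suc j)) (sel S ` {Suc (Suc j)..Suc j + f})"
    by (simp only: image_insert)
  have "q' < length L \<and> L ! q' = sel S (Suc j) \<longleftrightarrow> q' = ?q" for q'
    using q nth_eq_iff_index_eq[OF sorted_read_before_distinct[OF L(1)], of q' ?q]
    by (auto simp: at_pos_def simp del: sel.simps)
  then show ?case unfolding img marks.simps Let_def IH by (auto simp del: sel.simps)
qed simp

lemma charge_word_step:
  "word_charge_aux (Suc f) (map e L) = round_charge S + word_charge_aux f (map e (filter (\<lambda>x. x \<in> rest S) L))"
proof -
  let ?w = "map e L" and ?C = "sel S ` {1..height S}"
  define M where "M = marks ?w (length ?w) 1 (Max (set ?w))"
  have "Max (set ?w) = height S" using L(2) by (simp add: height_def)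
  then have M: "M = {q. q < length L \<and> L ! q \<in> ?C}"
    unfolding M_def using marks_eq[of 0 "length L" "height S"] by (simp add: at_pos_def)
  have "map (\<lambda>q. ?w ! q) (sorted_list_of_set M) = map e (filter (\<lambda>x. x \<in> ?C) L)"
    unfolding M sorted_list_of_set_filter by (rule map_nth_filter)
  moreover have "map (\<lambda>q. ?w ! q) (filter (\<lambda>q. q \<notin> M) [0..<length ?w]) = map e (filter (\<lambda>x. x \<in> rest S) L)"
  proof -
    have "filter (\<lambda>q. q \<notin> M) [0..<length ?w] = filter (\<lambda>q. L ! q \<in> rest S) [0..<length L]"
      using L(2) by (intro filter_cong) (auto simp: M rest_def)
    then show ?thesis using map_nth_filter[of e L "\<lambda>x. x \<in> rest S"] by simp
  qed
  moreover have "L \<noteq> []" using L(2) ne by auto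
  moreover from this have "word_charge_aux (Suc f) ?w = perm_charge (map (\<lambda>q. ?w ! q) (sorted_list_of_set M))
      + word_charge_aux f (map (\<lambda>q. ?w ! q) (filter (\<lambda>q. q \<notin> M) [0..<length ?w]))"
    unfolding word_charge_aux.simps(2) Let_def M_def by simp
  ultimately have step: "word_charge_aux (Suc f) ?w
      = perm_charge (map e (filter (\<lambda>x. x \<in> ?C) L)) + word_charge_aux f (map e (filter (\<lambda>x. x \<in> rest S) L))"
    by (simp only:)
  let ?K = "filter (\<lambda>x. x \<in> ?C) L"
  note sel = sel_in[OF inv ne]
  have setK: "set ?K = ?C" using L(2) sel(1) by auto
  have K: "sorted_wrt read_before ?K" using L(1) by (rule sorted_wrt_filter)
  have dK: "distinct ?K" using K by (rule sorted_read_before_distinct)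
  have injC: "inj_on e ?C" using sel(3) by (auto simp: inj_on_def)
  have injs: "inj_on (sel S) {1..height S}" using sel(3) by (metis atLeastAtMost_iff inj_onI)
  have "length ?K = height S" using distinct_card[OF dK] setK card_image[OF injs] by simp
  then have "perm_charge (map e ?K) = round_charge S"
    unfolding round_charge_def
  proof (intro perm_charge_eq)
    fix j assume j: "1 \<le> j" "Suc j \<le> height S"
    have "sel S j \<in> set ?K" "sel S (Suc j) \<in> set ?K" using j unfolding setK by (auto simp del: sel.simps)
    then obtain p q where p: "p < length ?K" "?K ! p = sel S j" and q: "q < length ?K" "?K ! q = sel S (Suc j)"
      by (metis in_set_conv_nth)
    have "idx j (map e ?K) = p" "idx (Suc j) (map e ?K) = q"
      using idx_map_nth[OF dK _ p(1), of e] idx_map_nth[OF dK _ q(1), of e] injC sel(3)[of j] sel(3)[of "Suc j"] j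
      unfolding setK p(2) q(2) by (auto simp del: sel.simps)
    then show "idx j (map e ?K) < idx (Suc j) (map e ?K) \<longleftrightarrow> ct (sel S j) < ct (sel S (Suc j))"
      using ascent_iff_read_before[OF inv ne j(2,1)] sorted_read_before_nth[OF K p(1) q(1)] p q
      by (simp del: sel.simps)
  qed simp
  then show ?thesis using step by simp
qed

end

text \<open>Any fuel not below the number of rounds left suffices, since the word is empty after
  round \<open>m 1\<close>.\<close>

lemma word_charge_aux_remaining:
  assumes "sorted_wrt read_before L" "set L = remaining r" "r \<le> m 1" "m 1 - r \<le> f"
  shows "word_charge_aux f (map e L) = (\<Sum>s = r..<m 1. round_charge (remaining s))"
  using assms
proof (induction f arbitrary: L r)
  case 0
  then have "r = m 1" by simp
  then show ?case by simp
next
  case (Suc f)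
  show ?case
  proof (cases "r = m 1")
    case True
    then have "L = []" using Suc.prems(2) remaining_end by simp
    then show ?thesis using True by simp
  next
    case False
    then have r: "r < m 1" using Suc.prems(3) by simp
    have inv: "round_inv (remaining r) r" using round_inv_remaining r by simp
    note ne = remaining_ne[OF inv r]
    let ?L = "filter (\<lambda>x. x \<in> rest (remaining r)) L"
    have "set ?L = remaining (Suc r)" using Suc.prems(2) by (auto simp: rest_def)
    then have "word_charge_aux f (map e ?L) = (\<Sum>s = Suc r..<m 1. round_charge (remaining s))"
      using Suc.prems r by (intro Suc.IH sorted_wrt_filter) auto
    then show ?thesis
      using charge_word_step[OF inv ne Suc.prems(1,2), of f] sum.atLeast_Suc_lessThan[OF r, of "\<lambda>s. round_charge (remaining s)"]
      by (simp del: word_charge_aux.simps)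
  qed
qed

end

section \<open>The sets of selected cells\<close>

text \<open>The column in which a tableau cell appears in the counter-tableau; its row there is the
  letter in the cell.\<close>

definition abc_col :: "nat \<Rightarrow> nat \<times> nat \<Rightarrow> nat" where
  "abc_col k x = nat (int k + 2 + ct x)"

context tableau_cells
begin

text \<open>Every \<open>E_A\<close> starts in a prescribed column and not by a choice from
  \<open>V_A\<close>. The prescription is correct because the letters 1 fill an initial part of the
  bottom row and are used from the right, so after \<open>r\<close> rounds the last one left is in
  column \<open>m 1 - r\<close>.\<close>

lemma sel_1:
  assumes inv: "round_inv S r" and ne: "S \<noteq> {}"
  shows "sel S 1 = (1, m 1 - r)"
proof -
  let ?Y = "{x \<in> S. e x = 1}" and ?X = "{b. (1, b) \<in> S \<and> e (1, b) = 1}"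
  have row1: "a = 1" if "(a, b) \<in> S" "e (a, b) = 1" for a b
  proof -
    have D: "(a, b) \<in> D" using that S_sub[OF inv ne] by blast
    have p: "1 \<le> a" "1 \<le> b" using pos[OF D] by auto
    have "e (1, b) + (a - 1) \<le> 1" using col_gap[OF D, of 1 b] p that(2) by simp
    moreover have "1 \<le> e (1, b)" using e_pos[OF down[OF D, of 1 b]] p by simp
    ultimately show ?thesis using p by simp
  qed
  have Y: "?Y = Pair 1 ` ?X"
  proof (intro set_eqI)
    fix x show "x \<in> ?Y \<longleftrightarrow> x \<in> Pair 1 ` ?X" using row1 by (cases x) auto
  qed
  have "finite ?Y" using S_fin[OF inv ne] by simp
  then have finX: "finite ?X" unfolding Y by (rule finite_imageD) (auto simp: inj_on_def)
  have posX: "1 \<le> b" if "b \<in> ?X" for b using that pos[of 1 b] S_sub[OF inv ne] by auto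
  have downX: "i \<in> ?X" if "l \<in> ?X" "1 \<le> i" "i \<le> l" for i l
    using that(3,1)
  proof (induction i rule: inc_induct)
    case (step b)
    have b: "(1, Suc b) \<in> S" "e (1, Suc b) = 1" using step by auto
    have SD: "(1, Suc b) \<in> D" using b S_sub[OF inv ne] by blast
    have b1: "1 \<le> b" using step.hyps that(2) by simp
    have bD: "(1, b) \<in> D" using down[OF SD, of 1 b] b1 by simp
    have "e (1, b) = 1" using row_mono[OF SD, of b] b1 b(2) e_pos[OF bD] by simp
    then show ?case using inv b bD by (auto simp: round_inv_def left_closed_def)
  qed
  have "?X = {1..card ?X}" using finX posX downX by (intro down_closed_eq_atLeastAtMost) blast+
  moreover have "card ?X = m 1 - r"
  proof -
    have "card ?Y = card ?X" unfolding Y by (rule card_image) (auto simp: inj_on_def)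
    then show ?thesis using inv by (simp add: round_inv_def)
  qed
  ultimately have X: "?X = {1..m 1 - r}" by simp
  have h: "Suc 0 \<le> height S"
  proof -
    have "1 \<le> height S" if "x \<in> S" for x
      using letters_eq[OF inv ne] that by (metis atLeastAtMost_iff imageI le_trans)
    then show ?thesis using ne by auto
  qed
  note s = sel_Suc[OF inv ne h]
  have "sel S 1 \<in> ?Y" using s(1,2) by simp
  then obtain b where b: "sel S 1 = (1, b)" "b \<in> ?X" unfolding Y by blast
  have "m 1 - r \<in> ?X" using b(2) unfolding X by simp
  then have "ct (1, m 1 - r) \<le> ct (sel S 1)"
    using s(3)[of "(1, m 1 - r)"] ct_less_virtual[OF inv ne, of "(1, m 1 - r)"] by simp
  then have "m 1 - r \<le> b" unfolding b(1) by simp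
  moreover have "b \<le> m 1 - r" using b(2) unfolding X by simp
  ultimately show ?thesis using b(1) by simp
qed

context
  fixes k :: nat and mu :: "nat list" and V :: "(nat \<times> nat) set"
  assumes mu_1: "part mu 1 = m 1"
    and bound: "\<lbrakk>x \<in> D; y \<in> D\<rbrakk> \<Longrightarrow> ct x - ct y < int k"
    and ct_lower: "x \<in> D \<Longrightarrow> 0 \<le> int k + 2 + ct x"
    and V: "2 \<le> i \<Longrightarrow> {c. (i, c) \<in> V} = abc_col k ` {x \<in> D. e x = i}"
begin

lemma int_abc_col: "x \<in> D \<Longrightarrow> int (abc_col k x) = int k + 2 + ct x"
  using ct_lower by (simp add: abc_col_def)

lemma abc_col_less: "\<lbrakk>x \<in> D; y \<in> D\<rbrakk> \<Longrightarrow> abc_col k x < abc_col k y \<longleftrightarrow> ct x < ct y"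
  using int_abc_col[of x] int_abc_col[of y] by linarith

lemma abc_col_eq_same_letter:
  assumes "x \<in> D" "y \<in> D" "e x = e y" "abc_col k x = abc_col k y"
  shows "x = y"
proof (rule ccontr)
  assume "x \<noteq> y"
  then have "ct x \<noteq> ct y" by (rule same_letter(2)[OF assms(1-3)])
  then show False using int_abc_col[OF assms(1)] int_abc_col[OF assms(2)] assms(4) by simp
qed

definition cyc :: "nat \<times> nat \<Rightarrow> nat \<times> nat \<Rightarrow> int" where
  "cyc x y = (int (abc_col k x) - int (abc_col k y) + int k) mod int (k + 1)"

text \<open>As contents differ by less than \<open>k\<close>, the residue modulo
  \<open>k + 1\<close> involves at most one wrap: targets of smaller content lie at distance
  \<open>ct x - ct y - 1\<close>, all others one full turn further.\<close>

lemma cyc_eq: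
  assumes "x \<in> D" "y \<in> D"
  shows "cyc x y = (if ct y < ct x then ct x - ct y - 1 else int k + ct x - ct y)"
proof -
  have b: "ct x - ct y < int k" "ct y - ct x < int k" using bound assms by auto
  have c: "cyc x y = (ct x - ct y + int k) mod (int k + 1)"
    unfolding cyc_def using int_abc_col[OF assms(1)] int_abc_col[OF assms(2)] by (simp add: algebra_simps)
  show ?thesis
  proof (cases "ct y < ct x")
    case True
    have "(ct x - ct y + int k) mod (int k + 1) = (ct x - ct y - 1 + (int k + 1)) mod (int k + 1)"
      by (simp add: algebra_simps)
    also have "\<dots> = (ct x - ct y - 1) mod (int k + 1)" by (rule mod_add_self2)
    also have "\<dots> = ct x - ct y - 1" using True b by (intro mod_pos_pos_trivial) auto
    finally show ?thesis using c True by simp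
  next
    case False
    then have "(ct x - ct y + int k) mod (int k + 1) = ct x - ct y + int k"
      using b by (intro mod_pos_pos_trivial) auto
    then show ?thesis using c False by simp
  qed
qed

context
  fixes S r assumes inv: "round_inv S r" and r: "r < m 1" and ne: "S \<noteq> {}"
begin

text \<open>On either side of the wrap the distance falls as the content grows, and
  \<open>bound\<close> makes every target of smaller content nearer than any other. The cyclic
  minimum is thus the rule of \<open>pick\<close>; strictness will make each row of
  \<open>E_A\<close> a single cell.\<close>

lemma sel_cyc_minimal:
  assumes "1 \<le> j" "Suc j \<le> height S" "y \<in> S" "e y = Suc j" "y \<noteq> sel S (Suc j)"
  shows "cyc (sel S j) (sel S (Suc j)) < cyc (sel S j) y"
proof -
  note s = sel_Suc[OF inv ne assms(2)] and S = S_sub[OF inv ne]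
  have D: "sel S j \<in> D" "sel S (Suc j) \<in> D" "y \<in> D"
    using sel_in(2)[OF inv ne assms(1)] assms(2,3) s(1) S by (auto simp del: sel.simps)
  have "ct y \<noteq> ct (sel S (Suc j))" using same_letter(2)[OF D(3,2)] s(2) assms(4,5) by simp
  moreover have "ct y - ct (sel S (Suc j)) < int k" using bound D by simp
  moreover have "ct y \<le> ct (sel S (Suc j)) \<and> ct (sel S (Suc j)) < ct (sel S j)" if "ct y < ct (sel S j)"
    using s(3)[OF assms(3,4) that] by simp
  moreover have "ct y \<le> ct (sel S (Suc j))" if "\<not> ct (sel S (Suc j)) < ct (sel S j)"
    using s(3) s(4)[OF _ assms(3,4)] that by blast
  ultimately show ?thesis
    unfolding cyc_eq[OF D(1,2)] cyc_eq[OF D(1,3)] by (auto simp del: sel.simps)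
qed

lemma Erow_eq:
  assumes Av: "\<And>i. 2 \<le> i \<Longrightarrow> {c. (i, c) \<in> Av} = abc_col k ` {x \<in> S. e x = i}"
  shows "1 \<le> i \<Longrightarrow> Erow k mu Av (Suc r) i = (if i \<le> height S then {abc_col k (sel S i)} else {})"
proof (induction i rule: dec_induct)
  case base
  have "sel S 1 \<in> S" "1 \<le> height S"
  proof -
    obtain x where "x \<in> S" using ne by blast
    then have "e x \<in> {1..height S}" using letters_eq[OF inv ne] by blast
    then show "1 \<le> height S" by simp
    then show "sel S 1 \<in> S" using sel_in(1)[OF inv ne, of 1] by simp
  qed
  then have "int (abc_col k (sel S 1)) = int k + 2 + ct (1, m 1 - r)"
    using int_abc_col[of "sel S 1"] S_sub[OF inv ne] unfolding sel_1[OF inv ne] by blast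
  \<comment> \<open>Rounds are counted from 0 here but from 1 in \<open>E_A\<close>, hence
    \<open>Suc r\<close>.\<close>
  then have "abc_col k (sel S 1) = k + m 1 + 2 - Suc r" using r by simp
  then show ?case using \<open>1 \<le> height S\<close> mu_1 by (simp del: sel.simps)
next
  case (step i)
  then obtain l where l: "i = Suc l" by (cases i) auto
  let ?X = "{c. (Suc i, c) \<in> Av}" and ?Y = "{x \<in> S. e x = Suc i}"
  have X: "?X = abc_col k ` ?Y" using Av[of "Suc i"] step.hyps by simp
  have E: "Erow k mu Av (Suc r) (Suc i) = {c \<in> ?X. \<exists>c' \<in> Erow k mu Av (Suc r) i.
      (int c' - int c + int k) mod int (k + 1) = Min ((\<lambda>x. (int c' - int x + int k) mod int (k + 1)) ` ?X)}"
    unfolding l by (simp only: Erow.simps Let_def)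
  show ?case
  proof (cases "Suc i \<le> height S")
    case True
    note s = sel_Suc(1,2)[OF inv ne True]
    have IH: "Erow k mu Av (Suc r) i = {abc_col k (sel S i)}" using step.IH True by simp
    let ?d = "\<lambda>c. (int (abc_col k (sel S i)) - int c + int k) mod int (k + 1)"
    have img: "?d ` ?X = cyc (sel S i) ` ?Y" unfolding X image_image cyc_def ..
    have selY: "sel S (Suc i) \<in> ?Y" using s by (simp del: sel.simps)
    have "Min (?d ` ?X) = cyc (sel S i) (sel S (Suc i))"
      unfolding img
    proof (rule Min_eqI)
      show "finite (cyc (sel S i) ` ?Y)" using S_fin[OF inv ne] by simp
      show "cyc (sel S i) (sel S (Suc i)) \<in> cyc (sel S i) ` ?Y" using selY by (rule imageI)
      fix z assume "z \<in> cyc (sel S i) ` ?Y"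
      then obtain y where y: "z = cyc (sel S i) y" "y \<in> S" "e y = Suc i" by blast
      show "cyc (sel S i) (sel S (Suc i)) \<le> z"
      proof (cases "y = sel S (Suc i)")
        case True
        then show ?thesis using y(1) by (simp only: order_refl)
      next
        case False
        then show ?thesis
          using sel_cyc_minimal[OF step.hyps(1) \<open>Suc i \<le> height S\<close> y(2,3)] y(1) by (simp del: sel.simps)
      qed
    qed
    then have "Erow k mu Av (Suc r) (Suc i) = {c \<in> abc_col k ` ?Y. ?d c = cyc (sel S i) (sel S (Suc i))}"
      unfolding E IH X by simp
    also have "\<dots> = {abc_col k (sel S (Suc i))}"
    proof (intro equalityI subsetI)
      fix c assume "c \<in> {c \<in> abc_col k ` ?Y. ?d c = cyc (sel S i) (sel S (Suc i))}"
      then obtain y where y: "c = abc_col k y" "y \<in> S" "e y = Suc i" "?d c = cyc (sel S i) (sel S (Suc i))"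
        by blast
      then have "cyc (sel S i) y = cyc (sel S i) (sel S (Suc i))" by (simp add: cyc_def)
      then have "y = sel S (Suc i)" using sel_cyc_minimal[OF step.hyps(1) True y(2,3)] by force
      then show "c \<in> {abc_col k (sel S (Suc i))}" using y(1) by simp
    next
      fix c assume "c \<in> {abc_col k (sel S (Suc i))}"
      then have c: "c = abc_col k (sel S (Suc i))" by simp
      show "c \<in> {c \<in> abc_col k ` ?Y. ?d c = cyc (sel S i) (sel S (Suc i))}"
        unfolding c using imageI[OF selY, of "abc_col k"] by (simp add: cyc_def del: sel.simps)
    qed
    finally show ?thesis using True by simp
  next
    case False
    then have "Suc i \<notin> e ` S" using letters_eq[OF inv ne] by simp
    then have "e x \<noteq> Suc i" if "x \<in> S" for x using that by (metis imageI)
    then have "?Y = {}" by simp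
    then have "?X = {}" using X by (simp only: image_empty)
    then show ?thesis using False unfolding E by simp
  qed
qed

end

text \<open>Taking away one set of the sequence removes one column from each row up to the height.
  Columns are injective on the cells of one letter, so this is the removal of the selected
  cell.\<close>

lemma available_eq:
  "r \<le> m 1 \<Longrightarrow> 2 \<le> i \<Longrightarrow> {c. (i, c) \<in> V - Eacc k mu V r} = abc_col k ` {x \<in> remaining r. e x = i}"
proof (induction r arbitrary: i)
  case 0
  then show ?case using V by simp
next
  case (Suc r)
  let ?S = "remaining r" and ?Av = "V - Eacc k mu V r"
  have inv: "round_inv ?S r" using round_inv_remaining Suc.prems(1) by simp
  have ne: "?S \<noteq> {}" using remaining_ne[OF inv] Suc.prems(1) by simp
  have Av: "{c. (i, c) \<in> ?Av} = abc_col k ` {x \<in> ?S. e x = i}" if "2 \<le> i" for i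
    using Suc.IH[OF _ that] Suc.prems(1) by simp
  have E: "Erow k mu ?Av (Suc r) i = (if i \<le> height ?S then {abc_col k (sel ?S i)} else {})"
    using Erow_eq[OF inv _ ne Av] Suc.prems by simp
  have "{c. (i, c) \<in> V - Eacc k mu V (Suc r)} = {c. (i, c) \<in> ?Av} - Erow k mu ?Av (Suc r) i"
    using Suc.prems(2) by (auto simp: Eset_def)
  also have "\<dots> = abc_col k ` {x \<in> ?S. e x = i} - (if i \<le> height ?S then {abc_col k (sel ?S i)} else {})"
    unfolding E Av[OF Suc.prems(2)] ..
  also have "\<dots> = abc_col k ` {x \<in> remaining (Suc r). e x = i}"
  proof (cases "i \<le> height ?S")
    case True
    have i1: "1 \<le> i" using Suc.prems(2) by simp
    note s = sel_in[OF inv ne i1 True]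
    have sub: "{x \<in> ?S. e x = i} \<subseteq> {x \<in> D. e x = i}" using S_sub[OF inv ne] by blast
    have "x \<in> rest ?S \<longleftrightarrow> x \<noteq> sel ?S i" if "x \<in> ?S" "e x = i" for x
    proof -
      have "x \<in> sel ?S ` {1..height ?S} \<longleftrightarrow> x = sel ?S i"
        using that i1 True sel_in(3)[OF inv ne] by auto
      then show ?thesis using that by (simp add: rest_def)
    qed
    then have "{x \<in> remaining (Suc r). e x = i} = {x \<in> ?S. e x = i} - {sel ?S i}"
      by (auto simp: rest_def)
    moreover have "inj_on (abc_col k) {x \<in> ?S. e x = i}"
    proof (rule inj_onI)
      fix x y assume xy: "x \<in> {x \<in> ?S. e x = i}" "y \<in> {x \<in> ?S. e x = i}" "abc_col k x = abc_col k y"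
      then have "x \<in> D" "y \<in> D" "e x = e y" using sub by auto
      then show "x = y" using xy(3) by (rule abc_col_eq_same_letter)
    qed
    ultimately show ?thesis using True s(1,3) by (simp add: inj_on_image_set_diff[where C = "{x \<in> ?S. e x = i}"])
  next
    case False
    then have "i \<notin> e ` ?S" using letters_eq[OF inv ne] by simp
    then have "{x \<in> ?S. e x = i} = {}" "{x \<in> remaining (Suc r). e x = i} = {}" by (auto simp: rest_def)
    then show ?thesis using False by (simp only: image_empty) simp
  qed
  finally show ?case .
qed

lemma perm_charge_Eset:
  assumes "r < m 1"
  shows "perm_charge (reading_word (Eset k mu V (Eacc k mu V r) (Suc r))) = round_charge (remaining r)"
proof -
  let ?S = "remaining r"
  have inv: "round_inv ?S r" using round_inv_remaining assms by simp
  have ne: "?S \<noteq> {}" using remaining_ne[OF inv] assms by simp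
  have h: "1 \<le> height ?S"
  proof -
    obtain x where "x \<in> ?S" using ne by blast
    then have "e x \<in> {1..height ?S}" using letters_eq[OF inv ne] by blast
    then show ?thesis by simp
  qed
  have Av: "{c. (i, c) \<in> V - Eacc k mu V r} = abc_col k ` {x \<in> ?S. e x = i}" if "2 \<le> i" for i
    using available_eq[OF _ that] assms by simp
  have "Eset k mu V (Eacc k mu V r) (Suc r) = (\<lambda>i. (i, abc_col k (sel ?S i))) ` {1..height ?S}"
  proof (intro set_eqI)
    fix y :: "nat \<times> nat"
    obtain i c where y: "y = (i, c)" by (metis surj_pair)
    show "y \<in> Eset k mu V (Eacc k mu V r) (Suc r) \<longleftrightarrow> y \<in> (\<lambda>i. (i, abc_col k (sel ?S i))) ` {1..height ?S}"
    proof (cases "1 \<le> i")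
      case True
      then show ?thesis using Erow_eq[OF inv assms ne Av True] by (auto simp: Eset_def y image_iff)
    qed (auto simp: Eset_def y)
  qed
  then have "perm_charge (reading_word (Eset k mu V (Eacc k mu V r) (Suc r)))
      = (\<Sum>i = 1..height ?S. card {j. 1 \<le> j \<and> j < i \<and> abc_col k (sel ?S j) < abc_col k (sel ?S (Suc j))})"
    using h by (rule perm_charge_reading_word)
  also have "\<dots> = round_charge ?S" unfolding round_charge_def
  proof (rule sum.cong[OF refl])
    fix i assume i: "i \<in> {1..height ?S}"
    have "abc_col k (sel ?S j) < abc_col k (sel ?S (Suc j)) \<longleftrightarrow> ct (sel ?S j) < ct (sel ?S (Suc j))"
      if "1 \<le> j" "j < i" for j
      using i that by (intro abc_col_less sel_in(2)[OF inv ne]) auto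
    then have "{j. 1 \<le> j \<and> j < i \<and> abc_col k (sel ?S j) < abc_col k (sel ?S (Suc j))}
        = {j. 1 \<le> j \<and> j < i \<and> ct (sel ?S j) < ct (sel ?S (Suc j))}" by (intro Collect_cong) blast
    then show "card {j. 1 \<le> j \<and> j < i \<and> abc_col k (sel ?S j) < abc_col k (sel ?S (Suc j))}
        = card {j. 1 \<le> j \<and> j < i \<and> ct (sel ?S j) < ct (sel ?S (Suc j))}" by (rule arg_cong)
  qed
  finally show ?thesis .
qed

end

end

section \<open>The bijection\<close>

definition row_cells :: "nat list \<Rightarrow> nat \<Rightarrow> (nat \<times> nat) list" where
  "row_cells la r = map (Pair r) [1..<Suc (part la r)]"

definition reading_cells :: "nat list \<Rightarrow> (nat \<times> nat) list" where
  "reading_cells la = concat (map (row_cells la) (rev [1..<Suc (length la)]))"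

lemma sorted_reading_cells: "sorted_wrt read_before (reading_cells la)"
proof -
  have "sorted_wrt read_before (concat (map (row_cells la) rs))" if "sorted_wrt (>) rs" for rs
    using that
  proof (induction rs)
    case (Cons r rs)
    have "sorted_wrt read_before (row_cells la r)"
      unfolding row_cells_def sorted_wrt_map
      by (rule sorted_wrt_mono_rel[OF _ sorted_wrt_upt]) simp
    moreover have "read_before x y"
      if "x \<in> set (row_cells la r)" "y \<in> set (concat (map (row_cells la) rs))" for x y
      using that Cons.prems by (auto simp: row_cells_def simp del: upt_Suc)
    ultimately show ?case using Cons by (simp add: sorted_wrt_append)
  qed simp
  moreover have "sorted_wrt (>) (rev [1..<Suc (length la)])"
    unfolding sorted_wrt_rev by (rule sorted_wrt_upt)
  ultimately show ?thesis unfolding reading_cells_def by blast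
qed

lemma set_reading_cells: "set (reading_cells la) = cells la"
proof (intro set_eqI)
  fix x :: "nat \<times> nat"
  obtain r c where x: "x = (r, c)" by (metis surj_pair)
  have "r \<le> length la" if "1 \<le> c" "c \<le> part la r" using that by (auto simp: part_def split: if_splits)
  then show "x \<in> set (reading_cells la) \<longleftrightarrow> x \<in> cells la"
    unfolding x
    by (auto simp: reading_cells_def row_cells_def image_iff simp del: upt_Suc intro!: bexI[of _ r])
qed

context
  fixes la mu :: "nat list" and T :: "nat list list"
  assumes la: "is_partition la" and mu: "is_partition mu" and T: "is_SSYT la mu T"
begin

lemma map_entry_reading_cells: "map (entry T) (reading_cells la) = concat (rev T)"
proof -
  note len = SSYT_length[OF la mu T]
  have row: "map (entry T) (row_cells la r) = T ! (r - 1)" if "1 \<le> r" "r \<le> length T" for r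
  proof (rule nth_equalityI)
    show "length (map (entry T) (row_cells la r)) = length (T ! (r - 1))"
      using SSYT_row_length[OF la mu T that] by (simp add: row_cells_def del: upt_Suc)
    fix i assume "i < length (map (entry T) (row_cells la r))"
    then show "map (entry T) (row_cells la r) ! i = T ! (r - 1) ! i"
      by (simp add: row_cells_def entry_def del: upt_Suc)
  qed
  have "map (map (entry T) \<circ> row_cells la) [1..<Suc (length la)] = T"
  proof (rule nth_equalityI)
    show "length (map (map (entry T) \<circ> row_cells la) [1..<Suc (length la)]) = length T"
      by (simp add: len del: upt_Suc)
    fix i assume "i < length (map (map (entry T) \<circ> row_cells la) [1..<Suc (length la)])"
    then show "map (map (entry T) \<circ> row_cells la) [1..<Suc (length la)] ! i = T ! i"
      using row[of "Suc i"] len by (simp del: upt_Suc)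
  qed
  then show ?thesis
    by (simp add: reading_cells_def map_concat rev_map[symmetric] del: upt_Suc)
qed

lemma card_letter:
  assumes "1 \<le> j"
  shows "card {x \<in> cells la. entry T x = j} = part mu j"
proof -
  have count: "count_list (concat (rev T)) j = count_list (concat T) j" by (induction T) auto
  have "{x \<in> cells la. entry T x = j} = set (filter (\<lambda>x. entry T x = j) (reading_cells la))"
    by (simp only: set_filter set_reading_cells)
  also have "card \<dots> = length (filter (\<lambda>x. entry T x = j) (reading_cells la))"
    using sorted_read_before_distinct[OF sorted_reading_cells] by (intro distinct_card distinct_filter)
  also have "\<dots> = count_list (map (entry T) (reading_cells la)) j"
    by (simp add: count_list_eq_length_filter filter_map comp_def eq_commute[of j])
  also have "\<dots> = count_list (concat T) j"
    unfolding map_entry_reading_cells by (rule count)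
  also have "\<dots> = part mu j" using T assms by (simp add: is_SSYT_def)
  finally show ?thesis .
qed

lemma tableau_cells_entry: "tableau_cells (cells la) (entry T) (part mu) (part la 1)"
proof
  show "finite (cells la)" using set_reading_cells by (metis List.finite_set)
  show "1 \<le> a \<and> 1 \<le> b \<and> b \<le> part la 1" if "(a, b) \<in> cells la" for a b
    using that part_antimono[OF la, of 1 a] by simp
  show "(a, b) \<in> cells la" if "(a', b') \<in> cells la" "1 \<le> a" "a \<le> a'" "1 \<le> b" "b \<le> b'" for a b a' b'
    using that part_antimono[OF la, of a a'] by simp
  show "1 \<le> entry T x" if "x \<in> cells la" for x
    using that entry_pos[OF la mu T] by (cases x) simp
  show "entry T (a, b) \<le> entry T (a, b')" if "(a, b') \<in> cells la" "1 \<le> b" "b \<le> b'" for a b b'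
    using that entry_le_iff[OF la mu T, of b a "entry T (a, b')"] entry_le_iff[OF la mu T, of b' a "entry T (a, b')"]
    by simp
  show "entry T (a, b) < entry T (Suc a, b)" if "(Suc a, b) \<in> cells la" "1 \<le> a" for a b
    using that entry_column_less[OF la mu T, of a b] by simp
  show "card {x \<in> cells la. entry T x = j} = part mu j" if "1 \<le> j" for j
    using that by (rule card_letter)
  show "part mu j \<le> part mu i" if "1 \<le> i" "i \<le> j" for i j
    using that by (rule part_antimono[OF mu])
qed

lemma V_A_shapes_of:
  assumes n: "1 \<le> n" "sum_list la = n" "sum_list mu = n" and i: "2 \<le> i"
  shows "{c. (i, c) \<in> V_A n mu (shapes_of (length mu) T)} = abc_col n ` {x \<in> cells la. entry T x = i}"
proof (cases "i \<le> length mu")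
  case True
  let ?A = "shapes_of (length mu) T"
  have A: "?A \<in> ABC_set n la mu" using shapes_of_in_ABC_set[OF la mu T n] .
  then have len: "length ?A = length mu"
    and parts: "\<And>i. i \<le> length mu \<Longrightarrow> is_partition (lamA ?A i) \<and> sum_list (lamA ?A i) = sum_list (take i mu)"
    and strips: "\<And>i. i < length mu \<Longrightarrow> hstrip (lamA ?A i) (lamA ?A (Suc i))"
    unfolding ABC_set_iff[OF n(1) la n(2) mu n(3)] by auto
  obtain l where l: "i = Suc l" "1 \<le> l" "l < length mu" using i True by (cases i) auto
  have "i \<in> {1..length ?A}" using i True len by simp
  then have bss: "is_bss n (lamA ?A (i - 1)) (lamA ?A i) (n - mu ! (i - 1))"
    using A unfolding ABC_set_def is_ABC_def by blast
  have pos: "1 \<le> mu ! j" if "j < length mu" for j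
    using part_pos_iff[OF mu, of "Suc j"] that by (simp add: part_def)
  have sum: "sum_list (take (Suc l) mu) = sum_list (take l mu) + mu ! l"
    using l by (simp add: take_Suc_conv_app_nth)
  have le: "sum_list (take (Suc l) mu) \<le> n" using sum_list_take_le[of "Suc l" mu] n by simp
  \<comment> \<open>From the second row on, the positive first part of \<open>mu\<close> lies below,
    so the current part is less than \<open>n\<close>, as \<open>V_A_row\<close> demands.\<close>
  have "mu ! 0 \<le> sum_list (take l mu)" using l by (cases mu; cases l) auto
  then have lt: "mu ! l < n" using pos[of 0] sum le l by fastforce
  have "{c. (i, c) \<in> V_A n mu ?A} = Suc ` content_cols n (lamA ?A l) (lamA ?A i)"
    using V_A_row[of ?A i mu n] bss parts[of l] parts[of i] strips[of l] sum le lt pos[of l] l len by simp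
  also have "\<dots> = abc_col n ` {x \<in> cells la. entry T x = i}"
  proof (intro set_eqI)
    have long: "part la 1 + length la \<le> n + 1" using first_part_length_le[OF la] n by simp
    have cell: "part (lamA ?A l) r < c \<and> c \<le> part (lamA ?A i) r \<longleftrightarrow> (r, c) \<in> cells la \<and> entry T (r, c) = i"
      if "1 \<le> r" for r c
    proof -
      have p: "part (lamA ?A l) r = row_count T l r" "part (lamA ?A i) r = row_count T (Suc l) r"
        using part_lamA_shapes_of[OF la mu T _ that] l by auto
      show ?thesis
      proof (cases "1 \<le> c \<and> c \<le> part la r")
        case True
        then show ?thesis
          using p that entry_le_iff[OF la mu T, of c r l] entry_le_iff[OF la mu T, of c r "Suc l"] l(1) by auto
      next
        case False
        then show ?thesis using p row_count_le[OF la mu T, of "Suc l" r] by auto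
      qed
    qed
    have col: "p + r = n + 1 + c \<longleftrightarrow> Suc p = abc_col n (r, c)" if "(r, c) \<in> cells la" for p r c
    proof -
      have "r \<le> length la" using that by (auto simp: part_def split: if_splits)
      then show ?thesis using long unfolding abc_col_def by auto
    qed
    fix c' :: nat
    show "c' \<in> Suc ` content_cols n (lamA ?A l) (lamA ?A i) \<longleftrightarrow> c' \<in> abc_col n ` {x \<in> cells la. entry T x = i}"
    proof
      assume "c' \<in> Suc ` content_cols n (lamA ?A l) (lamA ?A i)"
      then obtain p r c where "c' = Suc p" "1 \<le> r" "part (lamA ?A l) r < c" "c \<le> part (lamA ?A i) r" "p + r = n + 1 + c"
        unfolding content_cols_def by blast
      then have "(r, c) \<in> {x \<in> cells la. entry T x = i}" "c' = abc_col n (r, c)"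
        using cell[of r c] col[of r c p] by auto
      then show "c' \<in> abc_col n ` {x \<in> cells la. entry T x = i}" by blast
    next
      assume "c' \<in> abc_col n ` {x \<in> cells la. entry T x = i}"
      then obtain r c where x: "(r, c) \<in> cells la" "entry T (r, c) = i" "c' = abc_col n (r, c)" by auto
      have r: "1 \<le> r" "r \<le> length la" using x(1) by (auto simp: part_def split: if_splits)
      have rc: "part (lamA ?A l) r < c" "c \<le> part (lamA ?A i) r" using cell[OF r(1), of c] x by auto
      define p where "p = n + 1 + c - r"
      have p: "p + r = n + 1 + c" using r long by (simp add: p_def)
      then have "p \<in> content_cols n (lamA ?A l) (lamA ?A i)" unfolding content_cols_def using r rc by blast
      moreover have "c' = Suc p" using col[OF x(1), of p] p x(3) by simp
      ultimately show "c' \<in> Suc ` content_cols n (lamA ?A l) (lamA ?A i)" by blast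
    qed
  qed
  finally show ?thesis .
next
  case False
  interpret tableau_cells "cells la" "entry T" "part mu" "part la 1" by (rule tableau_cells_entry)
  have "card {x \<in> cells la. entry T x = i} = 0" using card_letter[of i] False i by (simp add: part_def)
  then have "{x \<in> cells la. entry T x = i} = {}" using fin by simp
  moreover have "{c. (i, c) \<in> V_A n mu (shapes_of (length mu) T)} = {}"
    using False by (simp add: V_A_def shapes_of_def del: upt_Suc)
  ultimately show ?thesis by (simp only: image_empty)
qed

lemma charge_preserved:
  assumes n: "1 \<le> n" "sum_list la = n" "sum_list mu = n"
  shows "ABC_charge n mu (shapes_of (length mu) T) = tab_charge T"
proof -
  interpret tableau_cells "cells la" "entry T" "part mu" "part la 1" by (rule tableau_cells_entry)
  let ?V = "V_A n mu (shapes_of (length mu) T)"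
  have long: "part la 1 + length la \<le> n + 1" using first_part_length_le[OF la] n by simp
  have ct: "1 - int (length la) \<le> ct x \<and> ct x \<le> int (part la 1) - 1" if "x \<in> cells la" for x
  proof -
    obtain a b where x: "x = (a, b)" by (metis surj_pair)
    have "1 \<le> a" "a \<le> length la" "1 \<le> b" "b \<le> part la 1"
      using that pos[of a b] unfolding x by (auto simp: part_def split: if_splits)
    then show ?thesis unfolding x by simp
  qed
  \<comment> \<open>Contents run from \<open>1 - length la\<close> to \<open>part la 1 - 1\<close>,
    so their spread is at most \<open>part la 1 + length la - 2 \<le> n - 1\<close>.\<close>
  have bound: "ct x - ct y < int n" if "x \<in> cells la" "y \<in> cells la" for x y
    using ct[OF that(1)] ct[OF that(2)] long by linarith
  have lower: "0 \<le> int n + 2 + ct x" if "x \<in> cells la" for x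
    using ct[OF that] long by linarith
  have charge: "perm_charge (reading_word (E_A n mu (shapes_of (length mu) T) (Suc r))) = round_charge (remaining r)"
    if "r < part mu 1" for r
    using perm_charge_Eset[OF refl bound lower V_A_shapes_of[OF n] that] by (simp add: E_A_def)
  have "ABC_charge n mu (shapes_of (length mu) T)
      = (\<Sum>r<part mu 1. perm_charge (reading_word (E_A n mu (shapes_of (length mu) T) (Suc r))))"
    unfolding ABC_charge_def by (simp add: sum.atLeast1_atMost_eq)
  also have "\<dots> = (\<Sum>r = 0..<part mu 1. round_charge (remaining r))"
    using charge by (simp add: atLeast0LessThan)
  also have "\<dots> = word_charge_aux (length (reading_cells la)) (map (entry T) (reading_cells la))"
  proof (rule word_charge_aux_remaining[symmetric])
    show "sorted_wrt read_before (reading_cells la)" by (rule sorted_reading_cells)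
    show "set (reading_cells la) = remaining 0" by (simp only: set_reading_cells remaining.simps)
    \<comment> \<open>The fuel suffices: every round consumes a different letter 1, so there are no
      more rounds than cells.\<close>
    have "part mu 1 = card {x \<in> cells la. entry T x = 1}" using card_letter[of 1] by simp
    also have "\<dots> \<le> card (cells la)" using fin by (intro card_mono) auto
    also have "\<dots> = length (reading_cells la)"
      using distinct_card[OF sorted_read_before_distinct[OF sorted_reading_cells]] by (simp add: set_reading_cells)
    finally show "part mu 1 - 0 \<le> length (reading_cells la)" by simp
  qed simp
  also have "\<dots> = tab_charge T"
    unfolding tab_charge_def word_charge_def map_entry_reading_cells[symmetric] by simp
  finally show ?thesis .
qed

end

theorem mainTheorem1:
  fixes n :: nat and la mu :: "nat list"
  assumes "1 \<le> n"
    and "is_partition la" and "sum_list la = n"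
    and "is_partition mu" and "sum_list mu = n"
  shows "\<exists>f. bij_betw f (ABC_set n la mu) (SSYT_set la mu)
           \<and> (\<forall>A \<in> ABC_set n la mu. ABC_charge n mu A = tab_charge (f A))"
proof -
  \<comment> \<open>The explicit map runs from tableaux to counter-tableaux; the bijection claimed
    is its inverse.\<close>
  let ?g = "shapes_of (length mu)"
  have g: "bij_betw ?g (SSYT_set la mu) (ABC_set n la mu)"
    unfolding bij_betw_def
  proof
    show "inj_on ?g (SSYT_set la mu)" using inj_on_shapes_of assms by blast
    show "?g ` SSYT_set la mu = ABC_set n la mu"
    proof
      show "?g ` SSYT_set la mu \<subseteq> ABC_set n la mu"
        using shapes_of_in_ABC_set assms by (auto simp: SSYT_set_def)
      show "ABC_set n la mu \<subseteq> ?g ` SSYT_set la mu"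
        using shapes_of_surj[OF assms(2,4,1,3,5)] by blast
    qed
  qed
  let ?f = "inv_into (SSYT_set la mu) ?g"
  have "ABC_charge n mu A = tab_charge (?f A)" if "A \<in> ABC_set n la mu" for A
  proof -
    have "A \<in> ?g ` SSYT_set la mu" using g that by (simp add: bij_betw_def)
    then have "?f A \<in> SSYT_set la mu" "?g (?f A) = A" by (rule inv_into_into, rule f_inv_into_f)
    then show ?thesis
      using charge_preserved[OF assms(2,4) _ assms(1,3,5), of "?f A"] by (simp add: SSYT_set_def)
  qed
  then show ?thesis using bij_betw_inv_into[OF g] by blast
qed

end
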